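(* A biharmonic map $\varphi: (M^m,g)\to S^n$ into a sphere with constant energy density $|d\varphi|^2=c$ and $\Delta^2\phi=-\mu\,\Delta\phi$ for some function $\mu$ on $M$, where $\phi=i\circ\varphi$ and $i: S^n\to\mathbb{R}^{n+1}$ is the standard isometric embedding, is either harmonic or $\mu=2c$.
   Context: $(M^m,g)$ is an $m$-dimensional Riemannian manifold and $S^n\subset\mathbb{R}^{n+1}$ is the unit sphere centered at the origin with its standard metric. $\Delta f=\mathrm{div}(\nabla f)$ is the Laplace operator of $(M,g)$ acting on functions; it is applied componentwise to $\mathbb{R}^{n+1}$-valued maps, and $\Delta^2\phi=\Delta(\Delta\phi)$. The energy density $|d\varphi|^2$ is the squared norm of the differential of $\varphi$, i.e. the trace with respect to $g$ of the pullback by $\varphi$ of the metric of $S^n$. For a map $\varphi:(M,g)\to(N,h)$ between Riemannian manifolds, $\tau(\varphi)=\mathrm{Tr}_g\nabla d\varphi$ is its tension field; $\varphi$ is harmonic if $\tau(\varphi)=0$, and biharmonic if it is a critical point of the bienergy functional $E_2(\varphi)=\frac12\int_M|\tau(\varphi)|^2\,dv_g$.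
   Formalization: The manifold M is assumed connected; on a disconnected M the dichotomy can fail, for instance for a unit-speed great circle and a unit-speed circle of radius 1/√2 in S², taken as two components. *)

theory Defs
  imports "HOL-Analysis.Analysis"
begin

section \<open>Smooth functions on open subsets of Euclidean spaces\<close>

definition dir_deriv ::
  "'v \<Rightarrow> ('v::real_normed_vector \<Rightarrow> 'w::real_normed_vector) \<Rightarrow> 'v \<Rightarrow> 'w"
  where "dir_deriv v f x = frechet_derivative f (at x) v"

abbreviation partial ::
  "'m::finite \<Rightarrow> (real^'m \<Rightarrow> 'w::real_normed_vector) \<Rightarrow> real^'m \<Rightarrow> 'w"
  where "partial i \<equiv> dir_deriv (axis i 1)"

text \<open>For open \<open>U\<close> this is \<open>C\<^sup>\<infinity>\<close>: all iterated directional derivatives exist and are differentiable,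
  hence continuous, on \<open>U\<close>.\<close>

definition smooth_on ::
  "'v::real_normed_vector set \<Rightarrow> ('v \<Rightarrow> 'w::real_normed_vector) \<Rightarrow> bool"
  where "smooth_on U f \<longleftrightarrow>
    (\<forall>vs. \<forall>x\<in>U. foldr dir_deriv vs f differentiable (at x))"


section \<open>Riemannian manifolds\<close>

text \<open>A chart is a coordinate domain together with the coordinate map; the values of that map outside
  the domain are irrelevant. For a chart \<open>c\<close> in the atlas, \<open>metric M c x\<close> is the
  Gram matrix \<open>(g\<^sub>i\<^sub>j)\<close> of the coordinate vector fields at the point with coordinates \<open>x\<close>.\<close>

text \<open>Coordinates are indexed by a finite type \<open>'m\<close> with \<open>CARD('m) = m\<close>. Where the change of variables
  theorem of the library is relevant, \<open>'m\<close> is to be taken of sort \<open>{finite, wellorder}\<close>, which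
  is no restriction on the dimension.\<close>

type_synonym ('a, 'm) chart = "'a set \<times> ('a \<Rightarrow> real^'m)"

record ('a, 'm::finite) riem =
  mtop :: "'a topology"
  atlas :: "('a, 'm) chart set"
  metric :: "('a, 'm) chart \<Rightarrow> real^'m \<Rightarrow> real^'m^'m"

abbreviation chart_dom :: "('a, 'm::finite) chart \<Rightarrow> 'a set"
  where "chart_dom c \<equiv> fst c"

abbreviation chart_map :: "('a, 'm::finite) chart \<Rightarrow> 'a \<Rightarrow> real^'m"
  where "chart_map c \<equiv> snd c"

definition chart_inv :: "('a, 'm::finite) chart \<Rightarrow> real^'m \<Rightarrow> 'a"
  where "chart_inv c = inv_into (chart_dom c) (chart_map c)"

definition transition ::
  "('a, 'm::finite) chart \<Rightarrow> ('a, 'm) chart \<Rightarrow> real^'m \<Rightarrow> real^'m"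
  where "transition c d = chart_map d \<circ> chart_inv c"

definition smooth_manifold :: "('a, 'm::finite, 'z) riem_scheme \<Rightarrow> bool"
  where "smooth_manifold M \<longleftrightarrow>
    Hausdorff_space (mtop M) \<and> second_countable (mtop M) \<and>
    (\<Union>c\<in>atlas M. chart_dom c) = topspace (mtop M) \<and>
    (\<forall>c\<in>atlas M.
       openin (mtop M) (chart_dom c) \<and> open (chart_map c ` chart_dom c) \<and>
       homeomorphic_map (subtopology (mtop M) (chart_dom c))
         (top_of_set (chart_map c ` chart_dom c)) (chart_map c)) \<and>
    (\<forall>c\<in>atlas M. \<forall>d\<in>atlas M.
       smooth_on (chart_map c ` (chart_dom c \<inter> chart_dom d)) (transition c d))"

definition riemannian_manifold :: "('a, 'm::finite, 'z) riem_scheme \<Rightarrow> bool"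
  where "riemannian_manifold M \<longleftrightarrow>
    smooth_manifold M \<and>
    (\<forall>c\<in>atlas M. smooth_on (chart_map c ` chart_dom c) (metric M c)) \<and>
    (\<forall>c\<in>atlas M. \<forall>x\<in>chart_map c ` chart_dom c.
       transpose (metric M c x) = metric M c x \<and>
       (\<forall>v. v \<noteq> 0 \<longrightarrow> v \<bullet> (metric M c x *v v) > 0)) \<and>
    (\<forall>c\<in>atlas M. \<forall>d\<in>atlas M. \<forall>x\<in>chart_map c ` (chart_dom c \<inter> chart_dom d). \<forall>i j.
       metric M c x $ i $ j =
         partial i (transition c d) x \<bullet>
           (metric M d (transition c d x) *v partial j (transition c d) x))"

text \<open>The objects below are tensorial, so they may be computed in any chart around a point; we fix one.\<close>

definition chart_at :: "('a, 'm::finite, 'z) riem_scheme \<Rightarrow> 'a \<Rightarrow> ('a, 'm) chart"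
  where "chart_at M p = (SOME c. c \<in> atlas M \<and> p \<in> chart_dom c)"

definition inv_metric ::
  "('a, 'm::finite, 'z) riem_scheme \<Rightarrow> ('a, 'm) chart \<Rightarrow> real^'m \<Rightarrow> real^'m^'m"
  where "inv_metric M c x = matrix_inv (metric M c x)"

definition metric_trace ::
  "('a, 'm::finite, 'z) riem_scheme \<Rightarrow> ('a, 'm) chart \<Rightarrow> real^'m
     \<Rightarrow> ('m \<Rightarrow> 'm \<Rightarrow> 'w::real_vector) \<Rightarrow> 'w"
  where "metric_trace M c x B = (\<Sum>i\<in>UNIV. \<Sum>j\<in>UNIV. inv_metric M c x $ i $ j *\<^sub>R B i j)"

definition volume_density ::
  "('a, 'm::finite, 'z) riem_scheme \<Rightarrow> ('a, 'm) chart \<Rightarrow> real^'m \<Rightarrow> real"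
  where "volume_density M c x = sqrt (det (metric M c x))"

text \<open>\<open>christoffel M c x k i j\<close> is the Christoffel symbol \<open>\<Gamma>\<^sup>k\<^sub>i\<^sub>j\<close> of the Levi-Civita connection.\<close>

definition christoffel ::
  "('a, 'm::finite, 'z) riem_scheme \<Rightarrow> ('a, 'm) chart \<Rightarrow> real^'m \<Rightarrow> 'm \<Rightarrow> 'm \<Rightarrow> 'm \<Rightarrow> real"
  where "christoffel M c x k i j =
    (\<Sum>l\<in>UNIV. inv_metric M c x $ k $ l *
       (partial i (\<lambda>y. metric M c y $ j $ l) x
      + partial j (\<lambda>y. metric M c y $ i $ l) x
      - partial l (\<lambda>y. metric M c y $ i $ j) x)) / 2"


section \<open>The Laplace operator\<close>

definition gradient_coords ::
  "('a, 'm::finite, 'z) riem_scheme \<Rightarrow> ('a, 'm) chart \<Rightarrow> ('a \<Rightarrow> real) \<Rightarrow> real^'m \<Rightarrow> real^'m"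
  where "gradient_coords M c f x =
    (\<chi> i. \<Sum>j\<in>UNIV. inv_metric M c x $ i $ j * partial j (f \<circ> chart_inv c) x)"

definition divergence_coords ::
  "('a, 'm::finite, 'z) riem_scheme \<Rightarrow> ('a, 'm) chart \<Rightarrow> (real^'m \<Rightarrow> real^'m) \<Rightarrow> real^'m \<Rightarrow> real"
  where "divergence_coords M c X x =
    (\<Sum>i\<in>UNIV. partial i (\<lambda>y. volume_density M c y * X y $ i) x) / volume_density M c x"

definition laplacian ::
  "('a, 'm::finite, 'z) riem_scheme \<Rightarrow> ('a \<Rightarrow> real) \<Rightarrow> 'a \<Rightarrow> real"
  where "laplacian M f p =
    (let c = chart_at M p in divergence_coords M c (gradient_coords M c f) (chart_map c p))"

definition vec_laplacian ::
  "('a, 'm::finite, 'z) riem_scheme \<Rightarrow> ('a \<Rightarrow> 'v::euclidean_space) \<Rightarrow> 'a \<Rightarrow> 'v"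
  where "vec_laplacian M f p = (\<Sum>b\<in>Basis. laplacian M (\<lambda>q. f q \<bullet> b) p *\<^sub>R b)"


section \<open>Maps between Riemannian manifolds\<close>

definition coord_rep ::
  "('a, 'm::finite) chart \<Rightarrow> ('b, 'n::finite) chart \<Rightarrow> ('a \<Rightarrow> 'b) \<Rightarrow> real^'m \<Rightarrow> real^'n"
  where "coord_rep c d \<phi> = chart_map d \<circ> \<phi> \<circ> chart_inv c"

definition smooth_map ::
  "('a, 'm::finite, 'y) riem_scheme \<Rightarrow> ('b, 'n::finite, 'z) riem_scheme \<Rightarrow> ('a \<Rightarrow> 'b) \<Rightarrow> bool"
  where "smooth_map M N \<phi> \<longleftrightarrow>
    continuous_map (mtop M) (mtop N) \<phi> \<and>
    (\<forall>c\<in>atlas M. \<forall>d\<in>atlas N.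
       smooth_on (chart_map c ` (chart_dom c \<inter> \<phi> -` chart_dom d)) (coord_rep c d \<phi>))"

definition pullback_metric ::
  "('b, 'n::finite, 'z) riem_scheme \<Rightarrow> ('a, 'm::finite) chart \<Rightarrow> ('b, 'n) chart
     \<Rightarrow> ('a \<Rightarrow> 'b) \<Rightarrow> real^'m \<Rightarrow> 'm \<Rightarrow> 'm \<Rightarrow> real"
  where "pullback_metric N c d \<phi> x i j =
    partial i (coord_rep c d \<phi>) x \<bullet>
      (metric N d (coord_rep c d \<phi> x) *v partial j (coord_rep c d \<phi>) x)"

definition energy_density ::
  "('a, 'm::finite, 'y) riem_scheme \<Rightarrow> ('b, 'n::finite, 'z) riem_scheme
     \<Rightarrow> ('a \<Rightarrow> 'b) \<Rightarrow> 'a \<Rightarrow> real"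
  where "energy_density M N \<phi> p =
    (let c = chart_at M p; d = chart_at N (\<phi> p); x = chart_map c p
     in metric_trace M c x (pullback_metric N c d \<phi> x))"

text \<open>\<open>second_fundamental_form M N c d \<phi> x i j\<close> has the components
  \<open>\<partial>\<^sub>i\<partial>\<^sub>jF\<^sup>a - \<Gamma>\<^sup>k\<^sub>i\<^sub>j \<partial>\<^sub>kF\<^sup>a + (\<Gamma>\<^sup>a\<^sub>b\<^sub>c \<circ> F) \<partial>\<^sub>iF\<^sup>b \<partial>\<^sub>jF\<^sup>c\<close>
  of \<open>\<nabla>d\<phi>(\<partial>\<^sub>i, \<partial>\<^sub>j)\<close> in the chart \<open>d\<close>, where \<open>F\<close> is the coordinate representation
  of \<open>\<phi>\<close> and \<open>\<nabla>\<close> is induced by the Levi-Civita connections of \<open>M\<close> and \<open>N\<close>.\<close>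

definition second_fundamental_form ::
  "('a, 'm::finite, 'y) riem_scheme \<Rightarrow> ('b, 'n::finite, 'z) riem_scheme
     \<Rightarrow> ('a, 'm) chart \<Rightarrow> ('b, 'n) chart \<Rightarrow> ('a \<Rightarrow> 'b) \<Rightarrow> real^'m \<Rightarrow> 'm \<Rightarrow> 'm \<Rightarrow> real^'n"
  where "second_fundamental_form M N c d \<phi> x i j =
    (let F = coord_rep c d \<phi> in
     \<chi> a. partial i (partial j F) x $ a
        - (\<Sum>k\<in>UNIV. christoffel M c x k i j * partial k F x $ a)
        + (\<Sum>b\<in>UNIV. \<Sum>e\<in>UNIV.
             christoffel N d (F x) a b e * partial i F x $ b * partial j F x $ e))"

text \<open>The components of the tension field at \<open>p\<close> refer to the chart \<open>chart_at N (\<phi> p)\<close>.\<close>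

definition tension ::
  "('a, 'm::finite, 'y) riem_scheme \<Rightarrow> ('b, 'n::finite, 'z) riem_scheme
     \<Rightarrow> ('a \<Rightarrow> 'b) \<Rightarrow> 'a \<Rightarrow> real^'n"
  where "tension M N \<phi> p =
    (let c = chart_at M p; d = chart_at N (\<phi> p); x = chart_map c p
     in metric_trace M c x (second_fundamental_form M N c d \<phi> x))"

definition tension_norm2 ::
  "('a, 'm::finite, 'y) riem_scheme \<Rightarrow> ('b, 'n::finite, 'z) riem_scheme
     \<Rightarrow> ('a \<Rightarrow> 'b) \<Rightarrow> 'a \<Rightarrow> real"
  where "tension_norm2 M N \<phi> p =
    (let d = chart_at N (\<phi> p)
     in tension M N \<phi> p \<bullet> (metric N d (chart_map d (\<phi> p)) *v tension M N \<phi> p))"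

definition harmonic ::
  "('a, 'm::finite, 'y) riem_scheme \<Rightarrow> ('b, 'n::finite, 'z) riem_scheme \<Rightarrow> ('a \<Rightarrow> 'b) \<Rightarrow> bool"
  where "harmonic M N \<phi> \<longleftrightarrow>
    smooth_map M N \<phi> \<and> (\<forall>p\<in>topspace (mtop M). tension M N \<phi> p = 0)"


section \<open>The bienergy\<close>

definition riemannian_volume ::
  "('a, 'm::finite, 'z) riem_scheme \<Rightarrow> 'a measure"
  where "riemannian_volume M =
    (THE \<nu>. space \<nu> = topspace (mtop M) \<and>
       sets \<nu> = sigma_sets (topspace (mtop M)) {U. openin (mtop M) U} \<and>
       (\<forall>c\<in>atlas M. \<forall>B\<in>sets \<nu>. B \<subseteq> chart_dom c \<longrightarrow>
          emeasure \<nu> B =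
            (\<integral>\<^sup>+x\<in>chart_map c ` B. ennreal (volume_density M c x) \<partial>lborel)))"

definition bienergy ::
  "('a, 'm::finite, 'y) riem_scheme \<Rightarrow> ('b, 'n::finite, 'z) riem_scheme
     \<Rightarrow> 'a set \<Rightarrow> ('a \<Rightarrow> 'b) \<Rightarrow> real"
  where "bienergy M N K \<phi> = (LINT p:K|riemannian_volume M. tension_norm2 M N \<phi> p) / 2"

text \<open>Smoothness of \<open>\<Phi> : (-\<epsilon>, \<epsilon>) \<times> M \<rightarrow> N\<close>, jointly in both arguments.\<close>

definition smooth_variation ::
  "('a, 'm::finite, 'y) riem_scheme \<Rightarrow> ('b, 'n::finite, 'z) riem_scheme
     \<Rightarrow> real \<Rightarrow> (real \<Rightarrow> 'a \<Rightarrow> 'b) \<Rightarrow> bool"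
  where "smooth_variation M N \<epsilon> \<Phi> \<longleftrightarrow>
    continuous_map (prod_topology (top_of_set {-\<epsilon><..<\<epsilon>}) (mtop M)) (mtop N) (\<lambda>(t, p). \<Phi> t p) \<and>
    (\<forall>c\<in>atlas M. \<forall>d\<in>atlas N.
       smooth_on
         {(t, x). t \<in> {-\<epsilon><..<\<epsilon>} \<and> x \<in> chart_map c ` chart_dom c \<and> \<Phi> t (chart_inv c x) \<in> chart_dom d}
         (\<lambda>(t, x). coord_rep c d (\<Phi> t) x))"

text \<open>On a non-compact \<open>M\<close> the bienergy need not be finite. As usual, critical points are
  understood with respect to variations that are constant outside a compact set \<open>K\<close>, and the
  bienergy is then computed over \<open>K\<close>. For compact \<open>M\<close> one may take \<open>K = M\<close>.\<close>

definition biharmonic ::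
  "('a, 'm::finite, 'y) riem_scheme \<Rightarrow> ('b, 'n::finite, 'z) riem_scheme \<Rightarrow> ('a \<Rightarrow> 'b) \<Rightarrow> bool"
  where "biharmonic M N \<phi> \<longleftrightarrow>
    smooth_map M N \<phi> \<and>
    (\<forall>\<epsilon> \<Phi> K.
       \<epsilon> > 0 \<and> smooth_variation M N \<epsilon> \<Phi> \<and>
       (\<forall>p\<in>topspace (mtop M). \<Phi> 0 p = \<phi> p) \<and>
       compactin (mtop M) K \<and>
       (\<forall>t\<in>{-\<epsilon><..<\<epsilon>}. \<forall>p\<in>topspace (mtop M) - K. \<Phi> t p = \<phi> p)
       \<longrightarrow> ((\<lambda>t. bienergy M N K (\<Phi> t)) has_real_derivative 0) (at 0))"


section \<open>The round sphere\<close>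

text \<open>With \<open>CARD('n) = n\<close>, the space \<open>\<real>\<^sup>n\<^sup>+\<^sup>1\<close> is \<open>real^'n \<times> real\<close>, and \<open>S\<^sup>n\<close> carries the stereographic
  projections from \<open>(0, 1)\<close> and \<open>(0, -1)\<close> together with the metric induced by the inner
  product of \<open>\<real>\<^sup>n\<^sup>+\<^sup>1\<close>. Points of \<open>S\<^sup>n\<close> are points of \<open>\<real>\<^sup>n\<^sup>+\<^sup>1\<close>, so that the
  standard embedding is the identity on the underlying type.\<close>

definition north_chart :: "((real^'n::finite) \<times> real, 'n) chart"
  where "north_chart = (sphere 0 1 - {(0, 1)}, \<lambda>(x, s). x /\<^sub>R (1 - s))"

definition south_chart :: "((real^'n::finite) \<times> real, 'n) chart"
  where "south_chart = (sphere 0 1 - {(0, -1)}, \<lambda>(x, s). x /\<^sub>R (1 + s))"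

definition round_sphere :: "((real^'n::finite) \<times> real, 'n) riem"
  where "round_sphere =
    \<lparr>mtop = top_of_set (sphere 0 1),
     atlas = {north_chart, south_chart},
     metric = (\<lambda>c y. \<chi> i j. partial i (chart_inv c) y \<bullet> partial j (chart_inv c) y)\<rparr>"

end

theory Submission
  imports Defs
begin

text \<open>
  Write \<open>\<phi>\<close> also for the map into the ambient Euclidean space. By the Gauss formula for the sphere, its
  Laplacian is \<open>\<Delta>\<phi> = \<tau>(\<phi>) - |d\<phi>|\<^sup>2 \<phi>\<close>, so \<open>|\<tau>(\<phi>)|\<^sup>2 = |\<Delta>\<phi>|\<^sup>2 - |d\<phi>|\<^sup>4\<close>. Rotating \<open>\<phi>(p)\<close> in a fixed
  coordinate plane by the angle \<open>t \<eta>(p)\<close>, with a bump function \<open>\<eta>\<close> supported in a chart, is a variation of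
  \<open>\<phi>\<close>. Differentiating the bienergy under the integral and integrating by parts shows, when
  \<open>|d\<phi>|\<^sup>2 = c\<close> is constant, that \<open>\<Delta>\<^sup>2\<phi> + 2c \<Delta>\<phi>\<close> is everywhere a multiple of \<open>\<phi>\<close>. If \<open>\<Delta>\<^sup>2\<phi> = -\<mu> \<Delta>\<phi>\<close>, its
  tangential part is \<open>(2c - \<mu>) \<tau>(\<phi>)\<close>, so \<open>\<mu> = 2c\<close> wherever \<open>\<tau>(\<phi>) \<noteq> 0\<close>.

  If \<open>c = 0\<close>, then \<open>d\<phi> = 0\<close> and \<open>\<phi>\<close> is harmonic. If \<open>c \<noteq> 0\<close>, then \<open>\<langle>\<Delta>\<phi>, \<phi>\<rangle> = -c\<close> makes
  \<open>\<mu> = \<langle>\<Delta>\<^sup>2\<phi>, \<phi>\<rangle> / c\<close> continuous; where \<open>\<mu> \<noteq> 2c\<close>, the tension vanishes nearby, so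
  \<open>\<Delta>\<phi> = -c\<phi>\<close> there and \<open>\<mu> = c\<close>. Thus \<open>\<mu>\<close> is a continuous function with values in \<open>{c, 2c}\<close> on a
  connected space.
\<close>

section \<open>Calculus of smooth functions\<close>

text \<open>Rotations preserve the sphere exactly and are given by a formula, so no exponential map
  or projection is needed to produce variations. The velocity of a rotation in the plane of two
  basis vectors \<open>b1\<close>, \<open>b2\<close> tests exactly the minor \<open>(P \<bullet> b2)
  * (u \<bullet> b1) - (P \<bullet> b1) * (u \<bullet> b2)\<close> of the field \<open>P\<close>
  formed from the Laplacians of \<open>u\<close>; if all these minors vanish, \<open>P\<close> is a
  multiple of the unit vector \<open>u\<close>. Constant energy \<open>k\<close> matters because the
  square of the energy density varies by \<open>4 k\<close> times the inner product of the gradients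
  of \<open>u\<close> and of the velocity. With \<open>k\<close> outside the integral a single Green
  formula moves both derivatives to \<open>u\<close>, no gradient of the density appears, and the
  coefficient \<open>2 k\<close> next to the bi-Laplacian results. Two features of the definitions
  cause most of the length. Laplacian, energy and tension are computed in arbitrarily chosen charts,
  so they must be shown independent of the chart; and the volume is a definite description, so the
  measure has to be constructed and proved unique before a bienergy can be evaluated.\<close>

lemma dir_deriv_eq:
  assumes "(f has_derivative f') (at x)"
  shows "dir_deriv v f x = f' v"
  using frechet_derivative_at[OF assms] by (simp add: dir_deriv_def)

lemma dir_deriv_works:
  "f differentiable (at x) \<Longrightarrow> (f has_derivative (\<lambda>v. dir_deriv v f x)) (at x)"
  by (simp add: dir_deriv_def frechet_derivative_works eta_contract_eq)

lemma differentiable_cong_open: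
  assumes "open U" "x \<in> U" "\<And>y. y \<in> U \<Longrightarrow> f y = g y"
  shows "f differentiable (at x) \<longleftrightarrow> g differentiable (at x)"
  using assms has_derivative_transform_within_open[of f _ x UNIV U g]
    has_derivative_transform_within_open[of g _ x UNIV U f]
  unfolding differentiable_def by metis

lemma dir_deriv_cong_open:
  assumes "open U" "x \<in> U" "\<And>y. y \<in> U \<Longrightarrow> f y = g y"
  shows "dir_deriv v f x = dir_deriv v g x"
proof -
  have "(f has_derivative D) (at x) \<longleftrightarrow> (g has_derivative D) (at x)" for D
    using assms has_derivative_transform_within_open[of f _ x UNIV U g]
      has_derivative_transform_within_open[of g _ x UNIV U f] by metis
  then show ?thesis unfolding dir_deriv_def frechet_derivative_def by simp
qed

lemma bounded_linear_dir_deriv: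
  "f differentiable (at x) \<Longrightarrow> bounded_linear (\<lambda>v. dir_deriv v f x)"
  by (metis dir_deriv_works has_derivative_bounded_linear)

lemma dir_deriv_sum_direction:
  assumes "f differentiable (at x)"
  shows "dir_deriv (\<Sum>b\<in>B. a b *\<^sub>R w b) f x = (\<Sum>b\<in>B. a b *\<^sub>R dir_deriv (w b) f x)"
proof -
  interpret bounded_linear "\<lambda>v. dir_deriv v f x"
    using assms by (rule bounded_linear_dir_deriv)
  show ?thesis by (simp add: sum scaleR)
qed

lemma dir_deriv_Basis:
  fixes f :: "'v::euclidean_space \<Rightarrow> _"
  assumes "f differentiable (at x)"
  shows "dir_deriv v f x = (\<Sum>b\<in>Basis. (v \<bullet> b) *\<^sub>R dir_deriv b f x)"
  using dir_deriv_sum_direction[OF assms, of "\<lambda>b. v \<bullet> b" "\<lambda>b. b" Basis]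
  by (simp add: euclidean_representation)

lemma dir_deriv_vec:
  fixes f :: "real^'m::finite \<Rightarrow> _"
  assumes "f differentiable (at x)"
  shows "dir_deriv v f x = (\<Sum>i\<in>UNIV. v $ i *\<^sub>R partial i f x)"
proof -
  have "v = (\<Sum>i\<in>UNIV. v $ i *\<^sub>R axis i 1)"
    by (simp add: vec_eq_iff axis_def if_distrib cong: if_cong)
  then show ?thesis using dir_deriv_sum_direction[OF assms, of "\<lambda>i. v $ i" "\<lambda>i. axis i 1" UNIV]
    by simp
qed

lemma dir_deriv_const [simp]: "dir_deriv v (\<lambda>x. c) = (\<lambda>x. 0)"
  by (simp add: dir_deriv_def fun_eq_iff)

lemma dir_deriv_bounded_linear:
  assumes "bounded_linear h" "f differentiable (at x)"
  shows "dir_deriv v (\<lambda>y. h (f y)) x = h (dir_deriv v f x)"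
  using bounded_linear.has_derivative[OF assms(1) dir_deriv_works[OF assms(2)]]
  by (rule dir_deriv_eq)

lemma dir_deriv_linear: "bounded_linear h \<Longrightarrow> dir_deriv v h x = h v"
  by (rule dir_deriv_eq) (rule bounded_linear_imp_has_derivative)

lemma dir_deriv_add:
  assumes "f differentiable (at x)" "g differentiable (at x)"
  shows "dir_deriv v (\<lambda>y. f y + g y) x = dir_deriv v f x + dir_deriv v g x"
  using has_derivative_add[OF dir_deriv_works[OF assms(1)] dir_deriv_works[OF assms(2)]]
  by (rule dir_deriv_eq)

lemma dir_deriv_diff:
  assumes "f differentiable (at x)" "g differentiable (at x)"
  shows "dir_deriv v (\<lambda>y. f y - g y) x = dir_deriv v f x - dir_deriv v g x"
  using has_derivative_diff[OF dir_deriv_works[OF assms(1)] dir_deriv_works[OF assms(2)]]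
  by (rule dir_deriv_eq)

lemma dir_deriv_sum:
  assumes "\<And>i. i \<in> I \<Longrightarrow> f i differentiable (at x)"
  shows "dir_deriv v (\<lambda>y. \<Sum>i\<in>I. f i y) x = (\<Sum>i\<in>I. dir_deriv v (f i) x)"
  by (rule dir_deriv_eq[OF has_derivative_sum]) (rule dir_deriv_works[OF assms])

lemma dir_deriv_bilinear:
  assumes "bounded_bilinear pr" "f differentiable (at x)" "g differentiable (at x)"
  shows "dir_deriv v (\<lambda>y. pr (f y) (g y)) x
       = pr (f x) (dir_deriv v g x) + pr (dir_deriv v f x) (g x)"
  using bounded_bilinear.FDERIV[OF assms(1) dir_deriv_works[OF assms(2)] dir_deriv_works[OF assms(3)]]
  by (rule dir_deriv_eq)

lemmas dir_deriv_mult = dir_deriv_bilinear[OF bounded_bilinear_mult]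
lemmas dir_deriv_scaleR = dir_deriv_bilinear[OF bounded_bilinear_scaleR]
lemmas dir_deriv_inner = dir_deriv_bilinear[OF bounded_bilinear_inner]

lemma dir_deriv_compose:
  assumes "f differentiable (at x)" "g differentiable (at (f x))"
  shows "dir_deriv v (\<lambda>y. g (f y)) x = dir_deriv (dir_deriv v f x) g (f x)"
  using has_derivative_compose[OF dir_deriv_works[OF assms(1)] dir_deriv_works[OF assms(2)]]
  by (rule dir_deriv_eq)

lemma dir_deriv_real_compose:
  assumes "f differentiable (at x)" "(g has_real_derivative g') (at (f x))"
  shows "dir_deriv v (\<lambda>y. g (f y)) x = g' * dir_deriv v f x"
  by (rule dir_deriv_eq)
    (use has_derivative_compose[OF dir_deriv_works[OF assms(1)] assms(2)[unfolded has_field_derivative_def]]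
      in \<open>simp add: mult.commute\<close>)

text \<open>The finite-order version of \<^const>\<open>smooth_on\<close> on which closure properties are proved by induction.\<close>

primrec ck :: "nat \<Rightarrow> 'v::real_normed_vector set \<Rightarrow> ('v \<Rightarrow> 'w::real_normed_vector) \<Rightarrow> bool" where
  "ck 0 U f \<longleftrightarrow> (\<forall>x\<in>U. f differentiable (at x))"
| "ck (Suc k) U f \<longleftrightarrow> (\<forall>x\<in>U. f differentiable (at x)) \<and> (\<forall>v. ck k U (dir_deriv v f))"

lemma ck_differentiable: "ck k U f \<Longrightarrow> x \<in> U \<Longrightarrow> f differentiable (at x)"
  by (cases k) auto

lemma ck_foldr:
  "ck k U f \<longleftrightarrow> (\<forall>vs. length vs \<le> k \<longrightarrow> (\<forall>x\<in>U. foldr dir_deriv vs f differentiable (at x)))"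
proof (induction k arbitrary: f)
  case (Suc k)
  show ?case
  proof
    assume L: "ck (Suc k) U f"
    show "\<forall>vs. length vs \<le> Suc k \<longrightarrow> (\<forall>x\<in>U. foldr dir_deriv vs f differentiable (at x))"
    proof (intro allI impI)
      fix vs :: "'a list" assume "length vs \<le> Suc k"
      then show "\<forall>x\<in>U. foldr dir_deriv vs f differentiable (at x)"
        \<comment> \<open>\<open>foldr\<close> applies the last list element first, so the recursion
          of \<open>ck\<close> peels the list from its end.\<close>
        using L Suc.IH by (cases vs rule: rev_cases) auto
    qed
  next
    assume R: "\<forall>vs. length vs \<le> Suc k \<longrightarrow> (\<forall>x\<in>U. foldr dir_deriv vs f differentiable (at x))"
    have "\<forall>x\<in>U. f differentiable (at x)" using R[rule_format, of "[]"] by simp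
    moreover have "ck k U (dir_deriv v f)" for v
      unfolding Suc.IH using R[rule_format, of "_ @ [v]"] by simp
    ultimately show "ck (Suc k) U f" by simp
  qed
qed simp

lemma smooth_on_ck: "smooth_on U f \<longleftrightarrow> (\<forall>k. ck k U f)"
  unfolding smooth_on_def ck_foldr by blast

lemma ck_Suc_imp: "ck (Suc k) U f \<Longrightarrow> ck k U f"
  by (auto simp: ck_foldr)

lemma ck_cong:
  assumes "open U" "\<And>x. x \<in> U \<Longrightarrow> f x = g x"
  shows "ck k U f \<longleftrightarrow> ck k U g"
  using assms(2)
proof (induction k arbitrary: f g)
  case 0
  then show ?case using differentiable_cong_open[OF assms(1), of _ f g] by auto
next
  case (Suc k)
  have "ck k U (dir_deriv v f) \<longleftrightarrow> ck k U (dir_deriv v g)" for v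
    by (rule Suc.IH) (rule dir_deriv_cong_open[OF assms(1) _ Suc.prems])
  then show ?case using differentiable_cong_open[OF assms(1), of _ f g] Suc.prems by auto
qed

lemma ck_const: "ck k U (\<lambda>x. c)"
  by (induction k arbitrary: c) auto

lemma ck_linear:
  assumes "bounded_linear h" shows "ck k U h"
proof -
  have "dir_deriv v h = (\<lambda>x. h v)" for v using dir_deriv_linear[OF assms] by auto
  then show ?thesis
    by (cases k) (auto simp: ck_const assms bounded_linear_imp_differentiable)
qed

lemma differentiable_bounded_linear:
  "bounded_linear h \<Longrightarrow> f differentiable F \<Longrightarrow> (\<lambda>x. h (f x)) differentiable F"
  unfolding differentiable_def using bounded_linear.has_derivative by blast

lemma ck_bounded_linear:
  assumes "bounded_linear h" "open U" "ck k U f"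
  shows "ck k U (\<lambda>x. h (f x))"
  using assms(3)
proof (induction k arbitrary: f)
  case 0
  then show ?case
    using differentiable_bounded_linear[OF assms(1)] by auto
next
  case (Suc k)
  have "ck k U (dir_deriv v (\<lambda>x. h (f x)))" for v
    by (rule ck_cong[OF assms(2), THEN iffD1, OF _ Suc.IH[of "dir_deriv v f"]])
      (use Suc.prems in \<open>simp_all add: dir_deriv_bounded_linear[OF assms(1)]\<close>)
  then show ?case using Suc.prems differentiable_bounded_linear[OF assms(1)] by auto
qed

lemma ck_add:
  assumes "open U" "ck k U f" "ck k U g"
  shows "ck k U (\<lambda>x. f x + g x)"
  using assms(2,3)
proof (induction k arbitrary: f g)
  case (Suc k)
  have "ck k U (dir_deriv v (\<lambda>x. f x + g x))" for v
    by (rule ck_cong[OF assms(1), THEN iffD1, OF _ Suc.IH[of "dir_deriv v f" "dir_deriv v g"]])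
      (use Suc.prems in \<open>simp_all add: dir_deriv_add\<close>)
  then show ?case using Suc.prems by auto
qed auto

text \<open>The Leibniz rule writes a derivative as a sum of two products of the same kind, each
  with one factor differentiated; the other factor is used at the lower order through
  \<open>ck_Suc_imp\<close>.\<close>

lemma ck_bilinear:
  assumes "bounded_bilinear pr" "open U" "ck k U f" "ck k U g"
  shows "ck k U (\<lambda>x. pr (f x) (g x))"
  using assms(3,4)
proof (induction k arbitrary: f g)
  case 0
  then show ?case using assms(1) bounded_bilinear.FDERIV unfolding ck.simps differentiable_def by blast
next
  case (Suc k)
  have "ck k U (dir_deriv v (\<lambda>x. pr (f x) (g x)))" for v
    by (rule ck_cong[OF assms(2), THEN iffD1, OF _
          ck_add[OF assms(2) Suc.IH[of f "dir_deriv v g"] Suc.IH[of "dir_deriv v f" g]]])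
      (use Suc.prems in \<open>auto simp: dir_deriv_bilinear[OF assms(1)] intro: ck_Suc_imp simp del: ck.simps,
        auto simp: dir_deriv_bilinear[OF assms(1)]\<close>)
  moreover have "(\<lambda>x. pr (f x) (g x)) differentiable (at x)" if "x \<in> U" for x
    using Suc.prems that assms(1) bounded_bilinear.FDERIV unfolding ck.simps differentiable_def by blast
  ultimately show ?case by simp
qed

lemma ck_sum:
  assumes "open U" "\<And>i. i \<in> I \<Longrightarrow> ck k U (f i)"
  shows "ck k U (\<lambda>x. \<Sum>i\<in>I. f i x)"
  using assms(2) by (induction I rule: infinite_finite_induct) (auto intro: ck_const ck_add assms(1))

text \<open>By the chain rule a derivative of the composite is a sum over \<open>Basis\<close> of
  products in which a derivative of \<open>g\<close> is composed with the same \<open>f\<close>.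
  Hence the induction varies only \<open>g\<close>, and a finite basis of the intermediate space is
  used.\<close>

lemma ck_compose:
  fixes f :: "'a::real_normed_vector \<Rightarrow> 'b::euclidean_space"
  assumes "open U" "ck k U f" "ck k V g" "f ` U \<subseteq> V"
  shows "ck k U (\<lambda>x. g (f x))"
  using assms(2,3)
proof (induction k arbitrary: g)
  case 0
  then show ?case using assms(4) differentiable_chain_at[of f _ g] by (auto simp: o_def)
next
  case (Suc k)
  have "ck k U (dir_deriv v (\<lambda>x. g (f x)))" for v
  proof (rule ck_cong[OF assms(1), THEN iffD1])
    show "ck k U (\<lambda>x. \<Sum>b\<in>Basis. (dir_deriv v f x \<bullet> b) *\<^sub>R dir_deriv b g (f x))"
      by (intro ck_sum assms(1) ck_bilinear[OF bounded_bilinear_scaleR] Suc.IH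
          ck_bounded_linear[OF bounded_linear_inner_left])
        (use Suc.prems in \<open>auto intro: ck_Suc_imp\<close>)
    show "(\<Sum>b\<in>Basis. (dir_deriv v f x \<bullet> b) *\<^sub>R dir_deriv b g (f x)) = dir_deriv v (\<lambda>x. g (f x)) x"
      if "x \<in> U" for x
    proof -
      have "f differentiable (at x)" "g differentiable (at (f x))"
        using that Suc.prems assms(4) by auto
      then show ?thesis by (simp add: dir_deriv_compose dir_deriv_Basis[of g])
    qed
  qed
  moreover have "(\<lambda>x. g (f x)) differentiable (at x)" if "x \<in> U" for x
    using Suc.prems that assms(4) differentiable_chain_at[of f _ g] by (auto simp: o_def)
  ultimately show ?case by simp
qed

text \<open>One induction for every outer function that lies in a family \<open>g n\<close> whose
  derivatives \<open>g' n\<close> are again built from the family. The assumption on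
  \<open>g'\<close> expresses this closure at a fixed order, and the induction must therefore treat
  all indices \<open>n\<close> at once. Reciprocal, square root, sine, cosine and the flat
  exponentials are instances.\<close>

lemma ck_real_compose:
  fixes g :: "nat \<Rightarrow> real \<Rightarrow> real"
  assumes "open U"
    and "\<And>n y. y \<in> V \<Longrightarrow> (g n has_real_derivative g' n y) (at y)"
    and g': "\<And>k n f. \<lbrakk>ck k U f; f ` U \<subseteq> V; \<And>n. ck k U (\<lambda>x. g n (f x))\<rbrakk> \<Longrightarrow> ck k U (\<lambda>x. g' n (f x))"
    and "ck k U f" "f ` U \<subseteq> V"
  shows "ck k U (\<lambda>x. g n (f x))"
  using assms(4)
proof (induction k arbitrary: n)
  have diff: "(\<lambda>x. g n (f x)) differentiable (at x)" if "x \<in> U" "f differentiable (at x)" for x n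
    using differentiable_chain_at[of f x "g n"] that assms(2)[of "f x" n] assms(5)
    by (auto simp: o_def intro: differentiableI has_field_derivative_imp_has_derivative)
  {
    case 0
    then show ?case using diff by simp
  next
    case (Suc k)
    have "ck k U (dir_deriv v (\<lambda>x. g n (f x)))" for v
    proof (rule ck_cong[OF assms(1), THEN iffD1])
      show "ck k U (\<lambda>x. g' n (f x) * dir_deriv v f x)"
        using Suc ck_Suc_imp assms(5)
        by (intro ck_bilinear[OF bounded_bilinear_mult] assms(1) g') auto
      show "g' n (f x) * dir_deriv v f x = dir_deriv v (\<lambda>x. g n (f x)) x" if "x \<in> U" for x
        using dir_deriv_real_compose[of f x "g n" "g' n (f x)" v] that Suc.prems assms(2,5) by auto
    qed
    then show ?case using diff Suc.prems by simp
  }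
qed

section \<open>Closure properties of smooth functions\<close>

lemma smooth_on_subset: "smooth_on U f \<Longrightarrow> V \<subseteq> U \<Longrightarrow> smooth_on V f"
  by (auto simp: smooth_on_def)

text \<open>Iterated derivatives are functions on the whole space and their differentiability is
  taken at unrestricted points, so any set \<open>V\<close> around each point will do, open or
  not.\<close>

lemma smooth_on_local:
  "(\<And>x. x \<in> U \<Longrightarrow> \<exists>V. x \<in> V \<and> smooth_on V f) \<Longrightarrow> smooth_on U f"
  unfolding smooth_on_def by blast

lemma smooth_on_cong:
  "open U \<Longrightarrow> (\<And>x. x \<in> U \<Longrightarrow> f x = g x) \<Longrightarrow> smooth_on U f \<Longrightarrow> smooth_on U g"
  unfolding smooth_on_ck using ck_cong[of U f g] by auto

lemma smooth_on_differentiable: "smooth_on U f \<Longrightarrow> x \<in> U \<Longrightarrow> f differentiable (at x)"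
  unfolding smooth_on_ck using ck_differentiable by blast

lemma smooth_on_continuous_on: "smooth_on U f \<Longrightarrow> continuous_on U f"
  by (meson continuous_at_imp_continuous_on differentiable_imp_continuous_within smooth_on_differentiable)

lemma smooth_on_dir_deriv: "smooth_on U f \<Longrightarrow> smooth_on U (dir_deriv v f)"
  unfolding smooth_on_ck by (metis ck.simps(2))

lemma smooth_on_const [simp]: "smooth_on U (\<lambda>x. c)"
  by (simp add: smooth_on_ck ck_const)

lemma smooth_on_linear: "bounded_linear h \<Longrightarrow> smooth_on U h"
  by (simp add: smooth_on_ck ck_linear)

lemma smooth_on_bounded_linear:
  "bounded_linear h \<Longrightarrow> open U \<Longrightarrow> smooth_on U f \<Longrightarrow> smooth_on U (\<lambda>x. h (f x))"
  by (simp add: smooth_on_ck ck_bounded_linear)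

lemma smooth_on_id [simp]: "smooth_on U (\<lambda>x. x)"
  by (rule smooth_on_linear) (rule bounded_linear_ident)

lemma smooth_on_add: "open U \<Longrightarrow> smooth_on U f \<Longrightarrow> smooth_on U g \<Longrightarrow> smooth_on U (\<lambda>x. f x + g x)"
  by (simp add: smooth_on_ck ck_add)

lemma smooth_on_bilinear:
  "bounded_bilinear pr \<Longrightarrow> open U \<Longrightarrow> smooth_on U f \<Longrightarrow> smooth_on U g \<Longrightarrow>
    smooth_on U (\<lambda>x. pr (f x) (g x))"
  by (simp add: smooth_on_ck ck_bilinear)

lemmas smooth_on_mult = smooth_on_bilinear[OF bounded_bilinear_mult]
lemmas smooth_on_scaleR = smooth_on_bilinear[OF bounded_bilinear_scaleR]
lemmas smooth_on_inner = smooth_on_bilinear[OF bounded_bilinear_inner]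

lemma smooth_on_minus: "open U \<Longrightarrow> smooth_on U f \<Longrightarrow> smooth_on U (\<lambda>x. - f x)"
  by (rule smooth_on_bounded_linear[OF bounded_linear_minus[OF bounded_linear_ident]])

lemma smooth_on_diff: "open U \<Longrightarrow> smooth_on U f \<Longrightarrow> smooth_on U g \<Longrightarrow> smooth_on U (\<lambda>x. f x - g x)"
  using smooth_on_add[of U f "\<lambda>x. - g x"] smooth_on_minus[of U g] by simp

lemma smooth_on_sum:
  "open U \<Longrightarrow> (\<And>i. i \<in> I \<Longrightarrow> smooth_on U (f i)) \<Longrightarrow> smooth_on U (\<lambda>x. \<Sum>i\<in>I. f i x)"
  by (simp add: smooth_on_ck ck_sum)

lemma smooth_on_prod:
  fixes f :: "'i \<Rightarrow> 'a::real_normed_vector \<Rightarrow> real"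
  shows "open U \<Longrightarrow> (\<And>i. i \<in> I \<Longrightarrow> smooth_on U (f i)) \<Longrightarrow> smooth_on U (\<lambda>x. \<Prod>i\<in>I. f i x)"
  by (induction I rule: infinite_finite_induct) (auto intro: smooth_on_mult)

lemma smooth_on_compose:
  fixes f :: "'a::real_normed_vector \<Rightarrow> 'b::euclidean_space"
  shows "open U \<Longrightarrow> smooth_on U f \<Longrightarrow> smooth_on V g \<Longrightarrow> f ` U \<subseteq> V \<Longrightarrow> smooth_on U (\<lambda>x. g (f x))"
  unfolding smooth_on_ck using ck_compose by blast

lemma smooth_on_power:
  fixes f :: "'a::real_normed_vector \<Rightarrow> real"
  shows "open U \<Longrightarrow> smooth_on U f \<Longrightarrow> smooth_on U (\<lambda>x. f x ^ n)"
  by (induction n) (auto intro: smooth_on_mult)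

lemma smooth_on_inverse:
  fixes f :: "'a::real_normed_vector \<Rightarrow> real"
  assumes "open U" "smooth_on U f" "\<And>x. x \<in> U \<Longrightarrow> f x \<noteq> 0"
  shows "smooth_on U (\<lambda>x. inverse (f x))"
  unfolding smooth_on_ck
proof
  fix k
  show "ck k U (\<lambda>x. inverse (f x))"
  proof (rule ck_real_compose[where g = "\<lambda>n. inverse" and V = "- {0}" and
        g' = "\<lambda>n y. - (inverse y * inverse y)"])
    show "(inverse has_real_derivative - (inverse y * inverse y)) (at y)" if "y \<in> - {0}" for y :: real
      using that by (auto intro!: derivative_eq_intros)
    show "ck k U (\<lambda>x. - (inverse (f x) * inverse (f x)))" if "\<And>n::nat. ck k U (\<lambda>x. inverse (f x))"
      for k and f :: "'a \<Rightarrow> real"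
      using that assms(1)
      by (intro ck_bounded_linear[OF bounded_linear_minus[OF bounded_linear_ident]] ck_bilinear[OF bounded_bilinear_mult])
  qed (use assms in \<open>auto simp: smooth_on_ck\<close>)
qed

lemma smooth_on_divide:
  fixes f g :: "'a::real_normed_vector \<Rightarrow> real"
  shows "open U \<Longrightarrow> smooth_on U f \<Longrightarrow> smooth_on U g \<Longrightarrow> (\<And>x. x \<in> U \<Longrightarrow> g x \<noteq> 0) \<Longrightarrow>
    smooth_on U (\<lambda>x. f x / g x)"
  unfolding divide_inverse by (intro smooth_on_mult smooth_on_inverse)

lemma smooth_on_sqrt:
  fixes f :: "'a::real_normed_vector \<Rightarrow> real"
  assumes "open U" "smooth_on U f" "\<And>x. x \<in> U \<Longrightarrow> f x > 0"
  shows "smooth_on U (\<lambda>x. sqrt (f x))"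
proof -
  \<comment> \<open>The derivative of the root is half its reciprocal, and the reciprocal has
    derivative minus one half times its own cube: two functions suffice for a closed family.\<close>
  define g :: "nat \<Rightarrow> real \<Rightarrow> real" where "g n y = (if n = 0 then sqrt y else inverse (sqrt y))" for n y
  define g' :: "nat \<Rightarrow> real \<Rightarrow> real" where
    "g' n y = (if n = 0 then (1/2) *\<^sub>R g 1 y else (-1/2) *\<^sub>R (g 1 y * (g 1 y * g 1 y)))" for n y
  have "ck k U (\<lambda>x. g 0 (f x))" for k
  proof (rule ck_real_compose[where g = g and V = "{0<..}" and g' = g'])
    show "(g n has_real_derivative g' n y) (at y)" if "y \<in> {0<..}" for n y
      using that unfolding g_def g'_def
      by (cases "n = 0") (auto intro!: derivative_eq_intros simp: field_simps)
    show "ck k U (\<lambda>x. g' n (f x))" if *: "\<And>n. ck k U (\<lambda>x. g n (f x))"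
      for k n and f :: "'a \<Rightarrow> real"
      unfolding g'_def
      by (cases "n = 0"; simp only: simp_thms if_True if_False)
        (intro ck_bounded_linear[OF bounded_linear_scaleR_right] ck_bilinear[OF bounded_bilinear_mult]
          assms(1) *)+
  qed (use assms in \<open>auto simp: smooth_on_ck\<close>)
  then show ?thesis by (simp add: smooth_on_ck g_def)
qed

lemma smooth_on_sin_cos:
  fixes f :: "'a::real_normed_vector \<Rightarrow> real"
  assumes "open U" "smooth_on U f"
  shows smooth_on_sin: "smooth_on U (\<lambda>x. sin (f x))"
    and smooth_on_cos: "smooth_on U (\<lambda>x. cos (f x))"
proof -
  define g :: "nat \<Rightarrow> real \<Rightarrow> real" where "g n = (if n = 0 then sin else cos)" for n
  define g' :: "nat \<Rightarrow> real \<Rightarrow> real" where "g' n y = (if n = 0 then g 1 y else - g 0 y)" for n y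
  have "ck k U (\<lambda>x. g n (f x))" for k n
  proof (rule ck_real_compose[where g = g and V = UNIV and g' = g'])
    show "(g n has_real_derivative g' n y) (at y)" for n y
      unfolding g_def g'_def
      by (cases "n = 0") (auto intro!: derivative_eq_intros)
    show "ck k U (\<lambda>x. g' n (f x))" if *: "\<And>n. ck k U (\<lambda>x. g n (f x))"
      for k n and f :: "'a \<Rightarrow> real"
      unfolding g'_def
      by (cases "n = 0") (use *[of 1] *[of 0] assms(1) in
          \<open>auto intro!: ck_bounded_linear[OF bounded_linear_minus[OF bounded_linear_ident]]\<close>)
  qed (use assms in \<open>auto simp: smooth_on_ck\<close>)
  from this[of _ 0] this[of _ 1] show "smooth_on U (\<lambda>x. sin (f x))" "smooth_on U (\<lambda>x. cos (f x))"
    by (auto simp: smooth_on_ck g_def)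
qed

lemma smooth_on_vec_nth: "open U \<Longrightarrow> smooth_on U f \<Longrightarrow> smooth_on U (\<lambda>x. f x $ i)"
  by (rule smooth_on_bounded_linear[OF bounded_linear_vec_nth])

lemma smooth_on_Pair:
  assumes "open U" "smooth_on U f" "smooth_on U g"
  shows "smooth_on U (\<lambda>x. (f x, g x))"
proof -
  have "bounded_linear (\<lambda>a. (a, 0))" "bounded_linear (\<lambda>b. (0, b))"
    by (auto intro!: bounded_linear_Pair bounded_linear_ident bounded_linear_zero)
  then have "smooth_on U (\<lambda>x. (f x, 0) + (0, g x))"
    using assms by (intro smooth_on_add smooth_on_bounded_linear[of "\<lambda>a. (a, 0)"]
        smooth_on_bounded_linear[of "\<lambda>b. (0, b)"])
  then show ?thesis by simp
qed

lemma smooth_on_fst: "open U \<Longrightarrow> smooth_on U f \<Longrightarrow> smooth_on U (\<lambda>x. fst (f x))"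
  by (rule smooth_on_bounded_linear[OF bounded_linear_fst])

lemma smooth_on_snd: "open U \<Longrightarrow> smooth_on U f \<Longrightarrow> smooth_on U (\<lambda>x. snd (f x))"
  by (rule smooth_on_bounded_linear[OF bounded_linear_snd])

lemmas smooth_intros = smooth_on_const smooth_on_id smooth_on_add smooth_on_diff smooth_on_minus
  smooth_on_mult smooth_on_scaleR smooth_on_inner smooth_on_sum smooth_on_power smooth_on_divide
  smooth_on_sin smooth_on_cos smooth_on_vec_nth smooth_on_Pair smooth_on_dir_deriv smooth_on_fst
  smooth_on_snd

section \<open>Symmetry of second directional derivatives\<close>

lemma dir_deriv_line:
  fixes f :: "'a::real_normed_vector \<Rightarrow> real"
  assumes "f differentiable (at (x + s *\<^sub>R v))"
  shows "((\<lambda>s. f (x + s *\<^sub>R v)) has_real_derivative dir_deriv v f (x + s *\<^sub>R v)) (at s)"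
proof -
  have "((\<lambda>s. x + s *\<^sub>R v) has_derivative (\<lambda>h. h *\<^sub>R v)) (at s)"
    by (auto intro!: derivative_eq_intros)
  from has_derivative_compose[OF this dir_deriv_works[OF assms]]
  have *: "((\<lambda>s. f (x + s *\<^sub>R v)) has_derivative (\<lambda>h. dir_deriv (h *\<^sub>R v) f (x + s *\<^sub>R v))) (at s)" .
  interpret bounded_linear "\<lambda>w. dir_deriv w f (x + s *\<^sub>R v)"
    using assms by (rule bounded_linear_dir_deriv)
  have "(\<lambda>h. dir_deriv (h *\<^sub>R v) f (x + s *\<^sub>R v)) = (*) (dir_deriv v f (x + s *\<^sub>R v))"
    by (auto simp: scaleR)
  with * show ?thesis by (simp add: has_field_derivative_def)
qed

text \<open>The mean value theorem is applied to the difference in direction \<open>w\<close> along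
  a step in direction \<open>v\<close>, and then once more along \<open>w\<close>. The left side is
  symmetric in the two directions, so exchanging them yields the other mixed derivative at another
  nearby point.\<close>

lemma second_difference_mean_value:
  fixes f :: "'a::real_normed_vector \<Rightarrow> real"
  assumes r: "smooth_on (ball x r) f" and h: "h > 0" "h * (norm v + norm w) < r"
  shows "\<exists>y. dist x y \<le> h * (norm v + norm w) \<and>
    f (x + h *\<^sub>R v + h *\<^sub>R w) - f (x + h *\<^sub>R v) - f (x + h *\<^sub>R w) + f x
      = h * h * dir_deriv w (dir_deriv v f) y"
proof -
  have near: "x + s *\<^sub>R v + t *\<^sub>R w \<in> ball x r" "dist x (x + s *\<^sub>R v + t *\<^sub>R w) \<le> h * (norm v + norm w)"
    if "0 \<le> s" "s \<le> h" "0 \<le> t" "t \<le> h" for s t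
  proof -
    have "x - (x + s *\<^sub>R v + t *\<^sub>R w) = - (s *\<^sub>R v + t *\<^sub>R w)" by simp
    then have "dist x (x + s *\<^sub>R v + t *\<^sub>R w) = norm (s *\<^sub>R v + t *\<^sub>R w)"
      unfolding dist_norm by (metis norm_minus_cancel)
    also have "\<dots> \<le> s * norm v + t * norm w"
      using norm_triangle_ineq[of "s *\<^sub>R v" "t *\<^sub>R w"] that by simp
    also have "\<dots> \<le> h * (norm v + norm w)"
      using that by (simp add: distrib_left add_mono mult_right_mono)
    finally show "dist x (x + s *\<^sub>R v + t *\<^sub>R w) \<le> h * (norm v + norm w)" .
    then show "x + s *\<^sub>R v + t *\<^sub>R w \<in> ball x r" using h by simp
  qed
  have df: "f differentiable (at y)" "dir_deriv v f differentiable (at y)" if "y \<in> ball x r" for y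
    using r that by (auto intro: smooth_on_differentiable smooth_on_dir_deriv)
  let ?F = "\<lambda>s. f (x + h *\<^sub>R w + s *\<^sub>R v) - f (x + s *\<^sub>R v)"
  have "\<exists>\<xi>>0. \<xi> < h \<and> ?F h - ?F 0 = (h - 0) *
    (dir_deriv v f (x + h *\<^sub>R w + \<xi> *\<^sub>R v) - dir_deriv v f (x + \<xi> *\<^sub>R v))"
  proof (rule MVT2[OF h(1)])
    fix s assume s: "0 \<le> s" "s \<le> h"
    have "x + h *\<^sub>R w + s *\<^sub>R v \<in> ball x r" "x + s *\<^sub>R v \<in> ball x r"
      using near[of s h] near[of s 0] s h by (auto simp: ac_simps)
    then show "(?F has_real_derivative
      dir_deriv v f (x + h *\<^sub>R w + s *\<^sub>R v) - dir_deriv v f (x + s *\<^sub>R v)) (at s)"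
      by (intro DERIV_diff dir_deriv_line df)
  qed
  then obtain \<xi> where \<xi>: "0 < \<xi>" "\<xi> < h"
    "?F h - ?F 0 = h * (dir_deriv v f (x + \<xi> *\<^sub>R v + h *\<^sub>R w) - dir_deriv v f (x + \<xi> *\<^sub>R v + 0 *\<^sub>R w))"
    by (auto simp: ac_simps)
  have "\<exists>\<zeta>>0. \<zeta> < h \<and> dir_deriv v f (x + \<xi> *\<^sub>R v + h *\<^sub>R w) - dir_deriv v f (x + \<xi> *\<^sub>R v + 0 *\<^sub>R w)
      = (h - 0) * dir_deriv w (dir_deriv v f) (x + \<xi> *\<^sub>R v + \<zeta> *\<^sub>R w)"
  proof (rule MVT2[OF h(1)])
    fix s assume s: "0 \<le> s" "s \<le> h"
    show "((\<lambda>s. dir_deriv v f (x + \<xi> *\<^sub>R v + s *\<^sub>R w)) has_real_derivative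
      dir_deriv w (dir_deriv v f) (x + \<xi> *\<^sub>R v + s *\<^sub>R w)) (at s)"
      using near[of \<xi> s] s \<xi> by (intro dir_deriv_line df) auto
  qed
  then obtain \<zeta> where \<zeta>: "0 < \<zeta>" "\<zeta> < h"
    "dir_deriv v f (x + \<xi> *\<^sub>R v + h *\<^sub>R w) - dir_deriv v f (x + \<xi> *\<^sub>R v + 0 *\<^sub>R w)
      = h * dir_deriv w (dir_deriv v f) (x + \<xi> *\<^sub>R v + \<zeta> *\<^sub>R w)" by auto
  show ?thesis
    by (rule exI[of _ "x + \<xi> *\<^sub>R v + \<zeta> *\<^sub>R w"]) (use near[of \<xi> \<zeta>] \<xi> \<zeta> in \<open>simp add: ac_simps\<close>)
qed

text \<open>Both mixed derivatives represent the same second difference, so they coincide at two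
  points that can be taken as close to \<open>x\<close> as desired. A gap at \<open>x\<close> would
  contradict continuity; \<open>e\<close> is half of that gap.\<close>

lemma dir_deriv_commute_real:
  fixes f :: "'a::real_normed_vector \<Rightarrow> real"
  assumes "open U" "smooth_on U f" "x \<in> U"
  shows "dir_deriv v (dir_deriv w f) x = dir_deriv w (dir_deriv v f) x"
proof (rule ccontr)
  let ?A = "dir_deriv v (dir_deriv w f)" and ?B = "dir_deriv w (dir_deriv v f)"
  assume ne: "?A x \<noteq> ?B x"
  define e where "e = \<bar>?A x - ?B x\<bar> / 2"
  have e: "e > 0" using ne by (simp add: e_def)
  have "continuous_on U ?A" "continuous_on U ?B"
    using assms by (auto intro: smooth_on_continuous_on smooth_on_dir_deriv)
  then have "isCont ?A x" "isCont ?B x"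
    using assms continuous_on_eq_continuous_at by blast+
  then obtain d1 d2 where d: "d1 > 0" "\<And>y. dist y x < d1 \<Longrightarrow> dist (?A y) (?A x) < e"
    "d2 > 0" "\<And>y. dist y x < d2 \<Longrightarrow> dist (?B y) (?B x) < e"
    using e unfolding continuous_at_eps_delta dist_norm by metis
  obtain r where r: "r > 0" "ball x r \<subseteq> U" using assms openE by blast
  define m where "m = min r (min d1 d2)"
  \<comment> \<open>This step keeps both intermediate points at distance less than \<open>m\<close>;
    the added 1 keeps the denominator positive when \<open>v\<close> and \<open>w\<close> are both
    zero.\<close>
  define h where "h = m / (2 * (norm v + norm w + 1))"
  have m: "m > 0" using d r by (simp add: m_def)
  have n: "norm v + norm w + 1 > 0" by (simp add: add_nonneg_pos)
  have h: "h > 0" using m n unfolding h_def by (intro divide_pos_pos) auto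
  have "h * (norm v + norm w) \<le> h * (norm v + norm w + 1)" using h by simp
  also have "\<dots> = m / 2" using n by (simp add: h_def divide_simps)
  finally have hm: "h * (norm v + norm w) < m" using m by simp
  have s: "smooth_on (ball x r) f" using assms(2) r smooth_on_subset by blast
  obtain y where y: "dist x y \<le> h * (norm v + norm w)"
    "f (x + h *\<^sub>R v + h *\<^sub>R w) - f (x + h *\<^sub>R v) - f (x + h *\<^sub>R w) + f x = h * h * ?B y"
    using second_difference_mean_value[OF s h, of v w] hm by (auto simp: m_def)
  obtain z where z: "dist x z \<le> h * (norm w + norm v)"
    "f (x + h *\<^sub>R w + h *\<^sub>R v) - f (x + h *\<^sub>R w) - f (x + h *\<^sub>R v) + f x = h * h * ?A z"
    using second_difference_mean_value[OF s h, of w v] hm by (auto simp: m_def ac_simps)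
  have "h * h * ?A z = h * h * ?B y"
    unfolding y(2)[symmetric] z(2)[symmetric] by (simp add: ac_simps)
  then have "?A z = ?B y" using h by simp
  moreover have "dist z x < d1" "dist y x < d2"
    using y(1) z(1) hm by (auto simp: m_def dist_commute[of _ x] add.commute)
  then have "dist (?A z) (?A x) < e" "dist (?B y) (?B x) < e"
    by (auto intro: d)
  ultimately have "\<bar>?A x - ?B x\<bar> < e + e" unfolding dist_real_def by linarith
  then show False by (simp add: e_def)
qed

lemma dir_deriv_commute:
  fixes f :: "'a::real_normed_vector \<Rightarrow> 'b::real_inner"
  assumes "open U" "smooth_on U f" "x \<in> U"
  shows "dir_deriv v (dir_deriv w f) x = dir_deriv w (dir_deriv v f) x"
proof -
  have "dir_deriv v (dir_deriv w f) x \<bullet> b = dir_deriv w (dir_deriv v f) x \<bullet> b" for b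
  proof -
    have sb: "smooth_on U (\<lambda>y. f y \<bullet> b)" using assms by (intro smooth_intros)
    have *: "dir_deriv w (dir_deriv v f) x \<bullet> b = dir_deriv w (dir_deriv v (\<lambda>y. f y \<bullet> b)) x" for v w
    proof -
      have "dir_deriv w (dir_deriv v (\<lambda>y. f y \<bullet> b)) x = dir_deriv w (\<lambda>y. dir_deriv v f y \<bullet> b) x"
        by (rule dir_deriv_cong_open[OF assms(1,3)])
          (use assms in \<open>auto intro!: dir_deriv_bounded_linear[OF bounded_linear_inner_left]
            smooth_on_differentiable\<close>)
      moreover have "dir_deriv v f differentiable (at x)"
        using assms by (blast intro: smooth_on_differentiable smooth_on_dir_deriv)
      ultimately show ?thesis by (simp add: dir_deriv_bounded_linear[OF bounded_linear_inner_left])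
    qed
    show ?thesis unfolding * by (rule dir_deriv_commute_real[OF assms(1) sb assms(3)])
  qed
  then show ?thesis by (metis vector_eq_rdot)
qed

section \<open>Bump functions\<close>

text \<open>Index 0 is the classical function that is flat at the origin. The powers of the
  reciprocal are included because differentiation leads to the indices \<open>n + 1\<close> and
  \<open>n + 2\<close>, which makes the family suitable for \<open>ck_real_compose\<close>.\<close>

definition flat_exp :: "nat \<Rightarrow> real \<Rightarrow> real" where
  "flat_exp n s = (if s > 0 then inverse s ^ n * exp (- inverse s) else 0)"

lemma flat_exp_tendsto: "(flat_exp n \<longlongrightarrow> 0) (at_right 0)"
proof -
  have "((\<lambda>y::real. y ^ n / exp y) \<longlongrightarrow> 0) at_top" by (rule tendsto_power_div_exp_0)
  then have "((\<lambda>s::real. inverse s ^ n / exp (inverse s)) \<longlongrightarrow> 0) (at_right 0)"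
    by (rule filterlim_compose[OF _ filterlim_inverse_at_top_right])
  then show ?thesis
    by (rule Lim_transform_eventually)
      (auto simp: flat_exp_def eventually_at_filter exp_minus divide_inverse)
qed

lemma flat_exp_deriv:
  "(flat_exp n has_real_derivative - real n * flat_exp (Suc n) s + flat_exp (Suc (Suc n)) s) (at s)"
proof -
  consider "s > 0" | "s < 0" | "s = 0" by linarith
  then show ?thesis
  proof cases
    case 1
    have "((\<lambda>s. inverse s ^ n * exp (- inverse s)) has_real_derivative
        - real n * flat_exp (Suc n) s + flat_exp (Suc (Suc n)) s) (at s)"
    proof (cases n)
      case 0
      then show ?thesis using 1
        by (auto intro!: derivative_eq_intros simp: flat_exp_def)
    next
      case (Suc k)
      have "((\<lambda>s. inverse s ^ Suc k * exp (- inverse s)) has_real_derivative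
         (1 + real k) * (- (inverse s * inverse s) * inverse s ^ k) * exp (- inverse s)
         + exp (- inverse s) * (inverse s * inverse s) * inverse s ^ Suc k) (at s)"
        using 1 by (intro derivative_eq_intros refl) (auto simp: algebra_simps)
      then show ?thesis using 1 by (simp add: Suc flat_exp_def algebra_simps)
    qed
    then show ?thesis
      by (rule DERIV_cong_ev[THEN iffD1, rotated -1])
        (use 1 eventually_nhds_in_open[of "{0<..}" s] in \<open>auto elim!: eventually_mono simp: flat_exp_def\<close>)
  next
    case 2
    have "((\<lambda>s::real. 0) has_real_derivative 0) (at s)" by simp
    then show ?thesis
      by (rule DERIV_cong_ev[THEN iffD1, rotated -1])
        (use 2 eventually_nhds_in_open[of "{..<0}" s] in \<open>auto elim!: eventually_mono simp: flat_exp_def\<close>)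
  next
    case 3
    have "((\<lambda>h. (flat_exp n (0 + h) - flat_exp n 0) / h) \<longlongrightarrow> 0) (at 0)"
    proof (rule filterlim_split_at)
      show "((\<lambda>h. (flat_exp n (0 + h) - flat_exp n 0) / h) \<longlongrightarrow> 0) (at_left 0)"
        by (rule Lim_transform_eventually[OF tendsto_const])
          (auto simp: flat_exp_def eventually_at_filter)
      \<comment> \<open>For positive \<open>h\<close> the difference quotient at the origin is
        \<open>flat_exp (Suc n) h\<close>, so the limit is already known for the next index.\<close>
      show "((\<lambda>h. (flat_exp n (0 + h) - flat_exp n 0) / h) \<longlongrightarrow> 0) (at_right 0)"
        by (rule Lim_transform_eventually[OF flat_exp_tendsto[of "Suc n"]])
          (auto simp: flat_exp_def eventually_at_filter field_simps)
    qed
    then show ?thesis using 3 by (simp add: DERIV_def flat_exp_def)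
  qed
qed

lemma smooth_on_flat_exp:
  assumes "open U" "smooth_on U f"
  shows "smooth_on U (\<lambda>x. flat_exp n (f x))"
  unfolding smooth_on_ck
proof
  fix k
  show "ck k U (\<lambda>x. flat_exp n (f x))"
  proof (rule ck_real_compose[where g = flat_exp and V = UNIV and
        g' = "\<lambda>n s. - real n * flat_exp (Suc n) s + flat_exp (Suc (Suc n)) s"])
    show "ck k U (\<lambda>x. - real n * flat_exp (Suc n) (f x) + flat_exp (Suc (Suc n)) (f x))"
      if *: "\<And>n. ck k U (\<lambda>x. flat_exp n (f x))" for k n and f :: "'a \<Rightarrow> real"
      by (intro ck_add ck_bilinear[OF bounded_bilinear_mult] ck_const * assms(1))
  qed (use assms flat_exp_deriv in \<open>auto simp: smooth_on_ck\<close>)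
qed

text \<open>The squared distance is used because it is smooth at the centre as well.\<close>

definition bump :: "'a::real_inner \<Rightarrow> real \<Rightarrow> 'a \<Rightarrow> real" where
  "bump x0 r x = flat_exp 0 (r\<^sup>2 - (x - x0) \<bullet> (x - x0))"

lemma smooth_on_bump: "open U \<Longrightarrow> smooth_on U (bump x0 r)"
  unfolding bump_def by (intro smooth_on_flat_exp smooth_intros)

lemma bump_nonneg: "bump x0 r x \<ge> 0"
  by (simp add: bump_def flat_exp_def)

lemma bump_pos_iff: "r > 0 \<Longrightarrow> bump x0 r x > 0 \<longleftrightarrow> dist x0 x < r"
  unfolding bump_def flat_exp_def dist_norm
  by (simp add: norm_minus_commute power2_norm_eq_inner[symmetric] abs_square_less_1 power_mono_iff)
     (metis norm_ge_zero norm_minus_commute power2_less_imp_less power_strict_mono less_imp_le zero_less_numeral)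

lemma bump_eq_0: "r > 0 \<Longrightarrow> r \<le> dist x0 x \<Longrightarrow> bump x0 r x = 0"
  using bump_pos_iff[of r x0 x] bump_nonneg[of x0 r x] by linarith

section \<open>Determinants and inverse matrices\<close>

lemma matrix_inv_right:
    fixes A :: "'a::semiring_1^'n::finite^'m::finite"
  assumes "invertible A" shows "A ** matrix_inv A = mat 1"
  using someI_ex[OF assms[unfolded invertible_def]] by (simp add: matrix_inv_def)

lemma matrix_inv_left:
  fixes A :: "'a::semiring_1^'n::finite^'m::finite"
  assumes "invertible A" shows "matrix_inv A ** A = mat 1"
  using someI_ex[OF assms[unfolded invertible_def]] by (simp add: matrix_inv_def)

lemma invertible_pos_def:
  fixes A :: "real^'n::finite^'n"
  assumes "\<And>v. v \<noteq> 0 \<Longrightarrow> v \<bullet> (A *v v) > 0"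
  shows "invertible A"
proof -
  have "x = 0" if "A *v x = 0" for x
    using assms[of x] that by fastforce
  then show ?thesis
    by (simp add: invertible_left_inverse matrix_left_invertible_ker)
qed

lemma continuous_on_det:
  fixes A :: "'a::topological_space \<Rightarrow> real^'n::finite^'n"
  assumes "\<And>i j. continuous_on S (\<lambda>x. A x $ i $ j)"
  shows "continuous_on S (\<lambda>x. det (A x))"
  unfolding det_def by (intro continuous_intros assms)

text \<open>The segment from the identity to \<open>A\<close> consists of positive definite, hence
  invertible, matrices. By the intermediate value theorem a determinant that is not positive at
  \<open>A\<close> would vanish somewhere on it.\<close>

lemma det_pos_def:
  fixes A :: "real^'n::finite^'n"
  assumes A: "\<And>v. v \<noteq> 0 \<Longrightarrow> v \<bullet> (A *v v) > 0"
  shows "det A > 0"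
proof (rule ccontr)
  define P where "P t = (1 - t) *\<^sub>R (mat 1 :: real^'n^'n) + t *\<^sub>R A" for t :: real
  assume "\<not> det A > 0"
  moreover have "P 0 = mat 1" "P 1 = A" by (auto simp: P_def)
  ultimately have "det (P 1) \<le> 0" "0 \<le> det (P 0)" by auto
  moreover have "continuous_on {0..1} (\<lambda>t. det (P t))"
    unfolding P_def by (intro continuous_on_det) (auto intro!: continuous_intros)
  ultimately obtain t where t: "0 \<le> t" "t \<le> 1" "det (P t) = 0"
    using IVT2'[of "\<lambda>t. det (P t)" 1 0 0] by auto
  have "v \<bullet> (P t *v v) > 0" if "v \<noteq> 0" for v
  proof -
    have "P t *v v = (1 - t) *\<^sub>R v + t *\<^sub>R (A *v v)"
      by (simp add: P_def matrix_vector_mult_add_rdistrib scaleR_matrix_vector_assoc[symmetric])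
    then have "v \<bullet> (P t *v v) = (1 - t) * (v \<bullet> v) + t * (v \<bullet> (A *v v))"
      by (simp add: inner_add_right)
    moreover have "(1 - t) * (v \<bullet> v) \<ge> 0" "t * (v \<bullet> (A *v v)) \<ge> 0"
      using t A[OF that] by auto
    moreover have "(1 - t) * (v \<bullet> v) > 0 \<or> t * (v \<bullet> (A *v v)) > 0"
      using t A[OF that] that by (cases "t = 1") auto
    ultimately show ?thesis by linarith
  qed
  then have "invertible (P t)" by (rule invertible_pos_def)
  with t show False by (simp add: invertible_det_nz)
qed

lemma smooth_on_det:
  fixes A :: "'a::real_normed_vector \<Rightarrow> real^'n::finite^'n"
  assumes "open U" "\<And>i j. smooth_on U (\<lambda>x. A x $ i $ j)"
  shows "smooth_on U (\<lambda>x. det (A x))"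
  unfolding det_def by (intro smooth_intros smooth_on_prod assms)

text \<open>Cramer's rule writes every entry of the inverse as a quotient of two determinants, which
  are polynomials in the entries.\<close>

lemma smooth_on_matrix_inv:
  fixes A :: "'a::real_normed_vector \<Rightarrow> real^'n::finite^'n"
  assumes "open U" "\<And>i j. smooth_on U (\<lambda>x. A x $ i $ j)" "\<And>x. x \<in> U \<Longrightarrow> invertible (A x)"
  shows "smooth_on U (\<lambda>x. matrix_inv (A x) $ i $ j)"
proof (rule smooth_on_cong[OF assms(1)])
  \<comment> \<open>\<open>A x\<close> with column \<open>i\<close> replaced by the
    \<open>j\<close>-th unit vector, the right-hand side of the linear system for column
    \<open>j\<close> of the inverse.\<close>
  let ?B = "\<lambda>x. (\<chi> a b. if b = i then (axis j 1 :: real^'n) $ a else A x $ a $ b) :: real^'n^'n"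
  have "smooth_on U (\<lambda>x. ?B x $ a $ b)" for a b
    using assms(2) by (cases "b = i") auto
  then show "smooth_on U (\<lambda>x. det (?B x) / det (A x))"
    by (intro smooth_on_divide smooth_on_det assms(1,2)) (use assms(3) invertible_det_nz in auto)
  show "det (?B x) / det (A x) = matrix_inv (A x) $ i $ j" if "x \<in> U" for x
  proof -
    have "A x ** matrix_inv (A x) = mat 1" using assms(3)[OF that] by (rule matrix_inv_right)
    then have "A x *v (matrix_inv (A x) *v axis j 1) = axis j 1"
      by (simp add: matrix_vector_mul_assoc)
    then have "matrix_inv (A x) *v axis j 1
      = (\<chi> k. det (\<chi> a b. if b = k then (axis j 1 :: real^'n) $ a else A x $ a $ b) / det (A x))"
      using assms(3)[OF that] by (subst (asm) cramer) (auto simp: invertible_det_nz)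
    then have "(matrix_inv (A x) *v axis j 1) $ i = det (?B x) / det (A x)" by simp
    then show ?thesis
      by (simp add: matrix_vector_mult_basis column_def)
  qed
qed

text \<open>A permutation other than the identity moves at least two points, so one moved index is
  left after \<open>i\<close> has been removed, and it contributes a zero factor.\<close>

lemma prod_off_diagonal_permutation:
  assumes p: "p permutes (UNIV :: 'n::finite set)" "p \<noteq> id"
  shows "(\<Prod>j\<in>UNIV - {i}. (if j = p j then 1 else 0 :: real)) = 0"
proof -
  obtain a where a: "p a \<noteq> a" using p by fastforce
  have "p (p a) \<noteq> p a" using a permutes_inj[OF p(1)] by (auto dest: injD)
  with a have "\<exists>j. j \<noteq> i \<and> p j \<noteq> j" by (cases "a = i") auto
  then obtain j where "j \<in> UNIV - {i}" "j \<noteq> p j" by auto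
  then show ?thesis by (auto intro!: prod_zero)
qed

text \<open>In the Leibniz expansion only the identity permutation has a first-order term at the
  identity matrix, and that term is the trace.\<close>

lemma has_derivative_det_at_identity:
  fixes C :: "'a::real_normed_vector \<Rightarrow> real^'n::finite^'n"
  assumes "\<And>i j. ((\<lambda>y. C y $ i $ j) has_derivative (\<lambda>v. D v $ i $ j)) (at x)" "C x = mat 1"
  shows "((\<lambda>y. det (C y)) has_derivative (\<lambda>v. \<Sum>i\<in>UNIV. D v $ i $ i)) (at x)"
proof -
  have "((\<lambda>y. \<Sum>p\<in>{p. p permutes (UNIV::'n set)}. of_int (sign p) * (\<Prod>i\<in>UNIV. C y $ i $ p i))
    has_derivative (\<lambda>v. \<Sum>p\<in>{p. p permutes (UNIV::'n set)}. of_int (sign p) *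
      (\<Sum>i\<in>UNIV. D v $ i $ p i * (\<Prod>j\<in>UNIV - {i}. C x $ j $ p j)))) (at x)"
    by (intro has_derivative_sum has_derivative_mult_right has_derivative_prod assms(1))
  moreover have "(\<Sum>p\<in>{p. p permutes (UNIV::'n set)}. of_int (sign p) *
      (\<Sum>i\<in>UNIV. D v $ i $ p i * (\<Prod>j\<in>UNIV - {i}. C x $ j $ p j))) = (\<Sum>i\<in>UNIV. D v $ i $ i)" for v
  proof -
    have "(\<Sum>i\<in>UNIV. D v $ i $ p i * (\<Prod>j\<in>UNIV - {i}. C x $ j $ p j))
        = (if p = id then \<Sum>i\<in>UNIV. D v $ i $ i else 0)" if "p permutes (UNIV::'n set)" for p
      by (cases "p = id") (simp_all add: assms(2) mat_def prod_off_diagonal_permutation[OF that])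
    then have "(\<Sum>p\<in>{p. p permutes (UNIV::'n set)}. of_int (sign p) *
        (\<Sum>i\<in>UNIV. D v $ i $ p i * (\<Prod>j\<in>UNIV - {i}. C x $ j $ p j)))
      = (\<Sum>p\<in>{p. p permutes (UNIV::'n set)}. if p = id then \<Sum>i\<in>UNIV. D v $ i $ i else 0)"
      by (intro sum.cong) (auto simp: sign_id)
    then show ?thesis by (simp add: sum.delta permutes_id finite_permutations)
  qed
  ultimately show ?thesis by (simp add: det_def)
qed

text \<open>Jacobi's formula. Multiplication by the fixed matrix \<open>matrix_inv (A x)\<close>
  reduces it to the derivative at the identity.\<close>

lemma dir_deriv_det:
  fixes A :: "'a::real_normed_vector \<Rightarrow> real^'n::finite^'n"
  assumes "invertible (A x)" "\<And>i j. (\<lambda>y. A y $ i $ j) differentiable (at x)"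
  shows "dir_deriv v (\<lambda>y. det (A y)) x
    = det (A x) * (\<Sum>i\<in>UNIV. \<Sum>j\<in>UNIV. matrix_inv (A x) $ i $ j * dir_deriv v (\<lambda>y. A y $ j $ i) x)"
proof -
  let ?C = "\<lambda>y. matrix_inv (A x) ** A y"
  let ?D = "\<lambda>v. (\<chi> i k. \<Sum>j\<in>UNIV. matrix_inv (A x) $ i $ j * dir_deriv v (\<lambda>y. A y $ j $ k) x) :: real^'n^'n"
  have I: "A x ** matrix_inv (A x) = mat 1" "matrix_inv (A x) ** A x = mat 1"
    using assms(1) by (auto simp: matrix_inv_right matrix_inv_left)
  have "((\<lambda>y. det (?C y)) has_derivative (\<lambda>v. \<Sum>i\<in>UNIV. ?D v $ i $ i)) (at x)"
  proof (rule has_derivative_det_at_identity)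
    fix i k
    show "((\<lambda>y. ?C y $ i $ k) has_derivative (\<lambda>v. ?D v $ i $ k)) (at x)"
      unfolding matrix_matrix_mult_def vec_lambda_beta
      by (intro has_derivative_sum has_derivative_mult_right dir_deriv_works assms(2))
  qed (simp add: I)
  then have "((\<lambda>y. det (A x) * det (?C y)) has_derivative (\<lambda>v. det (A x) * (\<Sum>i\<in>UNIV. ?D v $ i $ i))) (at x)"
    by (rule has_derivative_mult_right)
  moreover have "det (A x) * det (?C y) = det (A y)" for y
    using I(1) by (metis det_mul matrix_mul_assoc matrix_mul_lid)
  ultimately show ?thesis by (simp add: dir_deriv_eq)
qed

text \<open>Differentiating the identity that the inverse times the matrix is constant, then
  multiplying by the inverse from the right.\<close>

lemma dir_deriv_matrix_inv:
  fixes A :: "'a::real_normed_vector \<Rightarrow> real^'n::finite^'n"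
  assumes U: "open U" "x \<in> U" "\<And>y. y \<in> U \<Longrightarrow> invertible (A y)"
    and A: "\<And>i j. smooth_on U (\<lambda>y. A y $ i $ j)"
  shows "dir_deriv v (\<lambda>y. matrix_inv (A y) $ i $ k) x
    = - (\<Sum>p\<in>UNIV. \<Sum>q\<in>UNIV. matrix_inv (A x) $ i $ p * dir_deriv v (\<lambda>y. A y $ p $ q) x * matrix_inv (A x) $ q $ k)"
proof -
  let ?I = "\<lambda>i k y. matrix_inv (A y) $ i $ k" and ?A = "\<lambda>i k y. A y $ i $ k"
  have dA: "?A i k differentiable (at x)" and dI: "?I i k differentiable (at x)" for i k
    using smooth_on_differentiable[OF A U(2)]
      smooth_on_differentiable[OF smooth_on_matrix_inv[OF U(1) A U(3)] U(2)] by auto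
  have l: "(\<Sum>q\<in>UNIV. ?I i q y * ?A q r y) = (if i = r then 1 else 0)"
    and rr: "(\<Sum>q\<in>UNIV. ?A i q y * ?I q r y) = (if i = r then 1 else 0)" if "y \<in> U" for i r y
    using matrix_inv_left[OF U(3)[OF that]] matrix_inv_right[OF U(3)[OF that]]
    by (simp_all add: vec_eq_iff matrix_matrix_mult_def mat_def)
  have 0: "(\<Sum>q\<in>UNIV. dir_deriv v (?I i q) x * ?A q r x) = - (\<Sum>q\<in>UNIV. ?I i q x * dir_deriv v (?A q r) x)" for r
  proof -
    have "dir_deriv v (\<lambda>y. \<Sum>q\<in>UNIV. ?I i q y * ?A q r y) x = dir_deriv v (\<lambda>y. if i = r then 1 else 0) x"
      by (rule dir_deriv_cong_open[OF U(1,2)]) (rule l)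
    moreover have "dir_deriv v (\<lambda>y. \<Sum>q\<in>UNIV. ?I i q y * ?A q r y) x
      = (\<Sum>q\<in>UNIV. ?I i q x * dir_deriv v (?A q r) x + dir_deriv v (?I i q) x * ?A q r x)"
      using dA dI by (subst dir_deriv_sum) (auto simp: dir_deriv_mult)
    ultimately show ?thesis by (simp add: sum.distrib split: if_splits)
  qed
  have "dir_deriv v (?I i k) x = (\<Sum>q\<in>UNIV. dir_deriv v (?I i q) x * (if q = k then 1 else 0))"
    by (simp add: if_distrib cong: if_cong)
  also have "\<dots> = (\<Sum>q\<in>UNIV. dir_deriv v (?I i q) x * (\<Sum>r\<in>UNIV. ?A q r x * ?I r k x))"
    by (simp add: rr[OF U(2)])
  also have "\<dots> = (\<Sum>r\<in>UNIV. (\<Sum>q\<in>UNIV. dir_deriv v (?I i q) x * ?A q r x) * ?I r k x)"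
    unfolding sum_distrib_left sum_distrib_right by (subst sum.swap) (simp add: mult.assoc)
  also have "\<dots> = - (\<Sum>p\<in>UNIV. \<Sum>q\<in>UNIV. ?I i p x * dir_deriv v (?A p q) x * ?I q k x)"
    unfolding 0 by (subst sum.swap) (simp add: sum_distrib_right sum_negf)
  finally show ?thesis .
qed

section \<open>The Laplacian in a chart\<close>

text \<open>The trace of the covariant Hessian, in contrast to the divergence form behind
  \<open>laplacian\<close>. It accepts vector-valued functions at once and is the form in which the
  Laplacian occurs inside the tension field.\<close>

definition lap :: "('a, 'm::finite, 'z) riem_scheme \<Rightarrow> ('a, 'm) chart \<Rightarrow> (real^'m \<Rightarrow> 'w::real_normed_vector) \<Rightarrow> real^'m \<Rightarrow> 'w"
  where "lap M c u x = metric_trace M c x (\<lambda>i j. partial i (partial j u) x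
    - (\<Sum>k\<in>UNIV. christoffel M c x k i j *\<^sub>R partial k u x))"

definition grad_inner :: "('a, 'm::finite, 'z) riem_scheme \<Rightarrow> ('a, 'm) chart \<Rightarrow> (real^'m \<Rightarrow> 'w::real_inner)
    \<Rightarrow> (real^'m \<Rightarrow> 'w) \<Rightarrow> real^'m \<Rightarrow> real"
  where "grad_inner M c u v x = metric_trace M c x (\<lambda>i j. partial i u x \<bullet> partial j v x)"

text \<open>For sphere-valued \<open>u\<close> this is the squared length of the tension field (see
  \<open>norm_lap_u\<close> and \<open>tension_norm_u\<close>), written without any chart of the
  sphere.\<close>

abbreviation tension_sq :: "('a, 'm::finite, 'z) riem_scheme \<Rightarrow> ('a, 'm) chart \<Rightarrow> (real^'m \<Rightarrow> 'w::real_inner)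
    \<Rightarrow> real^'m \<Rightarrow> real"
  where "tension_sq M c u x \<equiv> lap M c u x \<bullet> lap M c u x - grad_inner M c u u x * grad_inner M c u u x"

text \<open>The open set \<open>V\<close> is a parameter rather than the full coordinate image, so
  that the results also apply to overlaps of charts and to the part of a chart that is mapped away
  from a pole of the sphere.\<close>

locale riem_chart =
  fixes M :: "('a, 'm::finite, 'z) riem_scheme" and c :: "('a, 'm) chart" and V :: "(real^'m) set"
  assumes open_V: "open V"
    and smooth_metric: "smooth_on V (metric M c)"
    and sym_metric: "x \<in> V \<Longrightarrow> transpose (metric M c x) = metric M c x"
    and pos_metric: "x \<in> V \<Longrightarrow> v \<noteq> 0 \<Longrightarrow> v \<bullet> (metric M c x *v v) > 0"
begin

abbreviation "g i j x \<equiv> metric M c x $ i $ j"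
abbreviation "a i j x \<equiv> inv_metric M c x $ i $ j"
abbreviation "vd \<equiv> volume_density M c"

lemma invertible_metric: "x \<in> V \<Longrightarrow> invertible (metric M c x)"
  using pos_metric by (intro invertible_pos_def) auto

lemma det_metric_pos: "x \<in> V \<Longrightarrow> det (metric M c x) > 0"
  using pos_metric by (intro det_pos_def) auto

lemma vd_pos: "x \<in> V \<Longrightarrow> vd x > 0"
  using det_metric_pos by (simp add: volume_density_def)

lemma metric_inverse:
  "x \<in> V \<Longrightarrow> inv_metric M c x ** metric M c x = mat 1"
  "x \<in> V \<Longrightarrow> metric M c x ** inv_metric M c x = mat 1"
  using invertible_metric unfolding inv_metric_def by (auto simp: matrix_inv_left matrix_inv_right)

lemma g_sym: "x \<in> V \<Longrightarrow> g i j x = g j i x"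
  using sym_metric[of x] by (simp add: transpose_def vec_eq_iff)

lemma sym_inv_metric: "x \<in> V \<Longrightarrow> transpose (inv_metric M c x) = inv_metric M c x"
  by (metis metric_inverse matrix_transpose_mul sym_metric transpose_mat matrix_mul_assoc matrix_mul_lid matrix_mul_rid)

lemma a_sym: "x \<in> V \<Longrightarrow> a i j x = a j i x"
  using sym_inv_metric[of x] by (simp add: transpose_def vec_eq_iff)

lemma smooth_g: "smooth_on V (g i j)"
  using open_V smooth_metric by (intro smooth_intros)

lemma smooth_a: "smooth_on V (a i j)"
  unfolding inv_metric_def using invertible_metric by (intro smooth_on_matrix_inv open_V smooth_g)

lemma smooth_vd: "smooth_on V vd"
  unfolding volume_density_def by (intro smooth_on_sqrt smooth_on_det open_V smooth_g det_metric_pos)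

lemma smooth_christoffel: "smooth_on V (\<lambda>x. christoffel M c x k i j)"
proof -
  have "smooth_on V (\<lambda>x. (1/2) * (\<Sum>l\<in>UNIV. a k l x *
       (partial i (g j l) x + partial j (g i l) x - partial l (g i j) x)))"
    by (intro smooth_intros open_V smooth_a smooth_g)
  then show ?thesis by (simp add: christoffel_def)
qed

lemma smooth_lap: "smooth_on V u \<Longrightarrow> smooth_on V (lap M c u)"
  unfolding lap_def metric_trace_def
  by (intro smooth_intros open_V smooth_a smooth_christoffel)

lemma smooth_grad_inner: "smooth_on V u \<Longrightarrow> smooth_on V v \<Longrightarrow> smooth_on V (grad_inner M c u v)"
  unfolding grad_inner_def metric_trace_def
  by (intro smooth_intros open_V smooth_a)

lemma partial_vd:
  assumes "x \<in> V"
  shows "partial i vd x = vd x * (\<Sum>p\<in>UNIV. \<Sum>q\<in>UNIV. a p q x * partial i (g q p) x) / 2"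
proof -
  have dg: "g i j differentiable (at x)" for i j
    using smooth_g assms by (rule smooth_on_differentiable)
  have det: "det (metric M c x) > 0" using assms by (rule det_metric_pos)
  have "(\<lambda>y. det (metric M c y)) differentiable (at x)"
    using smooth_on_det[OF open_V smooth_g] assms by (rule smooth_on_differentiable)
  then have "partial i vd x = inverse (sqrt (det (metric M c x))) / 2 * partial i (\<lambda>y. det (metric M c y)) x"
    unfolding volume_density_def
    by (rule dir_deriv_real_compose) (rule DERIV_real_sqrt[OF det])
  also have "\<dots> = inverse (sqrt (det (metric M c x))) / 2 * (det (metric M c x) *
     (\<Sum>p\<in>UNIV. \<Sum>q\<in>UNIV. a p q x * partial i (g q p) x))"
    unfolding inv_metric_def using dg invertible_metric[OF assms] by (subst dir_deriv_det) auto
  also have "inverse (sqrt (det (metric M c x))) * det (metric M c x) = vd x"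
    using det by (simp add: volume_density_def field_simps)
  then have "inverse (sqrt (det (metric M c x))) / 2 * (det (metric M c x) * X) = vd x * X / 2" for X
    by (metis mult.assoc times_divide_eq_left)
  finally show ?thesis .
qed

text \<open>The density contributes, by Jacobi's formula, half a trace of the derivative of the
  metric, and the inverse metric contributes its own derivative. Renaming indices turns them into
  the three terms of the contracted Christoffel symbol.\<close>

lemma divergence_of_inverse_metric:
  assumes x: "x \<in> V"
  shows "(\<Sum>i\<in>UNIV. partial i vd x / vd x * a i k x + partial i (a i k) x)
    = - (\<Sum>i\<in>UNIV. \<Sum>j\<in>UNIV. a i j x * christoffel M c x k i j)"
proof -
  let ?d = "\<lambda>l i j. partial l (g i j) x"
  have ds: "?d l i j = ?d l j i" for l i j
    by (rule dir_deriv_cong_open[OF open_V x]) (rule g_sym)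
  have as: "a i j x = a j i x" for i j using x by (rule a_sym)
  have "(\<Sum>i\<in>UNIV. partial i vd x / vd x * a i k x + partial i (a i k) x)
    = (\<Sum>i\<in>UNIV. (\<Sum>p\<in>UNIV. \<Sum>q\<in>UNIV. a p q x * ?d i q p) / 2 * a i k x
        - (\<Sum>p\<in>UNIV. \<Sum>q\<in>UNIV. a i p x * ?d i p q * a q k x))"
  proof (intro sum.cong refl)
    fix i
    have "partial i vd x / vd x = (\<Sum>p\<in>UNIV. \<Sum>q\<in>UNIV. a p q x * ?d i q p) / 2"
      using vd_pos[OF x] partial_vd[OF x, of i] by simp
    moreover have "partial i (a i k) x = - (\<Sum>p\<in>UNIV. \<Sum>q\<in>UNIV. a i p x * ?d i p q * a q k x)"
      by (rule dir_deriv_matrix_inv[OF open_V x invertible_metric smooth_g, folded inv_metric_def])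
    ultimately show "partial i vd x / vd x * a i k x + partial i (a i k) x
      = (\<Sum>p\<in>UNIV. \<Sum>q\<in>UNIV. a p q x * ?d i q p) / 2 * a i k x
        - (\<Sum>p\<in>UNIV. \<Sum>q\<in>UNIV. a i p x * ?d i p q * a q k x)"
      by (simp only: add_uminus_conv_diff)
  qed
  also have "\<dots> = (\<Sum>i\<in>UNIV. \<Sum>p\<in>UNIV. \<Sum>q\<in>UNIV. a p q x * ?d i q p / 2 * a i k x)
        - (\<Sum>i\<in>UNIV. \<Sum>p\<in>UNIV. \<Sum>q\<in>UNIV. a i p x * ?d i p q * a q k x)"
    by (simp add: sum_subtractf sum_distrib_right sum_divide_distrib)
  also have "(\<Sum>i\<in>UNIV. \<Sum>p\<in>UNIV. \<Sum>q\<in>UNIV. a p q x * ?d i q p / 2 * a i k x)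
      = (\<Sum>i\<in>UNIV. \<Sum>j\<in>UNIV. \<Sum>l\<in>UNIV. a i j x * a k l x * ?d l i j / 2)"
  proof -
    have "(\<Sum>i\<in>UNIV. \<Sum>p\<in>UNIV. \<Sum>q\<in>UNIV. a p q x * ?d i q p / 2 * a i k x)
      = (\<Sum>l\<in>UNIV. \<Sum>i\<in>UNIV. \<Sum>j\<in>UNIV. a i j x * a k l x * ?d l i j / 2)"
      by (intro sum.cong refl) (simp add: as[of k] ds)
    also have "\<dots> = (\<Sum>i\<in>UNIV. \<Sum>l\<in>UNIV. \<Sum>j\<in>UNIV. a i j x * a k l x * ?d l i j / 2)"
      by (rule sum.swap)
    also have "\<dots> = (\<Sum>i\<in>UNIV. \<Sum>j\<in>UNIV. \<Sum>l\<in>UNIV. a i j x * a k l x * ?d l i j / 2)"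
      by (intro sum.cong refl sum.swap)
    finally show ?thesis .
  qed
  also have "(\<Sum>i\<in>UNIV. \<Sum>p\<in>UNIV. \<Sum>q\<in>UNIV. a i p x * ?d i p q * a q k x)
      = (\<Sum>i\<in>UNIV. \<Sum>j\<in>UNIV. \<Sum>l\<in>UNIV. a i j x * a k l x * ?d i j l)"
    by (intro sum.cong refl) (simp add: as[of k])
  \<comment> \<open>Contraction with the symmetric \<open>a i j x\<close> allows averaging over the
    exchange of \<open>i\<close> and \<open>j\<close>, which supplies the two terms that the
    Christoffel symbol carries with a plus sign.\<close>
  also have "(\<Sum>i\<in>UNIV. \<Sum>j\<in>UNIV. \<Sum>l\<in>UNIV. a i j x * a k l x * ?d i j l)
      = (\<Sum>i\<in>UNIV. \<Sum>j\<in>UNIV. \<Sum>l\<in>UNIV. a i j x * a k l x * (?d i j l + ?d j i l) / 2)"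
  proof -
    have "(\<Sum>i\<in>UNIV. \<Sum>j\<in>UNIV. \<Sum>l\<in>UNIV. a i j x * a k l x * ?d i j l)
      = (\<Sum>j\<in>UNIV. \<Sum>i\<in>UNIV. \<Sum>l\<in>UNIV. a i j x * a k l x * ?d i j l)" by (rule sum.swap)
    also have "\<dots> = (\<Sum>i\<in>UNIV. \<Sum>j\<in>UNIV. \<Sum>l\<in>UNIV. a i j x * a k l x * ?d j i l)"
      by (intro sum.cong refl) (simp add: as)
    finally show ?thesis
      by (simp add: distrib_left add_divide_distrib sum.distrib sum_divide_distrib[symmetric])
  qed
  finally have "(\<Sum>i\<in>UNIV. partial i vd x / vd x * a i k x + partial i (a i k) x)
    = (\<Sum>i\<in>UNIV. \<Sum>j\<in>UNIV. \<Sum>l\<in>UNIV. a i j x * a k l x * ?d l i j / 2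
        - a i j x * a k l x * (?d i j l + ?d j i l) / 2)"
    by (simp add: sum_subtractf)
  also have "\<dots> = (\<Sum>i\<in>UNIV. \<Sum>j\<in>UNIV. - (a i j x * christoffel M c x k i j))"
    unfolding christoffel_def sum_distrib_left sum_divide_distrib sum_negf[symmetric]
    by (intro sum.cong refl) (simp add: field_simps)
  finally show ?thesis by (simp add: sum_negf)
qed

text \<open>The product rule separates second-order from first-order terms, and
  \<open>divergence_of_inverse_metric\<close> identifies the latter with Christoffel symbols. This
  is the link between the divergence form and the Hessian form of the Laplacian.\<close>

lemma divergence_form:
  fixes u :: "real^'m \<Rightarrow> real"
  assumes x: "x \<in> V" and u: "smooth_on V u"
  shows "(\<Sum>i\<in>UNIV. partial i (\<lambda>y. vd y * (\<Sum>j\<in>UNIV. a i j y * partial j u y)) x) = vd x * lap M c u x"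
proof -
  have d: "vd differentiable (at x)" "a i j differentiable (at x)" "partial j u differentiable (at x)"
    "(\<lambda>y. a i j y * partial j u y) differentiable (at x)"
    "(\<lambda>y. \<Sum>j\<in>UNIV. a i j y * partial j u y) differentiable (at x)" for i j
    by (rule smooth_on_differentiable[OF _ x], intro smooth_intros smooth_vd smooth_a u open_V)+
  have s: "vd x \<noteq> 0" using vd_pos[OF x] by simp
  have "(\<Sum>i\<in>UNIV. partial i (\<lambda>y. vd y * (\<Sum>j\<in>UNIV. a i j y * partial j u y)) x)
    = (\<Sum>i\<in>UNIV. vd x * (\<Sum>j\<in>UNIV. a i j x * partial i (partial j u) x + partial i (a i j) x * partial j u x)
        + partial i vd x * (\<Sum>j\<in>UNIV. a i j x * partial j u x))"
    by (simp add: dir_deriv_mult dir_deriv_sum d)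
  also have "\<dots> = (\<Sum>i\<in>UNIV. \<Sum>j\<in>UNIV. vd x * (a i j x * partial i (partial j u) x)
      + vd x * ((partial i vd x / vd x * a i j x + partial i (a i j) x) * partial j u x))"
    using s by (simp add: sum_distrib_left sum.distrib[symmetric] algebra_simps)
  also have "\<dots> = vd x * ((\<Sum>i\<in>UNIV. \<Sum>j\<in>UNIV. a i j x * partial i (partial j u) x)
      + (\<Sum>i\<in>UNIV. \<Sum>k\<in>UNIV. (partial i vd x / vd x * a i k x + partial i (a i k) x) * partial k u x))"
    by (simp add: sum_distrib_left sum.distrib distrib_left)
  also have "(\<Sum>i\<in>UNIV. \<Sum>k\<in>UNIV. (partial i vd x / vd x * a i k x + partial i (a i k) x) * partial k u x)
     = (\<Sum>k\<in>UNIV. (\<Sum>i\<in>UNIV. partial i vd x / vd x * a i k x + partial i (a i k) x) * partial k u x)"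
    by (subst sum.swap) (simp add: sum_distrib_right)
  also have "\<dots> = - (\<Sum>k\<in>UNIV. \<Sum>i\<in>UNIV. \<Sum>j\<in>UNIV. a i j x * (christoffel M c x k i j * partial k u x))"
    unfolding divergence_of_inverse_metric[OF x] by (simp add: sum_distrib_right sum_negf mult.assoc)
  also have "(\<Sum>k\<in>UNIV. \<Sum>i\<in>UNIV. \<Sum>j\<in>UNIV. a i j x * (christoffel M c x k i j * partial k u x))
      = (\<Sum>i\<in>UNIV. \<Sum>j\<in>UNIV. a i j x * (\<Sum>k\<in>UNIV. christoffel M c x k i j * partial k u x))"
    unfolding sum_distrib_left
    by (subst sum.swap, rule sum.cong[OF refl], rule sum.swap)
  finally show ?thesis
    by (simp add: lap_def metric_trace_def sum_subtractf right_diff_distrib)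
qed

lemma divergence_gradient:
  assumes "x \<in> V" "smooth_on V (f \<circ> chart_inv c)"
  shows "divergence_coords M c (gradient_coords M c f) x = lap M c (f \<circ> chart_inv c) x"
  using divergence_form[OF assms] vd_pos[OF assms(1)]
  by (simp add: divergence_coords_def gradient_coords_def)

text \<open>The product rule for the divergence of \<open>h\<close> times the weighted gradient of
  \<open>u\<close>; both Green formulas are its integrals.\<close>

lemma green_pointwise:
  fixes u h :: "real^'m \<Rightarrow> real"
  assumes x: "x \<in> V" and u: "smooth_on V u" and h: "smooth_on V h"
  shows "(\<Sum>i\<in>UNIV. partial i (\<lambda>y. h y * (vd y * (\<Sum>j\<in>UNIV. a i j y * partial j u y))) x)
    = vd x * (h x * lap M c u x) + vd x * grad_inner M c h u x"
proof -
  have d: "h differentiable (at x)" "(\<lambda>y. vd y * (\<Sum>j\<in>UNIV. a i j y * partial j u y)) differentiable (at x)" for i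
    by (rule smooth_on_differentiable[OF _ x], intro smooth_intros smooth_vd smooth_a u h open_V)+
  have "(\<Sum>i\<in>UNIV. partial i (\<lambda>y. h y * (vd y * (\<Sum>j\<in>UNIV. a i j y * partial j u y))) x)
    = h x * (\<Sum>i\<in>UNIV. partial i (\<lambda>y. vd y * (\<Sum>j\<in>UNIV. a i j y * partial j u y)) x)
      + (\<Sum>i\<in>UNIV. partial i h x * (vd x * (\<Sum>j\<in>UNIV. a i j x * partial j u x)))"
    unfolding dir_deriv_mult[OF d] by (simp add: sum.distrib sum_distrib_left)
  then show ?thesis unfolding divergence_form[OF x u]
    by (simp add: grad_inner_def metric_trace_def sum_distrib_left ac_simps)
qed

lemma inv_metric_pos:
  assumes x: "x \<in> V" and v: "v \<noteq> 0"
  shows "v \<bullet> (inv_metric M c x *v v) > 0"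
proof -
  let ?w = "inv_metric M c x *v v"
  have v': "metric M c x *v ?w = v"
    using metric_inverse(2)[OF x] by (simp add: matrix_vector_mul_assoc)
  then have "?w \<noteq> 0" using v by auto
  from pos_metric[OF x this] v' show ?thesis by (simp add: inner_commute)
qed

lemma lap_bounded_linear:
  assumes h: "bounded_linear h" and x: "x \<in> V" and u: "smooth_on V u"
  shows "lap M c (\<lambda>y. h (u y)) x = h (lap M c u x)"
proof -
  interpret h: bounded_linear h by (rule h)
  have 1: "partial i (\<lambda>y. h (u y)) y = h (partial i u y)" if "y \<in> V" for i y
    using u that by (intro dir_deriv_bounded_linear h smooth_on_differentiable)
  have 2: "partial i (partial j (\<lambda>y. h (u y))) x = h (partial i (partial j u) x)" for i j
  proof -
    have "partial i (partial j (\<lambda>y. h (u y))) x = partial i (\<lambda>y. h (partial j u y)) x"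
      using 1 by (intro dir_deriv_cong_open[OF open_V x])
    also have "\<dots> = h (partial i (partial j u) x)"
      using u x by (intro dir_deriv_bounded_linear h smooth_on_differentiable smooth_on_dir_deriv)
    finally show ?thesis .
  qed
  show ?thesis unfolding lap_def metric_trace_def
    by (simp add: 1[OF x] 2 h.sum h.scaleR h.diff)
qed

end

lemma lap_cong_open:
  assumes "open V" "x \<in> V" "\<And>y. y \<in> V \<Longrightarrow> u y = v y"
  shows "lap M c u x = lap M c v x"
proof -
  have 1: "partial i u y = partial i v y" if "y \<in> V" for i y
    using assms that by (intro dir_deriv_cong_open) auto
  have "partial i (partial j u) x = partial i (partial j v) x" for i j
    using assms 1 by (intro dir_deriv_cong_open[OF assms(1,2)])
  then show ?thesis unfolding lap_def by (simp add: 1[OF assms(2)])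
qed

lemma grad_inner_cong_open:
  assumes "open V" "x \<in> V" "\<And>y. y \<in> V \<Longrightarrow> u y = u' y" "\<And>y. y \<in> V \<Longrightarrow> v y = v' y"
  shows "grad_inner M c u v x = grad_inner M c u' v' x"
  using dir_deriv_cong_open[OF assms(1,2,3)] dir_deriv_cong_open[OF assms(1,2,4)]
  by (simp add: grad_inner_def)

section \<open>Charts of a Riemannian manifold\<close>

lemma bounded_bilinear_matrix_vector_mult:
  "bounded_bilinear (\<lambda>(A :: real^'n::finite^'m::finite) v. A *v v)"
  unfolding bilinear_conv_bounded_bilinear[symmetric] bilinear_def
  by (auto intro!: linearI simp: matrix_vector_right_distrib matrix_vector_mult_add_rdistrib
      matrix_vector_mult_scaleR scaleR_matrix_vector_assoc)

lemma sum_rotate3: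
  "(\<Sum>k\<in>A. \<Sum>p\<in>B. \<Sum>q\<in>C. f k p q) = (\<Sum>p\<in>B. \<Sum>q\<in>C. \<Sum>k\<in>A. f k p q)"
proof -
  have "(\<Sum>k\<in>A. \<Sum>p\<in>B. \<Sum>q\<in>C. f k p q) = (\<Sum>p\<in>B. \<Sum>k\<in>A. \<Sum>q\<in>C. f k p q)"
    by (rule sum.swap)
  also have "\<dots> = (\<Sum>p\<in>B. \<Sum>q\<in>C. \<Sum>k\<in>A. f k p q)"
    by (rule sum.cong[OF refl]) (rule sum.swap)
  finally show ?thesis .
qed

lemma sum_swap4:
  "(\<Sum>i\<in>A. \<Sum>j\<in>B. \<Sum>p\<in>C. \<Sum>q\<in>D. f i j p q) = (\<Sum>p\<in>C. \<Sum>q\<in>D. \<Sum>i\<in>A. \<Sum>j\<in>B. f i j p q)"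
  by (subst sum_rotate3[symmetric]) (subst sum_rotate3[symmetric], rule refl)

section \<open>Coordinate domains and the topology of the manifold\<close>

locale riem_mfd =
  fixes M :: "('a, 'm::finite, 'z) riem_scheme"
  assumes riem: "riemannian_manifold M"
begin

abbreviation "cimg c \<equiv> chart_map c ` chart_dom c"

lemma smooth_mfd: "smooth_manifold M"
  using riem by (simp add: riemannian_manifold_def)

lemma chart_hom:
  assumes "c \<in> atlas M"
  shows "homeomorphic_map (subtopology (mtop M) (chart_dom c)) (top_of_set (cimg c)) (chart_map c)"
    and openin_chart_dom: "openin (mtop M) (chart_dom c)"
    and open_cimg: "open (cimg c)"
  using smooth_mfd assms by (auto simp: smooth_manifold_def)

lemma chart_dom_subset: "c \<in> atlas M \<Longrightarrow> chart_dom c \<subseteq> topspace (mtop M)"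
  by (rule openin_subset[OF openin_chart_dom])

lemma chart_exists: "p \<in> topspace (mtop M) \<Longrightarrow> \<exists>c\<in>atlas M. p \<in> chart_dom c"
  using smooth_mfd by (auto simp: smooth_manifold_def)

lemma chart_at: "p \<in> topspace (mtop M) \<Longrightarrow> chart_at M p \<in> atlas M \<and> p \<in> chart_dom (chart_at M p)"
  unfolding chart_at_def by (rule someI_ex) (use chart_exists in blast)

lemma topspace_chart:
  "c \<in> atlas M \<Longrightarrow> topspace (subtopology (mtop M) (chart_dom c)) = chart_dom c"
  by (simp add: Int_absorb1 chart_dom_subset)

lemma inj_on_chart: "c \<in> atlas M \<Longrightarrow> inj_on (chart_map c) (chart_dom c)"
  using homeomorphic_imp_injective_map[OF chart_hom(1)] topspace_chart by metis

lemma chart_inv_left [simp]: "c \<in> atlas M \<Longrightarrow> p \<in> chart_dom c \<Longrightarrow> chart_inv c (chart_map c p) = p"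
  unfolding chart_inv_def by (simp add: inj_on_chart)

lemma chart_inv_right: "x \<in> cimg c \<Longrightarrow> chart_map c (chart_inv c x) = x"
  unfolding chart_inv_def by (rule f_inv_into_f)

lemma chart_inv_in: "x \<in> cimg c \<Longrightarrow> chart_inv c x \<in> chart_dom c"
  unfolding chart_inv_def by (rule inv_into_into)

lemma open_chart_image:
  assumes c: "c \<in> atlas M" and A: "openin (mtop M) A" "A \<subseteq> chart_dom c"
  shows "open (chart_map c ` A)"
proof -
  have "openin (subtopology (mtop M) (chart_dom c)) A"
    using A by (auto simp: openin_subtopology intro!: exI[of _ A])
  then have "openin (top_of_set (cimg c)) (chart_map c ` A)"
    using homeomorphic_imp_open_map[OF chart_hom(1)[OF c]] by (simp add: open_map_def)
  then show ?thesis using open_cimg[OF c] openin_open_eq by blast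
qed

lemma openin_chart_preimage:
  assumes c: "c \<in> atlas M" and "open S"
  shows "openin (mtop M) {p \<in> chart_dom c. chart_map c p \<in> S}"
proof -
  have "continuous_map (subtopology (mtop M) (chart_dom c)) (top_of_set (cimg c)) (chart_map c)"
    using homeomorphic_imp_continuous_map[OF chart_hom(1)[OF c]] .
  then have "continuous_map (subtopology (mtop M) (chart_dom c)) euclidean (chart_map c)"
    by (rule continuous_map_into_fulltopology)
  from openin_continuous_map_preimage[OF this, of S]
  have "openin (subtopology (mtop M) (chart_dom c)) {p \<in> chart_dom c. chart_map c p \<in> S}"
    unfolding topspace_chart[OF c] using assms(2) by (simp only: open_openin)
  then show ?thesis by (rule openin_trans_full[OF _ openin_chart_dom[OF c]])
qed

lemma continuous_chart_inv:
  assumes c: "c \<in> atlas M"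
  shows "continuous_map (top_of_set (cimg c)) (mtop M) (chart_inv c)"
proof -
  obtain g where g: "homeomorphic_maps (subtopology (mtop M) (chart_dom c)) (top_of_set (cimg c)) (chart_map c) g"
    using chart_hom(1)[OF c] homeomorphic_map_maps by blast
  have eq: "g x = chart_inv c x" if "x \<in> cimg c" for x
  proof -
    have "chart_inv c x \<in> chart_dom c" using that by (rule chart_inv_in)
    then have "g (chart_map c (chart_inv c x)) = chart_inv c x"
      using g unfolding homeomorphic_maps_def topspace_chart[OF c] by blast
    then show ?thesis using chart_inv_right[OF that] by simp
  qed
  have "continuous_map (top_of_set (cimg c)) (mtop M) g"
    using g unfolding homeomorphic_maps_def by (blast intro: continuous_map_into_fulltopology)
  then show ?thesis by (rule continuous_map_eq) (simp add: eq)
qed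

lemma riem_chart: "c \<in> atlas M \<Longrightarrow> riem_chart M c (cimg c)"
proof
  assume c: "c \<in> atlas M"
  show "open (cimg c)" by (rule open_cimg[OF c])
  show "smooth_on (cimg c) (metric M c)"
    using riem c unfolding riemannian_manifold_def by metis
  fix x assume x: "x \<in> cimg c"
  show "transpose (metric M c x) = metric M c x"
    using riem c x unfolding riemannian_manifold_def by metis
  fix v :: "real^'m" assume "v \<noteq> 0"
  then show "v \<bullet> (metric M c x *v v) > 0"
    using riem c x unfolding riemannian_manifold_def by metis
qed

end

section \<open>Transformation of metric, Christoffel symbols and Laplacian under a change of
  chart\<close>

locale chart_pair = riem_mfd M
  for M :: "('a, 'm::finite, 'z) riem_scheme" +
  fixes c d :: "('a, 'm) chart"
  assumes c: "c \<in> atlas M" and d: "d \<in> atlas M"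
begin

abbreviation "T \<equiv> transition c d"
abbreviation "V \<equiv> chart_map c ` (chart_dom c \<inter> chart_dom d)"
abbreviation "W \<equiv> chart_map d ` (chart_dom c \<inter> chart_dom d)"

lemma openin_overlap: "openin (mtop M) (chart_dom c \<inter> chart_dom d)"
  using openin_chart_dom c d by blast

lemma open_V: "open V" and open_W: "open W"
  using openin_overlap by (auto intro: open_chart_image c d)

lemma V_subset: "V \<subseteq> cimg c" and W_subset: "W \<subseteq> cimg d" by auto

lemma smooth_T: "smooth_on V T"
  using smooth_mfd c d unfolding smooth_manifold_def by blast

lemma T_chart: "p \<in> chart_dom c \<Longrightarrow> T (chart_map c p) = chart_map d p"
  using c by (simp add: transition_def)

lemma V_E: assumes "x \<in> V" obtains p where "p \<in> chart_dom c" "p \<in> chart_dom d" "x = chart_map c p"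
  using assms by blast

lemma T_in: "x \<in> V \<Longrightarrow> T x \<in> W"
  by (elim V_E) (simp add: T_chart)

lemma chart_inv_T: "x \<in> V \<Longrightarrow> chart_inv d (T x) = chart_inv c x"
  by (elim V_E) (simp add: T_chart c d)

lemma metric_T: "x \<in> V \<Longrightarrow> metric M c x $ i $ j = partial i T x \<bullet> (metric M d (T x) *v partial j T x)"
proof -
  assume x: "x \<in> V"
  have "\<forall>c\<in>atlas M. \<forall>d\<in>atlas M. \<forall>x\<in>chart_map c ` (chart_dom c \<inter> chart_dom d). \<forall>i j.
       metric M c x $ i $ j =
         partial i (transition c d) x \<bullet>
           (metric M d (transition c d x) *v partial j (transition c d) x)"
    using riem unfolding riemannian_manifold_def by (elim conjE)
  from this[rule_format, OF c d x] show ?thesis .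
qed

lemma inj_on_T: "inj_on T V"
proof (rule inj_on_inverseI)
  fix x assume "x \<in> V"
  then show "chart_map c (chart_inv d (T x)) = x"
    by (elim V_E) (simp add: T_chart c d)
qed

sublocale C: riem_chart M c "cimg c" by (rule riem_chart[OF c])
sublocale D: riem_chart M d "cimg d" by (rule riem_chart[OF d])

definition Jm :: "real^'m \<Rightarrow> real^'m^'m" where "Jm x = (\<chi> b k. partial k T x $ b)"

lemma matrix_metric_T:
  assumes "x \<in> V" shows "metric M c x = transpose (Jm x) ** (metric M d (T x) ** Jm x)"
proof -
  have "metric M c x $ i $ j = (transpose (Jm x) ** (metric M d (T x) ** Jm x)) $ i $ j" for i j
    unfolding metric_T[OF assms] inner_vec_def matrix_vector_mult_def matrix_matrix_mult_def
      transpose_def Jm_def by simp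
  then show ?thesis by (simp add: vec_eq_iff)
qed

text \<open>Inserting \<open>matrix_metric_T\<close> exhibits a left inverse of the square matrix
  \<open>Jm x\<close>, which is also a right inverse. So
  \<open>Jm x ** inv_metric M c x ** transpose (Jm x)\<close> inverts the metric of chart
  \<open>d\<close>; the inverse of the Jacobian itself is never written down.\<close>

lemma inv_metric_T:
  assumes x: "x \<in> V" shows "Jm x ** inv_metric M c x ** transpose (Jm x) = inv_metric M d (T x)"
proof -
  let ?A = "inv_metric M c x" and ?G = "metric M d (T x)" and ?J = "Jm x"
  have Tx: "T x \<in> cimg d" using T_in[OF x] W_subset by blast
  have "?A ** (transpose ?J ** (?G ** ?J)) = mat 1"
    using C.metric_inverse(1)[of x] x V_subset matrix_metric_T[OF x] by auto
  then have "(?A ** transpose ?J ** ?G) ** ?J = mat 1" by (simp add: matrix_mul_assoc)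
  then have "?J ** (?A ** transpose ?J ** ?G) = mat 1" by (simp add: matrix_left_right_inverse)
  then have "(?J ** ?A ** transpose ?J) ** (?G ** inv_metric M d (T x)) = inv_metric M d (T x)"
    by (metis matrix_mul_assoc matrix_mul_lid)
  then show ?thesis by (simp add: D.metric_inverse(2)[OF Tx])
qed

lemma inv_metric_T_nth:
  assumes x: "x \<in> V"
  shows "(\<Sum>i\<in>UNIV. \<Sum>j\<in>UNIV. inv_metric M c x $ i $ j * partial i T x $ p * partial j T x $ q)
    = inv_metric M d (T x) $ p $ q"
  unfolding inv_metric_T[OF x, symmetric] matrix_matrix_mult_def transpose_def Jm_def vec_lambda_beta
    sum_distrib_right
  by (subst sum.swap) (simp add: ac_simps)

lemma det_metric_T:
  assumes x: "x \<in> V"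
  shows "volume_density M c x = \<bar>det (Jm x)\<bar> * volume_density M d (T x)"
  unfolding volume_density_def matrix_metric_T[OF x]
  by (simp add: det_mul real_sqrt_mult det_transpose mult.left_commute)

text \<open>The Christoffel symbol of the first kind of chart \<open>d\<close> as a trilinear form.
  Arbitrary vectors replace the coordinate vectors so that it can be evaluated on columns of the
  Jacobian.\<close>

definition cf :: "real^'m \<Rightarrow> real^'m \<Rightarrow> real^'m \<Rightarrow> real^'m \<Rightarrow> real" where
  "cf x p q r = (q \<bullet> (dir_deriv p (metric M d) (T x) *v r) + p \<bullet> (dir_deriv q (metric M d) (T x) *v r)
     - p \<bullet> (dir_deriv r (metric M d) (T x) *v q)) / 2"

lemma diff_metric_d: "x \<in> V \<Longrightarrow> metric M d differentiable (at (T x))"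
  using smooth_on_differentiable[OF D.smooth_metric] T_in W_subset by blast

lemma cf_sum:
  assumes x: "x \<in> V"
  shows "cf x p q r = (\<Sum>i\<in>UNIV. \<Sum>j\<in>UNIV. \<Sum>k\<in>UNIV. p $ i * q $ j * r $ k * cf x (axis i 1) (axis j 1) (axis k 1))"
proof -
  have dm: "linear (\<lambda>v. dir_deriv v (metric M d) (T x))"
    using bounded_linear_dir_deriv[OF diff_metric_d[OF x]] by (rule bounded_linear.linear)
  note lin = linear_add[OF dm] linear_scale[OF dm]
    matrix_vector_right_distrib matrix_vector_mult_add_rdistrib
    matrix_vector_mult_scaleR scaleR_matrix_vector_assoc[symmetric] inner_add_left inner_add_right
  have l: "linear (\<lambda>p. cf x p q r)" "linear (\<lambda>q. cf x p q r)" "linear (\<lambda>r. cf x p q r)" for p q r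
    unfolding cf_def by (auto intro!: linearI simp: lin field_simps)
  have e: "(\<Sum>i\<in>UNIV. v $ i *\<^sub>R axis i 1) = v" for v :: "real^'m"
    by (simp add: vec_eq_iff axis_def if_distrib cong: if_cong)
  have "cf x p q r = cf x (\<Sum>i\<in>UNIV. p $ i *\<^sub>R axis i 1) (\<Sum>i\<in>UNIV. q $ i *\<^sub>R axis i 1) (\<Sum>i\<in>UNIV. r $ i *\<^sub>R axis i 1)"
    by (simp add: e)
  also have "\<dots> = (\<Sum>i\<in>UNIV. \<Sum>j\<in>UNIV. \<Sum>k\<in>UNIV. p $ i * q $ j * r $ k * cf x (axis i 1) (axis j 1) (axis k 1))"
    unfolding linear_sum[OF l(1)] linear_scale[OF l(1)]
    unfolding linear_sum[OF l(2)] linear_scale[OF l(2)]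
    unfolding linear_sum[OF l(3)] linear_scale[OF l(3)]
    by (simp add: sum_distrib_left ac_simps)
  finally show ?thesis .
qed

lemma partial_metric_nth:
  "y \<in> cimg d \<Longrightarrow> dir_deriv v (metric M d) y $ i $ j = dir_deriv v (\<lambda>y. metric M d y $ i $ j) y"
proof -
  assume y: "y \<in> cimg d"
  have 1: "metric M d differentiable (at y)" using D.smooth_metric y by (rule smooth_on_differentiable)
  then show ?thesis
    using dir_deriv_bounded_linear[OF bounded_linear_compose[OF bounded_linear_vec_nth bounded_linear_vec_nth] 1]
    by simp
qed

lemma christoffel_d:
  assumes x: "x \<in> V"
  shows "christoffel M d (T x) k i j
    = (\<Sum>l\<in>UNIV. inv_metric M d (T x) $ k $ l * cf x (axis i 1) (axis j 1) (axis l 1))"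
proof -
  have Tx: "T x \<in> cimg d" using T_in[OF x] W_subset by blast
  have *: "axis i 1 \<bullet> (dir_deriv v (metric M d) (T x) *v axis j 1) = dir_deriv v (\<lambda>y. metric M d y $ i $ j) (T x)" for i j v
    using partial_metric_nth[OF Tx]
    by (simp add: inner_axis_axis matrix_vector_mult_basis column_def inner_axis' )
  show ?thesis unfolding christoffel_def cf_def * by (simp add: sum_divide_distrib)
qed

text \<open>Each derivative of the transformed metric has two terms with second derivatives of
  \<open>T\<close> and one with a derivative of the metric of \<open>d\<close>. In the alternating
  sum four of the six second-derivative terms cancel, by symmetry of the metric and of second
  derivatives; the other two coincide and give the factor 2.\<close>

lemma first_christoffel_c:
  assumes x: "x \<in> V"
  shows "partial i (\<lambda>y. metric M c y $ j $ l) x + partial j (\<lambda>y. metric M c y $ i $ l) x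
      - partial l (\<lambda>y. metric M c y $ i $ j) x
    = 2 * (partial i (partial j T) x \<bullet> (metric M d (T x) *v partial l T x)
        + cf x (partial i T x) (partial j T x) (partial l T x))"
proof -
  have Tx: "T x \<in> cimg d" using T_in[OF x] W_subset by blast
  have dT: "T differentiable (at x)" "partial i T differentiable (at x)" for i
    by (rule smooth_on_differentiable[OF _ x], intro smooth_intros smooth_T)+
  have dG: "(\<lambda>y. metric M d (T y)) differentiable (at x)"
    using differentiable_chain_at[OF dT(1) diff_metric_d[OF x]] by (simp add: o_def)
  have dGT: "(\<lambda>y. metric M d (T y) *v partial j T y) differentiable (at x)" for j
    using bounded_bilinear.FDERIV[OF bounded_bilinear_matrix_vector_mult] dG dT(2)
    unfolding differentiable_def by blast
  have der: "partial l (\<lambda>y. metric M c y $ i $ j) x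
    = partial l (partial i T) x \<bullet> (metric M d (T x) *v partial j T x)
    + partial i T x \<bullet> (metric M d (T x) *v partial l (partial j T) x)
    + partial i T x \<bullet> (dir_deriv (partial l T x) (metric M d) (T x) *v partial j T x)" for i j l
  proof -
    have "partial l (\<lambda>y. metric M c y $ i $ j) x
      = partial l (\<lambda>y. partial i T y \<bullet> (metric M d (T y) *v partial j T y)) x"
      by (rule dir_deriv_cong_open[OF open_V x]) (rule metric_T)
    also have "\<dots> = partial i T x \<bullet> (metric M d (T x) *v partial l (partial j T) x
          + dir_deriv (partial l T x) (metric M d) (T x) *v partial j T x)
        + partial l (partial i T) x \<bullet> (metric M d (T x) *v partial j T x)"
      unfolding dir_deriv_inner[OF dT(2) dGT] dir_deriv_bilinear[OF bounded_bilinear_matrix_vector_mult dG dT(2)]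
        dir_deriv_compose[OF dT(1) diff_metric_d[OF x]] ..
    finally show ?thesis by (simp add: inner_add_right)
  qed
  have H: "partial i (partial j T) x = partial j (partial i T) x" for i j
    by (rule dir_deriv_commute[OF open_V smooth_T x])
  have G: "v \<bullet> (metric M d (T x) *v w) = w \<bullet> (metric M d (T x) *v v)" for v w
    using D.sym_metric[OF Tx] by (metis dot_lmul_matrix inner_commute transpose_matrix_vector)
  show ?thesis
    unfolding der cf_def
    by (simp add: H[of l] H[of j i] G[of "partial i T x" "partial j (partial l T) x"]
        G[of "partial j T x" "partial i (partial l T) x"])
qed

text \<open>The inhomogeneous transformation law. It is the first-kind identity with an index raised
  in chart \<open>c\<close> and pushed forward by the Jacobian, where
  \<open>inv_metric_T_nth\<close> replaces the inverse metric of \<open>c\<close> by that of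
  \<open>d\<close>.\<close>

lemma christoffel_T:
  assumes x: "x \<in> V"
  shows "(\<Sum>k\<in>UNIV. christoffel M c x k i j * partial k T x $ e)
    = partial i (partial j T) x $ e
    + (\<Sum>p\<in>UNIV. \<Sum>q\<in>UNIV. partial i T x $ p * partial j T x $ q * christoffel M d (T x) e p q)"
proof -
  have Tx: "T x \<in> cimg d" using T_in[OF x] W_subset by blast
  let ?A = "inv_metric M c x" and ?B = "inv_metric M d (T x)" and ?J = "\<lambda>k. partial k T x"
  let ?cf = "\<lambda>r. cf x (?J i) (?J j) r"
  \<comment> \<open>The covector whose pairing with the column \<open>?J l\<close> is the first-kind
    symbol of chart \<open>c\<close> with indices \<open>i\<close>, \<open>j\<close>,
    \<open>l\<close>.\<close>
  define z where "z = metric M d (T x) *v partial i (partial j T) x + (\<chi> b. ?cf (axis b 1))"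
  have cfz: "?cf r = (\<chi> b. ?cf (axis b 1)) \<bullet> r" for r
  proof -
    have "?cf r = (\<Sum>i'\<in>UNIV. \<Sum>j'\<in>UNIV. \<Sum>k\<in>UNIV. r $ k * (?J i $ i' * ?J j $ j' * cf x (axis i' 1) (axis j' 1) (axis k 1)))"
      by (subst cf_sum[OF x]) (simp add: ac_simps)
    also have "\<dots> = (\<Sum>i'\<in>UNIV. \<Sum>k\<in>UNIV. \<Sum>j'\<in>UNIV. r $ k * (?J i $ i' * ?J j $ j' * cf x (axis i' 1) (axis j' 1) (axis k 1)))"
      by (rule sum.cong[OF refl]) (rule sum.swap)
    also have "\<dots> = (\<Sum>k\<in>UNIV. \<Sum>i'\<in>UNIV. \<Sum>j'\<in>UNIV. r $ k * (?J i $ i' * ?J j $ j' * cf x (axis i' 1) (axis j' 1) (axis k 1)))"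
      by (rule sum.swap)
    also have "\<dots> = (\<Sum>k\<in>UNIV. r $ k * ?cf (axis k 1))"
      by (subst (2) cf_sum[OF x])
        (simp add: sum_distrib_left axis_def if_distrib[of "\<lambda>z. _ * z"] if_distrib[of "\<lambda>z. z * _"] cong: if_cong)
    finally show ?thesis by (simp add: inner_vec_def mult.commute)
  qed
  have G: "partial i (partial j T) x \<bullet> (metric M d (T x) *v r) = (metric M d (T x) *v partial i (partial j T) x) \<bullet> r" for r
    using D.sym_metric[OF Tx] by (metis dot_lmul_matrix inner_commute transpose_matrix_vector)
  have "christoffel M c x k i j = (\<Sum>l\<in>UNIV. ?A $ k $ l * (z \<bullet> ?J l))" for k
    unfolding christoffel_def first_christoffel_c[OF x] z_def inner_add_left cfz[symmetric] G
    by (simp add: sum_divide_distrib algebra_simps add_divide_distrib)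
  then have "(\<Sum>k\<in>UNIV. christoffel M c x k i j * ?J k $ e)
    = (\<Sum>k\<in>UNIV. \<Sum>l\<in>UNIV. \<Sum>b\<in>UNIV. ?A $ k $ l * ?J k $ e * ?J l $ b * z $ b)"
    by (simp add: inner_vec_def sum_distrib_left sum_distrib_right ac_simps)
  also have "\<dots> = (\<Sum>k\<in>UNIV. \<Sum>b\<in>UNIV. \<Sum>l\<in>UNIV. ?A $ k $ l * ?J k $ e * ?J l $ b * z $ b)"
    by (rule sum.cong[OF refl]) (rule sum.swap)
  also have "\<dots> = (\<Sum>b\<in>UNIV. \<Sum>k\<in>UNIV. \<Sum>l\<in>UNIV. ?A $ k $ l * ?J k $ e * ?J l $ b * z $ b)"
    by (rule sum.swap)
  also have "\<dots> = (\<Sum>b\<in>UNIV. ?B $ e $ b * z $ b)"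
    by (simp add: inv_metric_T_nth[OF x, symmetric] sum_distrib_right)
  also have "\<dots> = (?B *v z) $ e" by (simp add: matrix_vector_mult_def)
  also have "?B *v z = partial i (partial j T) x + ?B *v (\<chi> b. ?cf (axis b 1))"
    by (simp add: z_def matrix_vector_right_distrib matrix_vector_mul_assoc D.metric_inverse(1)[OF Tx])
  also have "(\<dots>) $ e = partial i (partial j T) x $ e + (\<Sum>b\<in>UNIV. ?B $ e $ b * ?cf (axis b 1))"
    by (simp add: matrix_vector_mult_def)
  also have "(\<Sum>b\<in>UNIV. ?B $ e $ b * ?cf (axis b 1))
     = (\<Sum>b\<in>UNIV. \<Sum>p\<in>UNIV. \<Sum>q\<in>UNIV. ?J i $ p * ?J j $ q * (?B $ e $ b * cf x (axis p 1) (axis q 1) (axis b 1)))"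
    by (subst cf_sum[OF x])
      (simp add: sum_distrib_left axis_def if_distrib[of "\<lambda>z. _ * z"] if_distrib[of "\<lambda>z. z * _"] ac_simps cong: if_cong)
  also have "\<dots> = (\<Sum>p\<in>UNIV. \<Sum>b\<in>UNIV. \<Sum>q\<in>UNIV. ?J i $ p * ?J j $ q * (?B $ e $ b * cf x (axis p 1) (axis q 1) (axis b 1)))"
    by (rule sum.swap)
  also have "\<dots> = (\<Sum>p\<in>UNIV. \<Sum>q\<in>UNIV. \<Sum>b\<in>UNIV. ?J i $ p * ?J j $ q * (?B $ e $ b * cf x (axis p 1) (axis q 1) (axis b 1)))"
    by (rule sum.cong[OF refl]) (rule sum.swap)
  also have "\<dots> = (\<Sum>p\<in>UNIV. \<Sum>q\<in>UNIV. ?J i $ p * ?J j $ q * christoffel M d (T x) e p q)"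
    by (simp add: christoffel_d[OF x] sum_distrib_left)
  finally show ?thesis .
qed

lemma partial_comp_T:
  assumes x: "x \<in> V" and u: "smooth_on W u"
  shows "partial i (\<lambda>y. u (T y)) x = (\<Sum>b\<in>UNIV. partial i T x $ b *\<^sub>R partial b u (T x))"
proof -
  have "u differentiable (at (T x))" "T differentiable (at x)"
    using u smooth_T x T_in by (auto intro: smooth_on_differentiable)
  then show ?thesis by (simp add: dir_deriv_compose dir_deriv_vec[symmetric])
qed

lemma smooth_comp_T: "smooth_on W u \<Longrightarrow> smooth_on V (\<lambda>y. u (T y))"
  using T_in by (intro smooth_on_compose[OF open_V smooth_T]) auto

lemma grad_inner_T:
  fixes u v :: "real^'m \<Rightarrow> 'w::real_inner"
  assumes x: "x \<in> V" and u: "smooth_on W u" and v: "smooth_on W v"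
  shows "grad_inner M c (\<lambda>y. u (T y)) (\<lambda>y. v (T y)) x = grad_inner M d u v (T x)"
proof -
  let ?A = "inv_metric M c x" and ?J = "\<lambda>k. partial k T x"
  let ?u = "\<lambda>p. partial p u (T x)" and ?v = "\<lambda>p. partial p v (T x)"
  have "grad_inner M c (\<lambda>y. u (T y)) (\<lambda>y. v (T y)) x
    = (\<Sum>i\<in>UNIV. \<Sum>j\<in>UNIV. \<Sum>p\<in>UNIV. \<Sum>q\<in>UNIV. ?A $ i $ j * ?J i $ p * ?J j $ q * (?u p \<bullet> ?v q))"
    unfolding grad_inner_def metric_trace_def partial_comp_T[OF x u] partial_comp_T[OF x v] inner_sum_left
    unfolding inner_sum_right by (simp add: sum_distrib_left ac_simps)
  also have "\<dots> = (\<Sum>p\<in>UNIV. \<Sum>q\<in>UNIV. \<Sum>i\<in>UNIV. \<Sum>j\<in>UNIV. ?A $ i $ j * ?J i $ p * ?J j $ q * (?u p \<bullet> ?v q))"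
    by (rule sum_swap4)
  also have "\<dots> = grad_inner M d u v (T x)"
    by (simp add: grad_inner_def metric_trace_def inv_metric_T_nth[OF x, symmetric] sum_distrib_right)
  finally show ?thesis .
qed

text \<open>The second derivatives of \<open>T\<close> produced by the chain rule are the
  inhomogeneous term of \<open>christoffel_T\<close>. Their cancellation leaves the covariant
  Hessian transforming as a tensor, and the trace then transforms by
  \<open>inv_metric_T_nth\<close>.\<close>

lemma lap_T_real:
  fixes u :: "real^'m \<Rightarrow> real"
  assumes x: "x \<in> V" and u: "smooth_on W u"
  shows "lap M c (\<lambda>y. u (T y)) x = lap M d u (T x)"
proof -
  let ?A = "inv_metric M c x" and ?J = "\<lambda>k. partial k T x"
  let ?u = "\<lambda>p. partial p u (T x)" and ?uu = "\<lambda>p q. partial p (partial q u) (T x)"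
  let ?h = "\<lambda>p q. ?uu p q - (\<Sum>e\<in>UNIV. christoffel M d (T x) e p q * ?u e)"
  have 1: "partial i (partial j (\<lambda>y. u (T y))) x
    = (\<Sum>b\<in>UNIV. partial i (partial j T) x $ b * ?u b) + (\<Sum>p\<in>UNIV. \<Sum>q\<in>UNIV. ?J i $ p * ?J j $ q * ?uu p q)" for i j
  proof -
    have d: "partial j T differentiable (at x)" "(\<lambda>y. partial j T y $ b) differentiable (at x)" "(\<lambda>y. partial b u (T y)) differentiable (at x)" for b
      by (rule smooth_on_differentiable[OF _ x], intro smooth_intros smooth_T smooth_comp_T u open_V)+
    have "partial i (partial j (\<lambda>y. u (T y))) x = partial i (\<lambda>y. \<Sum>b\<in>UNIV. partial j T y $ b * partial b u (T y)) x"
      using partial_comp_T[OF _ u] by (intro dir_deriv_cong_open[OF open_V x]) simp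
    also have "\<dots> = (\<Sum>b\<in>UNIV. partial i (partial j T) x $ b * ?u b + ?J j $ b * (\<Sum>p\<in>UNIV. ?J i $ p * ?uu p b))"
      using d partial_comp_T[OF x smooth_on_dir_deriv[OF u]]
      by (simp add: dir_deriv_sum dir_deriv_mult dir_deriv_bounded_linear[OF bounded_linear_vec_nth] add.commute)
    also have "\<dots> = (\<Sum>b\<in>UNIV. partial i (partial j T) x $ b * ?u b) + (\<Sum>b\<in>UNIV. \<Sum>p\<in>UNIV. ?J i $ p * ?J j $ b * ?uu p b)"
      by (simp add: sum.distrib sum_distrib_left ac_simps)
    also have "(\<Sum>b\<in>UNIV. \<Sum>p\<in>UNIV. ?J i $ p * ?J j $ b * ?uu p b) = (\<Sum>p\<in>UNIV. \<Sum>q\<in>UNIV. ?J i $ p * ?J j $ q * ?uu p q)"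
      by (rule sum.swap)
    finally show ?thesis .
  qed
  have 2: "(\<Sum>k\<in>UNIV. christoffel M c x k i j * partial k (\<lambda>y. u (T y)) x)
    = (\<Sum>b\<in>UNIV. partial i (partial j T) x $ b * ?u b)
      + (\<Sum>p\<in>UNIV. \<Sum>q\<in>UNIV. ?J i $ p * ?J j $ q * (\<Sum>e\<in>UNIV. christoffel M d (T x) e p q * ?u e))" for i j
  proof -
    have "(\<Sum>k\<in>UNIV. christoffel M c x k i j * partial k (\<lambda>y. u (T y)) x)
      = (\<Sum>k\<in>UNIV. \<Sum>b\<in>UNIV. christoffel M c x k i j * ?J k $ b * ?u b)"
      by (simp add: partial_comp_T[OF x u] sum_distrib_left ac_simps)
    also have "\<dots> = (\<Sum>b\<in>UNIV. (\<Sum>k\<in>UNIV. christoffel M c x k i j * ?J k $ b) * ?u b)"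
      by (subst sum.swap) (simp add: sum_distrib_right)
    also have "\<dots> = (\<Sum>b\<in>UNIV. partial i (partial j T) x $ b * ?u b)
      + (\<Sum>e\<in>UNIV. \<Sum>p\<in>UNIV. \<Sum>q\<in>UNIV. ?J i $ p * ?J j $ q * (christoffel M d (T x) e p q * ?u e))"
      unfolding christoffel_T[OF x] distrib_right sum.distrib sum_distrib_right by (simp add: mult.assoc)
    also have "(\<Sum>e\<in>UNIV. \<Sum>p\<in>UNIV. \<Sum>q\<in>UNIV. ?J i $ p * ?J j $ q * (christoffel M d (T x) e p q * ?u e))
      = (\<Sum>p\<in>UNIV. \<Sum>q\<in>UNIV. \<Sum>e\<in>UNIV. ?J i $ p * ?J j $ q * (christoffel M d (T x) e p q * ?u e))"
      by (rule sum_rotate3)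
    finally show ?thesis by (simp add: sum_distrib_left)
  qed
  have "lap M c (\<lambda>y. u (T y)) x
    = (\<Sum>i\<in>UNIV. \<Sum>j\<in>UNIV. ?A $ i $ j * (\<Sum>p\<in>UNIV. \<Sum>q\<in>UNIV. ?J i $ p * ?J j $ q * ?h p q))"
    by (simp add: lap_def metric_trace_def 1 2 sum_subtractf right_diff_distrib)
  also have "\<dots> = (\<Sum>i\<in>UNIV. \<Sum>j\<in>UNIV. \<Sum>p\<in>UNIV. \<Sum>q\<in>UNIV. ?A $ i $ j * ?J i $ p * ?J j $ q * ?h p q)"
    by (simp add: sum_distrib_left mult.assoc)
  also have "\<dots> = (\<Sum>p\<in>UNIV. \<Sum>q\<in>UNIV. \<Sum>i\<in>UNIV. \<Sum>j\<in>UNIV. ?A $ i $ j * ?J i $ p * ?J j $ q * ?h p q)"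
    by (rule sum_swap4)
  also have "\<dots> = lap M d u (T x)"
    by (simp add: lap_def metric_trace_def inv_metric_T_nth[OF x, symmetric] sum_distrib_right)
  finally show ?thesis .
qed

lemma lap_T:
  fixes u :: "real^'m \<Rightarrow> 'w::real_inner"
  assumes x: "x \<in> V" and u: "smooth_on W u"
  shows "lap M c (\<lambda>y. u (T y)) x = lap M d u (T x)"
proof -
  \<comment> \<open>The chart results are needed again on the overlap alone, because
    \<open>u\<close> is assumed smooth only there and not on the whole image of the chart.\<close>
  interpret C': riem_chart M c V
    using C.smooth_metric C.sym_metric C.pos_metric open_V V_subset
    by unfold_locales (auto intro: smooth_on_subset)
  interpret D': riem_chart M d W
    using D.smooth_metric D.sym_metric D.pos_metric open_W W_subset
    by unfold_locales (auto intro: smooth_on_subset)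
  have "lap M c (\<lambda>y. u (T y)) x \<bullet> b = lap M d u (T x) \<bullet> b" for b
  proof -
    have "smooth_on W (\<lambda>y. u y \<bullet> b)" using u by (intro smooth_intros open_W)
    from lap_T_real[OF x this] show ?thesis
      using C'.lap_bounded_linear[OF bounded_linear_inner_left x smooth_comp_T[OF u], of b]
        D'.lap_bounded_linear[OF bounded_linear_inner_left T_in[OF x] u, of b] by simp
  qed
  then show ?thesis by (metis vector_eq_rdot)
qed

end

section \<open>Independence of the chosen chart\<close>

context riem_mfd begin

definition smooth_fun :: "('a \<Rightarrow> 'w::real_normed_vector) \<Rightarrow> bool" where
  "smooth_fun f \<longleftrightarrow> (\<forall>c\<in>atlas M. smooth_on (cimg c) (f \<circ> chart_inv c))"

lemma chart_pair: "c \<in> atlas M \<Longrightarrow> d \<in> atlas M \<Longrightarrow> chart_pair M c d"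
  using riem by unfold_locales auto

lemma lap_chart_independent:
  fixes f :: "'a \<Rightarrow> 'w::real_inner"
  assumes "c \<in> atlas M" "d \<in> atlas M" "p \<in> chart_dom c" "p \<in> chart_dom d"
    and f: "smooth_on (cimg d) (f \<circ> chart_inv d)"
  shows "lap M c (f \<circ> chart_inv c) (chart_map c p) = lap M d (f \<circ> chart_inv d) (chart_map d p)"
proof -
  interpret chart_pair M c d using assms by (intro chart_pair)
  have x: "chart_map c p \<in> V" using assms by auto
  have "lap M c (f \<circ> chart_inv c) (chart_map c p) = lap M c (\<lambda>y. (f \<circ> chart_inv d) (T y)) (chart_map c p)"
    by (rule lap_cong_open[OF open_V x]) (simp only: o_apply chart_inv_T)
  also have "\<dots> = lap M d (f \<circ> chart_inv d) (T (chart_map c p))"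
    using smooth_on_subset[OF f W_subset] by (rule lap_T[OF x])
  finally show ?thesis using T_chart assms by simp
qed

lemma grad_inner_chart_independent:
  fixes f h :: "'a \<Rightarrow> 'w::real_inner"
  assumes "c \<in> atlas M" "d \<in> atlas M" "p \<in> chart_dom c" "p \<in> chart_dom d"
    and f: "smooth_on (cimg d) (f \<circ> chart_inv d)" and h: "smooth_on (cimg d) (h \<circ> chart_inv d)"
  shows "grad_inner M c (f \<circ> chart_inv c) (h \<circ> chart_inv c) (chart_map c p)
    = grad_inner M d (f \<circ> chart_inv d) (h \<circ> chart_inv d) (chart_map d p)"
proof -
  interpret chart_pair M c d using assms by (intro chart_pair)
  have x: "chart_map c p \<in> V" using assms by auto
  have "grad_inner M c (f \<circ> chart_inv c) (h \<circ> chart_inv c) (chart_map c p)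
    = grad_inner M c (\<lambda>y. (f \<circ> chart_inv d) (T y)) (\<lambda>y. (h \<circ> chart_inv d) (T y)) (chart_map c p)"
    by (rule grad_inner_cong_open[OF open_V x]) (simp_all only: o_apply chart_inv_T)
  also have "\<dots> = grad_inner M d (f \<circ> chart_inv d) (h \<circ> chart_inv d) (T (chart_map c p))"
    using smooth_on_subset[OF f W_subset] smooth_on_subset[OF h W_subset] by (rule grad_inner_T[OF x])
  finally show ?thesis using T_chart assms by simp
qed

text \<open>In the chart picked by \<open>chart_at\<close> the divergence form of each component
  equals its Hessian form; chart independence then carries the result to \<open>c\<close>. All later
  computations are free to choose their chart.\<close>

lemma vec_laplacian_chart:
  fixes f :: "'a \<Rightarrow> 'w::euclidean_space"
  assumes f: "smooth_fun f" and c: "c \<in> atlas M" "p \<in> chart_dom c"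
  shows "vec_laplacian M f p = lap M c (f \<circ> chart_inv c) (chart_map c p)"
proof -
  let ?e = "chart_at M p"
  have p: "p \<in> topspace (mtop M)" using c chart_dom_subset by blast
  then have e: "?e \<in> atlas M" "p \<in> chart_dom ?e" using chart_at by auto
  interpret E: riem_chart M ?e "cimg ?e" by (rule riem_chart[OF e(1)])
  have fe: "smooth_on (cimg ?e) (f \<circ> chart_inv ?e)" using f e by (simp add: smooth_fun_def)
  have "laplacian M (\<lambda>q. f q \<bullet> b) p = lap M ?e (f \<circ> chart_inv ?e) (chart_map ?e p) \<bullet> b" for b
  proof -
    have "smooth_on (cimg ?e) ((\<lambda>q. f q \<bullet> b) \<circ> chart_inv ?e)"
      using fe E.open_V by (simp add: o_def smooth_intros)
    then have "laplacian M (\<lambda>q. f q \<bullet> b) p = lap M ?e ((\<lambda>q. f q \<bullet> b) \<circ> chart_inv ?e) (chart_map ?e p)"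
      unfolding laplacian_def Let_def using e by (intro E.divergence_gradient) auto
    then show ?thesis
      using E.lap_bounded_linear[OF bounded_linear_inner_left _ fe, of "chart_map ?e p" b] e
      by (simp add: o_def)
  qed
  then have "vec_laplacian M f p = lap M ?e (f \<circ> chart_inv ?e) (chart_map ?e p)"
    by (simp add: vec_laplacian_def euclidean_representation)
  also have "\<dots> = lap M c (f \<circ> chart_inv c) (chart_map c p)"
    using e c f by (intro lap_chart_independent) (auto simp: smooth_fun_def)
  finally show ?thesis .
qed

lemma smooth_fun_vec_laplacian:
  fixes f :: "'a \<Rightarrow> 'w::euclidean_space"
  assumes f: "smooth_fun f"
  shows "smooth_fun (vec_laplacian M f)"
  unfolding smooth_fun_def
proof
  fix c assume c: "c \<in> atlas M"
  interpret C: riem_chart M c "cimg c" by (rule riem_chart[OF c])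
  show "smooth_on (cimg c) (vec_laplacian M f \<circ> chart_inv c)"
  proof (rule smooth_on_cong[OF C.open_V _ C.smooth_lap])
    show "smooth_on (cimg c) (f \<circ> chart_inv c)" using f c by (simp add: smooth_fun_def)
    show "lap M c (f \<circ> chart_inv c) x = (vec_laplacian M f \<circ> chart_inv c) x" if "x \<in> cimg c" for x
      using vec_laplacian_chart[OF f c chart_inv_in[OF that]] chart_inv_right[OF that] by simp
  qed
qed

lemma lap_vec_laplacian:
  fixes f :: "'a \<Rightarrow> 'w::euclidean_space"
  assumes f: "smooth_fun f" and c: "c \<in> atlas M" and x: "x \<in> cimg c"
  shows "vec_laplacian M (vec_laplacian M f) (chart_inv c x) = lap M c (lap M c (f \<circ> chart_inv c)) x"
proof -
  have "vec_laplacian M (vec_laplacian M f) (chart_inv c x) = lap M c (vec_laplacian M f \<circ> chart_inv c) x"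
    using vec_laplacian_chart[OF smooth_fun_vec_laplacian[OF f] c chart_inv_in[OF x]] chart_inv_right[OF x] by simp
  also have "\<dots> = lap M c (lap M c (f \<circ> chart_inv c)) x"
    by (rule lap_cong_open[OF open_cimg[OF c] x])
      (simp add: vec_laplacian_chart[OF f c chart_inv_in] chart_inv_right)
  finally show ?thesis .
qed

end

section \<open>Stereographic charts of the sphere\<close>

text \<open>The conformal factor of stereographic coordinates: the round metric is its square times
  the Euclidean metric.\<close>

definition conf :: "real^'n::finite \<Rightarrow> real" where
  "conf y = 2 / (1 + y \<bullet> y)"

text \<open>The sign \<open>e\<close> names the pole \<open>(0, e)\<close> that is left out. With
  \<open>e * e = 1\<close> as the only assumption on it, both charts of the sphere are handled by
  one computation.\<close>

definition stereo_inv :: "real \<Rightarrow> real^'n::finite \<Rightarrow> (real^'n) \<times> real" where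
  "stereo_inv e y = (conf y *\<^sub>R y, e * (1 - conf y))"

definition stereo_chart :: "real \<Rightarrow> ((real^'n::finite) \<times> real, 'n) chart" where
  "stereo_chart e = (sphere 0 1 - {(0, e)}, \<lambda>(x, s). x /\<^sub>R (1 - e * s))"

lemma north_chart_stereo: "north_chart = stereo_chart 1"
  and south_chart_stereo: "south_chart = stereo_chart (-1)"
  by (simp_all add: north_chart_def south_chart_def stereo_chart_def)

lemma atlas_sphere: "d \<in> atlas round_sphere \<longleftrightarrow> d = stereo_chart 1 \<or> d = stereo_chart (-1)"
  by (simp add: round_sphere_def north_chart_stereo south_chart_stereo)

lemma sphere_inner: "z \<in> sphere 0 1 \<longleftrightarrow> z \<bullet> z = (1::real)"
  by (simp add: norm_eq_1)

lemma one_plus_inner_pos: "1 + y \<bullet> y > 0" for y :: "'a::real_inner"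
  by (simp add: add_pos_nonneg)

lemma conf_pos: "conf y > 0"
  by (simp add: conf_def one_plus_inner_pos)

lemma conf_eq: "conf y * (y \<bullet> y) = 2 - conf y"
  using one_plus_inner_pos[of y] by (simp add: conf_def field_simps)

lemma sign_cases: "e * e = (1::real) \<Longrightarrow> e = 1 \<or> e = -1"
  by (metis mult_cancel_right1 square_eq_1_iff power2_eq_square)

lemma stereo_inv_sphere:
  assumes "e * e = 1" shows "stereo_inv e y \<in> sphere 0 1"
proof -
  have "stereo_inv e y \<bullet> stereo_inv e y = conf y * (conf y * (y \<bullet> y)) + (e * e) * (1 - conf y) * (1 - conf y)"
    by (simp add: stereo_inv_def algebra_simps)
  also have "\<dots> = 1" unfolding conf_eq assms by (simp add: algebra_simps)
  finally show ?thesis by (simp only: sphere_inner)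
qed

lemma stereo_inv_ne_pole:
  assumes "e * e = 1" shows "stereo_inv e y \<noteq> (0, e)"
  using conf_pos[of y] sign_cases[OF assms] by (auto simp: stereo_inv_def)

lemma stereo_inv_dom: "e * e = 1 \<Longrightarrow> stereo_inv e y \<in> chart_dom (stereo_chart e)"
  using stereo_inv_sphere[of e y] stereo_inv_ne_pole[of e y] by (simp add: stereo_chart_def)

lemma stereo_chart_inv: "e * e = 1 \<Longrightarrow> chart_map (stereo_chart e) (stereo_inv e y) = y"
proof -
  assume e: "e * e = 1"
  have "1 - e * (e * (1 - conf y)) = conf y" using e by (simp add: algebra_simps)
  then show ?thesis using conf_pos[of y] by (simp add: stereo_chart_def stereo_inv_def)
qed

lemma pole_denominator:
  assumes e: "e * e = 1" and z: "z \<in> chart_dom (stereo_chart e)"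
  shows "1 - e * snd z \<noteq> 0"
proof
  obtain x s where xs: "z = (x, s)" by fastforce
  assume "1 - e * snd z = 0"
  then have "e * s = 1" by (simp add: xs)
  then have s: "s = e" using sign_cases[OF e] by auto
  moreover have "x \<bullet> x + s * s = 1" using z sphere_inner[of z] by (simp add: stereo_chart_def xs)
  ultimately have "x = 0" using e by simp
  with s z show False by (simp add: stereo_chart_def xs)
qed

lemma stereo_inv_chart:
  assumes e: "e * e = 1" and z: "z \<in> chart_dom (stereo_chart e)"
  shows "stereo_inv e (chart_map (stereo_chart e) z) = z"
proof -
  obtain x s where xs: "z = (x, s)" by fastforce
  define y where "y = x /\<^sub>R (1 - e * s)"
  have ne: "1 - e * s \<noteq> 0" using pole_denominator[OF e z] by (simp add: xs)
  have "z \<bullet> z = 1" using z sphere_inner[of z] by (simp add: stereo_chart_def)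
  then have "x \<bullet> x = 1 - s * s" by (simp add: xs)
  also have "s * s = (e * e) * (s * s)" by (simp add: e)
  finally have 1: "x \<bullet> x = 1 - (e * s) * (e * s)" by (simp add: ac_simps)
  have "y \<bullet> y = (x \<bullet> x) / ((1 - e * s) * (1 - e * s))" by (simp add: y_def divide_inverse)
  also have "\<dots> = (1 + e * s) / (1 - e * s)"
    unfolding 1 using ne by (simp add: frac_eq_eq) (simp add: algebra_simps)
  finally have "1 + y \<bullet> y = 2 / (1 - e * s)" using ne by (simp add: field_simps)
  then have l: "conf y = 1 - e * s" by (simp add: conf_def)
  have "conf y *\<^sub>R y = x" unfolding l using ne by (simp add: y_def)
  moreover have "e * (1 - conf y) = s" unfolding l using e by (simp add: algebra_simps)
  ultimately show ?thesis by (simp add: stereo_inv_def xs stereo_chart_def y_def)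
qed

lemma chart_inv_stereo:
  assumes e: "e * e = 1"
  shows "chart_inv (stereo_chart e) = stereo_inv e"
proof
  fix y
  have "inj_on (chart_map (stereo_chart e)) (chart_dom (stereo_chart e))"
    using stereo_inv_chart[OF e] by (rule inj_on_inverseI)
  then show "chart_inv (stereo_chart e) y = stereo_inv e y"
    unfolding chart_inv_def using stereo_inv_dom[OF e, of y] stereo_chart_inv[OF e, of y]
    by (metis inv_into_f_f)
qed

lemma smooth_conf: "open U \<Longrightarrow> smooth_on U conf"
  unfolding conf_def[abs_def] using one_plus_inner_pos by (intro smooth_intros) (auto simp: less_le)

lemma smooth_stereo_inv: "open U \<Longrightarrow> smooth_on U (stereo_inv e)"
  unfolding stereo_inv_def[abs_def] by (intro smooth_intros smooth_conf)

lemma dir_deriv_conf: "dir_deriv v conf y = - (conf y * conf y * (y \<bullet> v))"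
proof (rule dir_deriv_eq)
  have "1 + y \<bullet> y \<noteq> 0" using one_plus_inner_pos[of y] by simp
  then show "(conf has_derivative (\<lambda>v. - (conf y * conf y * (y \<bullet> v)))) (at y)"
    unfolding conf_def[abs_def]
    by (auto intro!: derivative_eq_intros simp: inner_commute power2_eq_square field_simps)
qed

lemma dir_deriv_stereo_inv:
  "dir_deriv v (stereo_inv e) y
    = (- (conf y * conf y * (y \<bullet> v)) *\<^sub>R y + conf y *\<^sub>R v, e * (conf y * conf y * (y \<bullet> v)))"
proof (rule dir_deriv_eq)
  have "conf differentiable (at y)" using smooth_conf[of UNIV] by (auto intro: smooth_on_differentiable)
  note this[THEN dir_deriv_works, unfolded dir_deriv_conf, derivative_intros]
  show "(stereo_inv e has_derivative (\<lambda>v. (- (conf y * conf y * (y \<bullet> v)) *\<^sub>R y + conf y *\<^sub>R v,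
       e * (conf y * conf y * (y \<bullet> v))))) (at y)"
    unfolding stereo_inv_def[abs_def] by (auto intro!: derivative_eq_intros simp: algebra_simps)
qed

lemma inner_dir_deriv_stereo_inv:
  assumes "e * e = 1"
  shows "dir_deriv v (stereo_inv e) y \<bullet> dir_deriv w (stereo_inv e) y = conf y * conf y * (v \<bullet> w)"
proof -
  let ?l = "conf y" and ?p = "y \<bullet> v" and ?q = "y \<bullet> w"
  have "dir_deriv v (stereo_inv e) y \<bullet> dir_deriv w (stereo_inv e) y
    = ?l * ?l * ?l * ?p * ?q * (?l * (y \<bullet> y)) - 2 * (?l * ?l * ?l * ?p * ?q) + ?l * ?l * (v \<bullet> w)
      + (e * e) * (?l * ?l * ?p * (?l * ?l * ?q))"
    unfolding dir_deriv_stereo_inv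
    by (simp add: inner_add_left inner_add_right inner_commute[of v y] algebra_simps)
  then show ?thesis unfolding conf_eq assms by (simp add: algebra_simps)
qed

lemma second_dir_deriv_stereo_inv:
  "dir_deriv w (dir_deriv v (stereo_inv e)) y
    = ((2 * conf y * conf y * conf y * (y \<bullet> w) * (y \<bullet> v) - conf y * conf y * (w \<bullet> v)) *\<^sub>R y
        - (conf y * conf y * (y \<bullet> v)) *\<^sub>R w - (conf y * conf y * (y \<bullet> w)) *\<^sub>R v,
       e * (conf y * conf y * (w \<bullet> v) - 2 * conf y * conf y * conf y * (y \<bullet> w) * (y \<bullet> v)))"
proof -
  have "conf differentiable (at y)" using smooth_conf[of UNIV] by (auto intro: smooth_on_differentiable)
  note this[THEN dir_deriv_works, unfolded dir_deriv_conf, derivative_intros]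
  have "((\<lambda>y. (- (conf y * conf y * (y \<bullet> v)) *\<^sub>R y + conf y *\<^sub>R v, e * (conf y * conf y * (y \<bullet> v)))) has_derivative
     (\<lambda>w. ((2 * conf y * conf y * conf y * (y \<bullet> w) * (y \<bullet> v) - conf y * conf y * (w \<bullet> v)) *\<^sub>R y
        - (conf y * conf y * (y \<bullet> v)) *\<^sub>R w - (conf y * conf y * (y \<bullet> w)) *\<^sub>R v,
       e * (conf y * conf y * (w \<bullet> v) - 2 * conf y * conf y * conf y * (y \<bullet> w) * (y \<bullet> v))))) (at y)"
    by (auto intro!: derivative_eq_intros simp: vec_eq_iff algebra_simps)
  moreover have "dir_deriv v (stereo_inv e)
     = (\<lambda>y. (- (conf y * conf y * (y \<bullet> v)) *\<^sub>R y + conf y *\<^sub>R v, e * (conf y * conf y * (y \<bullet> v))))"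
    by (simp add: dir_deriv_stereo_inv fun_eq_iff)
  ultimately show ?thesis by (simp only: dir_deriv_eq)
qed

lemma metric_stereo:
  assumes e: "e * e = 1"
  shows "metric round_sphere (stereo_chart e) y $ i $ j = (if i = j then conf y * conf y else 0)"
  by (simp add: round_sphere_def chart_inv_stereo[OF e] inner_dir_deriv_stereo_inv[OF e] inner_axis_axis)

lemma matrix_inv_unique:
  fixes A :: "'a::semiring_1^'n::finite^'n"
  assumes "A ** B = mat 1" "B ** A = mat 1"
  shows "matrix_inv A = B"
proof -
  have "invertible A" using assms by (auto simp: invertible_def)
  then have "matrix_inv A = matrix_inv A ** (A ** B)" by (simp add: assms)
  also have "\<dots> = B" using \<open>invertible A\<close> by (simp add: matrix_mul_assoc matrix_inv_left)
  finally show ?thesis .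
qed

lemma inv_metric_stereo:
  assumes e: "e * e = 1"
  shows "inv_metric round_sphere (stereo_chart e) y $ i $ j = (if i = j then inverse (conf y * conf y) else 0)"
proof -
  have "matrix_inv (metric round_sphere (stereo_chart e) y)
      = (\<chi> i j. if i = j then inverse (conf y * conf y) else 0)"
    using conf_pos[of y] by (intro matrix_inv_unique)
      (simp_all add: vec_eq_iff matrix_matrix_mult_def metric_stereo[OF e] mat_def
        if_distrib[of "\<lambda>z. z * _"] if_distrib[of "\<lambda>z. _ * z"] field_simps cong: if_cong)
  then show ?thesis by (simp add: inv_metric_def)
qed

text \<open>The standard formula for a conformally flat metric, where the logarithm of the factor
  \<open>conf\<close> has gradient \<open>- conf y *\<^sub>R y\<close>.\<close>

lemma christoffel_stereo:
  assumes e: "e * e = 1"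
  shows "christoffel round_sphere (stereo_chart e) y k i j
    = - conf y * ((if j = k then y $ i else 0) + (if i = k then y $ j else 0) - (if i = j then y $ k else 0))"
proof -
  have cd: "conf differentiable (at y)" using smooth_conf[of UNIV] by (auto intro: smooth_on_differentiable)
  have d: "partial l (\<lambda>y. metric round_sphere (stereo_chart e) y $ a $ b) y
      = (if a = b then - (2 * conf y * conf y * conf y * y $ l) else 0)" for l a b
    unfolding metric_stereo[OF e]
    by (simp add: dir_deriv_mult[OF cd cd] dir_deriv_conf inner_axis)
  show ?thesis
    unfolding christoffel_def d inv_metric_stereo[OF e] using conf_pos[of y]
    by (simp add: if_distrib[of "\<lambda>z. z * _"] cong: if_cong) (auto simp: field_simps)
qed

text \<open>Gauss formula: the second fundamental form of the unit sphere at \<open>\<sigma>\<close> is \<open>-h\<sigma>\<close>.\<close>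

lemma gauss_formula_stereo:
  fixes y :: "real^'n::finite"
  assumes e: "e * e = 1"
  shows "(\<Sum>a\<in>UNIV. christoffel round_sphere (stereo_chart e) y a b c *\<^sub>R partial a (stereo_inv e) y)
    = partial b (partial c (stereo_inv e)) y
      + (partial b (stereo_inv e) y \<bullet> partial c (stereo_inv e) y) *\<^sub>R stereo_inv e y"
proof -
  let ?\<delta> = "if b = c then 1 else 0 :: real"
  have sd: "stereo_inv e differentiable (at y)"
    using smooth_stereo_inv[of UNIV] by (auto intro: smooth_on_differentiable)
  have "(\<Sum>a\<in>UNIV. christoffel round_sphere (stereo_chart e) y a b c *\<^sub>R partial a (stereo_inv e) y)
    = (\<Sum>a\<in>UNIV. - conf y *\<^sub>R ((if c = a then y $ b *\<^sub>R partial a (stereo_inv e) y else 0)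
       + (if b = a then y $ c *\<^sub>R partial a (stereo_inv e) y else 0) - ?\<delta> *\<^sub>R y $ a *\<^sub>R partial a (stereo_inv e) y))"
    by (intro sum.cong refl) (auto simp: christoffel_stereo[OF e] algebra_simps)
  also have "\<dots> = - conf y *\<^sub>R (y $ b *\<^sub>R partial c (stereo_inv e) y + y $ c *\<^sub>R partial b (stereo_inv e) y
      - ?\<delta> *\<^sub>R (\<Sum>a\<in>UNIV. y $ a *\<^sub>R partial a (stereo_inv e) y))"
    unfolding scaleR_right.sum[symmetric] sum.distrib sum_subtractf by simp
  also have "(\<Sum>a\<in>UNIV. y $ a *\<^sub>R partial a (stereo_inv e) y) = dir_deriv y (stereo_inv e) y"
    by (rule dir_deriv_vec[OF sd, symmetric])
  also have "- conf y *\<^sub>R (y $ b *\<^sub>R partial c (stereo_inv e) y + y $ c *\<^sub>R partial b (stereo_inv e) y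
      - ?\<delta> *\<^sub>R dir_deriv y (stereo_inv e) y)
    = partial b (partial c (stereo_inv e)) y
      + (partial b (stereo_inv e) y \<bullet> partial c (stereo_inv e) y) *\<^sub>R stereo_inv e y"
  proof -
    have i: "y \<bullet> axis a 1 = y $ a" for a by (simp add: inner_axis)
    have d: "(axis b 1 :: real^'n) \<bullet> axis c 1 = ?\<delta>" by (simp add: inner_axis_axis)
    \<comment> \<open>The derivative in the radial direction \<open>y\<close> brings in
      \<open>y \<bullet> y\<close>; multiplied by \<open>conf y\<close> it can be eliminated by
      \<open>conf_eq\<close>, after which both sides are polynomials in the same quantities.\<close>
    have f: "conf y * (y \<bullet> y) * (conf y * conf y * t) = 2 * (conf y * conf y * t) - conf y * (conf y * conf y * t)" for t
      by (simp add: conf_eq algebra_simps)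
    show ?thesis
      unfolding inner_dir_deriv_stereo_inv[OF e] second_dir_deriv_stereo_inv
      unfolding dir_deriv_stereo_inv stereo_inv_def i d
    proof (rule prod_eqI)
      show "fst (- conf y *\<^sub>R (y $ b *\<^sub>R (- (conf y * conf y * y $ c) *\<^sub>R y + conf y *\<^sub>R axis c 1, e * (conf y * conf y * y $ c)) +
           y $ c *\<^sub>R (- (conf y * conf y * y $ b) *\<^sub>R y + conf y *\<^sub>R axis b 1, e * (conf y * conf y * y $ b)) -
           ?\<delta> *\<^sub>R (- (conf y * conf y * (y \<bullet> y)) *\<^sub>R y + conf y *\<^sub>R y, e * (conf y * conf y * (y \<bullet> y)))))
        = fst (((2 * conf y * conf y * conf y * y $ b * y $ c - conf y * conf y * ?\<delta>) *\<^sub>R y -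
            (conf y * conf y * y $ c) *\<^sub>R axis b 1 - (conf y * conf y * y $ b) *\<^sub>R axis c 1,
            e * (conf y * conf y * ?\<delta> - 2 * conf y * conf y * conf y * y $ b * y $ c)) +
           (conf y * conf y * ?\<delta>) *\<^sub>R (conf y *\<^sub>R y, e * (1 - conf y)))"
        unfolding vec_eq_iff using f[of "?\<delta> * y $ _"]
        by (simp add: algebra_simps)
      show "snd (- conf y *\<^sub>R (y $ b *\<^sub>R (- (conf y * conf y * y $ c) *\<^sub>R y + conf y *\<^sub>R axis c 1, e * (conf y * conf y * y $ c)) +
           y $ c *\<^sub>R (- (conf y * conf y * y $ b) *\<^sub>R y + conf y *\<^sub>R axis b 1, e * (conf y * conf y * y $ b)) -
           ?\<delta> *\<^sub>R (- (conf y * conf y * (y \<bullet> y)) *\<^sub>R y + conf y *\<^sub>R y, e * (conf y * conf y * (y \<bullet> y)))))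
        = snd (((2 * conf y * conf y * conf y * y $ b * y $ c - conf y * conf y * ?\<delta>) *\<^sub>R y -
            (conf y * conf y * y $ c) *\<^sub>R axis b 1 - (conf y * conf y * y $ b) *\<^sub>R axis c 1,
            e * (conf y * conf y * ?\<delta> - 2 * conf y * conf y * conf y * y $ b * y $ c)) +
           (conf y * conf y * ?\<delta>) *\<^sub>R (conf y *\<^sub>R y, e * (1 - conf y)))"
        using f[of "?\<delta> * e"] by (simp add: algebra_simps)
    qed
  qed
  finally show ?thesis .
qed

lemma chart_at_sphere:
  fixes z :: "(real^'n::finite) \<times> real"
  assumes "z \<in> sphere 0 1"
  obtains e where "e * e = 1" "chart_at round_sphere z = stereo_chart e" "z \<in> chart_dom (stereo_chart e)"
proof -
  have "z \<in> chart_dom (stereo_chart 1) \<or> z \<in> chart_dom (stereo_chart (-1))"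
    using assms by (auto simp: stereo_chart_def)
  then have "\<exists>c. c \<in> atlas round_sphere \<and> z \<in> chart_dom c" using atlas_sphere by blast
  then have "chart_at round_sphere z \<in> atlas round_sphere \<and> z \<in> chart_dom (chart_at round_sphere z)"
    unfolding chart_at_def by (rule someI_ex)
  then show ?thesis using that[of 1] that[of "-1"] unfolding atlas_sphere by fastforce
qed

lemma chart_dom_stereo: "z \<in> sphere 0 1 \<Longrightarrow> z \<in> chart_dom (stereo_chart e) \<longleftrightarrow> z \<noteq> (0, e)"
  by (simp add: stereo_chart_def)

lemma open_stereo_preimage:
  assumes U: "open U" and u: "continuous_on U u" "\<And>x. x \<in> U \<Longrightarrow> u x \<in> sphere 0 1"
  shows "open {x \<in> U. u x \<in> chart_dom (stereo_chart e)}"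
proof -
  have "u x \<in> chart_dom (stereo_chart e) \<longleftrightarrow> u x \<noteq> (0, e)" if "x \<in> U" for x
    using u(2)[OF that] by (rule chart_dom_stereo)
  then have "{x \<in> U. u x \<in> chart_dom (stereo_chart e)} = U \<inter> u -` (- {(0, e)})"
    by blast
  then show ?thesis using continuous_open_preimage[OF u(1) U, of "- {(0, e)}"] by auto
qed

lemma smooth_stereo_chart:
  assumes e: "e * e = 1" and U: "open U" and u: "smooth_on U u"
    and s: "\<And>x. x \<in> U \<Longrightarrow> u x \<in> chart_dom (stereo_chart e)"
  shows "smooth_on U (\<lambda>x. chart_map (stereo_chart e) (u x))"
proof -
  have "smooth_on U (\<lambda>x. inverse (1 - e * snd (u x)) *\<^sub>R fst (u x))"
    using pole_denominator[OF e s] by (intro smooth_on_inverse smooth_intros U u) auto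
  then show ?thesis by (simp add: stereo_chart_def case_prod_beta)
qed

section \<open>The tension field of a map into the sphere\<close>

locale sphere_rep = riem_chart M c V
  for M :: "('a, 'm::finite, 'z) riem_scheme" and c V +
  fixes u :: "real^'m \<Rightarrow> (real^'n::finite) \<times> real"
  assumes smooth_u: "smooth_on V u" and u_sphere: "x \<in> V \<Longrightarrow> u x \<in> sphere 0 1"
begin

lemma u_inner: "x \<in> V \<Longrightarrow> u x \<bullet> u x = 1"
  using u_sphere sphere_inner by blast

lemma diff_u: "x \<in> V \<Longrightarrow> u differentiable (at x)" "x \<in> V \<Longrightarrow> partial i u differentiable (at x)"
  using smooth_u by (auto intro: smooth_on_differentiable smooth_on_dir_deriv)

lemma partial_u_inner: "x \<in> V \<Longrightarrow> partial i u x \<bullet> u x = 0"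
proof -
  assume x: "x \<in> V"
  have "partial i (\<lambda>y. u y \<bullet> u y) x = partial i (\<lambda>y. 1) x"
    by (rule dir_deriv_cong_open[OF open_V x]) (rule u_inner)
  then show ?thesis by (simp add: dir_deriv_inner[OF diff_u(1)[OF x] diff_u(1)[OF x]] inner_commute)
qed

lemma second_partial_u_inner: "x \<in> V \<Longrightarrow> partial i (partial j u) x \<bullet> u x = - (partial i u x \<bullet> partial j u x)"
proof -
  assume x: "x \<in> V"
  have "partial i (\<lambda>y. partial j u y \<bullet> u y) x = partial i (\<lambda>y. 0) x"
    by (rule dir_deriv_cong_open[OF open_V x]) (rule partial_u_inner)
  then have "partial j u x \<bullet> partial i u x + partial i (partial j u) x \<bullet> u x = 0"
    unfolding dir_deriv_inner[OF diff_u(2)[OF x] diff_u(1)[OF x]] by simp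
  then show ?thesis using inner_commute[of "partial i u x" "partial j u x"] by simp
qed

lemma lap_u_inner: "x \<in> V \<Longrightarrow> lap M c u x \<bullet> u x = - grad_inner M c u u x"
  by (simp add: lap_def grad_inner_def metric_trace_def inner_sum_left inner_diff_left
      partial_u_inner second_partial_u_inner sum_negf)

text \<open>The normal component of the Laplacian is minus the energy density, so adding the
  multiple of \<open>u\<close> removes it and Pythagoras gives the difference of squares.\<close>

lemma norm_lap_u:
  assumes "x \<in> V"
  shows "(lap M c u x + grad_inner M c u u x *\<^sub>R u x) \<bullet> (lap M c u x + grad_inner M c u u x *\<^sub>R u x)
    = tension_sq M c u x"
  using lap_u_inner[OF assms] u_inner[OF assms]
  by (simp add: inner_add_left inner_add_right inner_commute[of "u x" "lap M c u x"])

end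

text \<open>Two descriptions of one map are compared: \<open>u\<close> in the ambient space, where
  the Laplacian acts, and \<open>F\<close> in a stereographic chart, where the tension field is
  defined. On \<open>V\<close> the image avoids the omitted pole.\<close>

locale stereo_rep = sphere_rep M c V u
  for M :: "('a, 'm::finite, 'z) riem_scheme" and c V and u :: "real^'m \<Rightarrow> (real^'n::finite) \<times> real" +
  fixes e :: real and \<phi> :: "'a \<Rightarrow> (real^'n::finite) \<times> real"
  assumes e: "e * e = 1" and u_dom: "x \<in> V \<Longrightarrow> u x \<in> chart_dom (stereo_chart e)"
    and u_eq: "x \<in> V \<Longrightarrow> \<phi> (chart_inv c x) = u x"
begin

abbreviation "F \<equiv> coord_rep c (stereo_chart e) \<phi>"

lemma F_eq: "x \<in> V \<Longrightarrow> F x = chart_map (stereo_chart e) (u x)"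
  by (simp add: coord_rep_def u_eq)

lemma smooth_F: "smooth_on V F"
  by (rule smooth_on_cong[OF open_V F_eq[symmetric]])
    (auto intro!: smooth_stereo_chart e open_V smooth_u u_dom)

lemma u_F: "x \<in> V \<Longrightarrow> u x = stereo_inv e (F x)"
  using stereo_inv_chart[OF e u_dom] F_eq by metis

lemma diff_F: "x \<in> V \<Longrightarrow> F differentiable (at x)" "x \<in> V \<Longrightarrow> partial i F differentiable (at x)"
  using smooth_F by (auto intro: smooth_on_differentiable smooth_on_dir_deriv)

abbreviation "\<sigma> b y \<equiv> partial b (stereo_inv e) y"

lemma smooth_\<sigma>: "smooth_on UNIV (stereo_inv e)" "smooth_on UNIV (\<sigma> b)" "\<sigma> b differentiable (at y)"
  "stereo_inv e differentiable (at y)"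
  using smooth_stereo_inv[of UNIV e] by (auto intro: smooth_on_differentiable smooth_on_dir_deriv)

lemma partial_u: "x \<in> V \<Longrightarrow> partial j u x = (\<Sum>b\<in>UNIV. partial j F x $ b *\<^sub>R \<sigma> b (F x))"
proof -
  assume x: "x \<in> V"
  have "partial j u x = partial j (\<lambda>y. stereo_inv e (F y)) x"
    by (rule dir_deriv_cong_open[OF open_V x]) (rule u_F)
  also have "\<dots> = dir_deriv (partial j F x) (stereo_inv e) (F x)"
    by (rule dir_deriv_compose[OF diff_F(1)[OF x] smooth_\<sigma>(4)])
  also have "\<dots> = (\<Sum>b\<in>UNIV. partial j F x $ b *\<^sub>R \<sigma> b (F x))"
    by (rule dir_deriv_vec[OF smooth_\<sigma>(4)])
  finally show ?thesis .
qed

lemma partial_u_inner_partial_u: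
  assumes x: "x \<in> V"
  shows "partial i u x \<bullet> partial j u x
    = (\<Sum>b\<in>UNIV. \<Sum>k\<in>UNIV. (partial i F x $ b * partial j F x $ k) * (\<sigma> b (F x) \<bullet> \<sigma> k (F x)))"
  unfolding partial_u[OF x] inner_sum_left
  unfolding inner_sum_right by (intro sum.cong refl) (simp add: mult.assoc)

lemma pullback_metric_u:
  assumes x: "x \<in> V"
  shows "pullback_metric round_sphere c (stereo_chart e) \<phi> x i j = partial i u x \<bullet> partial j u x"
  unfolding partial_u_inner_partial_u[OF x] pullback_metric_def inner_vec_def matrix_vector_mult_def
  by (simp add: round_sphere_def chart_inv_stereo[OF e] sum_distrib_left ac_simps)

text \<open>Pushed forward along the vectors \<open>\<sigma> a (F x)\<close>, the Christoffel terms
  of the sphere become second derivatives of \<open>stereo_inv\<close> by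
  \<open>gauss_formula_stereo\<close>. These complete the chain rule for second derivatives of
  \<open>u\<close>, and the normal part of the Gauss formula leaves the multiple of
  \<open>u\<close>.\<close>

lemma second_fundamental_form_u:
  assumes x: "x \<in> V"
  shows "(\<Sum>a\<in>UNIV. second_fundamental_form M round_sphere c (stereo_chart e) \<phi> x i j $ a *\<^sub>R \<sigma> a (F x))
    = partial i (partial j u) x - (\<Sum>k\<in>UNIV. christoffel M c x k i j *\<^sub>R partial k u x)
      + (partial i u x \<bullet> partial j u x) *\<^sub>R u x"
proof -
  let ?s = "\<lambda>a. \<sigma> a (F x)" and ?G = "\<lambda>a b k. christoffel round_sphere (stereo_chart e) (F x) a b k"
  have 1: "partial i (partial j u) x = (\<Sum>a\<in>UNIV. partial i (partial j F) x $ a *\<^sub>R ?s a)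
    + (\<Sum>b\<in>UNIV. \<Sum>k\<in>UNIV. (partial i F x $ b * partial j F x $ k) *\<^sub>R partial b (partial k (stereo_inv e)) (F x))"
  proof -
    have d: "(\<lambda>y. partial j F y $ b) differentiable (at x)" "(\<lambda>y. \<sigma> b (F y)) differentiable (at x)"
      "(\<lambda>y. partial j F y $ b *\<^sub>R \<sigma> b (F y)) differentiable (at x)" for b
      by (rule smooth_on_differentiable[OF _ x],
          intro smooth_intros smooth_F open_V smooth_on_compose[OF open_V smooth_F smooth_\<sigma>(2)], simp?)+
    have "partial i (partial j u) x = partial i (\<lambda>y. \<Sum>b\<in>UNIV. partial j F y $ b *\<^sub>R \<sigma> b (F y)) x"
      by (rule dir_deriv_cong_open[OF open_V x]) (rule partial_u)
    also have "\<dots> = (\<Sum>k\<in>UNIV. partial j F x $ k *\<^sub>R dir_deriv (partial i F x) (\<sigma> k) (F x)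
        + partial i (partial j F) x $ k *\<^sub>R ?s k)"
      by (simp add: dir_deriv_sum dir_deriv_scaleR d dir_deriv_compose[OF diff_F(1)[OF x] smooth_\<sigma>(3)]
          dir_deriv_bounded_linear[OF bounded_linear_vec_nth diff_F(2)[OF x]])
    also have "\<dots> = (\<Sum>a\<in>UNIV. partial i (partial j F) x $ a *\<^sub>R ?s a)
      + (\<Sum>k\<in>UNIV. \<Sum>b\<in>UNIV. (partial i F x $ b * partial j F x $ k) *\<^sub>R partial b (partial k (stereo_inv e)) (F x))"
      by (simp add: dir_deriv_vec[OF smooth_\<sigma>(3), of "partial i F x"] scaleR_sum_right sum.distrib mult.commute)
    also have "(\<Sum>k\<in>UNIV. \<Sum>b\<in>UNIV. (partial i F x $ b * partial j F x $ k) *\<^sub>R partial b (partial k (stereo_inv e)) (F x))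
      = (\<Sum>b\<in>UNIV. \<Sum>k\<in>UNIV. (partial i F x $ b * partial j F x $ k) *\<^sub>R partial b (partial k (stereo_inv e)) (F x))"
      by (rule sum.swap)
    finally show ?thesis .
  qed
  have 2: "(\<Sum>a\<in>UNIV. (\<Sum>k\<in>UNIV. christoffel M c x k i j * partial k F x $ a) *\<^sub>R ?s a)
     = (\<Sum>k\<in>UNIV. christoffel M c x k i j *\<^sub>R partial k u x)"
    unfolding partial_u[OF x] scaleR_sum_left scaleR_sum_right scaleR_scaleR by (rule sum.swap)
  have "(\<Sum>a\<in>UNIV. (\<Sum>b\<in>UNIV. \<Sum>k\<in>UNIV. ?G a b k * partial i F x $ b * partial j F x $ k) *\<^sub>R ?s a)
    = (\<Sum>a\<in>UNIV. \<Sum>b\<in>UNIV. \<Sum>k\<in>UNIV. (partial i F x $ b * partial j F x $ k) *\<^sub>R (?G a b k *\<^sub>R ?s a))"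
    by (simp add: scaleR_sum_left ac_simps)
  also have "\<dots> = (\<Sum>b\<in>UNIV. \<Sum>k\<in>UNIV. \<Sum>a\<in>UNIV. (partial i F x $ b * partial j F x $ k) *\<^sub>R (?G a b k *\<^sub>R ?s a))"
    by (rule sum_rotate3)
  also have "\<dots> = (\<Sum>b\<in>UNIV. \<Sum>k\<in>UNIV. (partial i F x $ b * partial j F x $ k) *\<^sub>R
      (partial b (partial k (stereo_inv e)) (F x) + (?s b \<bullet> ?s k) *\<^sub>R u x))"
    unfolding scaleR_sum_right[symmetric] gauss_formula_stereo[OF e] u_F[OF x] ..
  also have "\<dots> = (\<Sum>b\<in>UNIV. \<Sum>k\<in>UNIV. (partial i F x $ b * partial j F x $ k) *\<^sub>R partial b (partial k (stereo_inv e)) (F x))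
      + (partial i u x \<bullet> partial j u x) *\<^sub>R u x"
    unfolding partial_u_inner_partial_u[OF x]
    by (simp add: scaleR_sum_left scaleR_right_distrib sum.distrib)
  finally have 3: "(\<Sum>a\<in>UNIV. (\<Sum>b\<in>UNIV. \<Sum>k\<in>UNIV. ?G a b k * partial i F x $ b * partial j F x $ k) *\<^sub>R ?s a) = \<dots>" .
  show ?thesis
    unfolding second_fundamental_form_def Let_def vec_lambda_beta scaleR_left_distrib scaleR_left_diff_distrib
      sum.distrib sum_subtractf 1 2 3 by simp
qed

lemma tension_u:
  assumes x: "x \<in> V"
  defines "\<tau> \<equiv> metric_trace M c x (second_fundamental_form M round_sphere c (stereo_chart e) \<phi> x)"
  shows "(\<Sum>a\<in>UNIV. \<tau> $ a *\<^sub>R \<sigma> a (F x)) = lap M c u x + grad_inner M c u u x *\<^sub>R u x"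
proof -
  have "(\<Sum>a\<in>UNIV. \<tau> $ a *\<^sub>R \<sigma> a (F x)) = (\<Sum>k\<in>UNIV. \<Sum>i\<in>UNIV. \<Sum>j\<in>UNIV. a i j x *\<^sub>R
     (second_fundamental_form M round_sphere c (stereo_chart e) \<phi> x i j $ k *\<^sub>R \<sigma> k (F x)))"
    by (simp add: \<tau>_def metric_trace_def scaleR_sum_left)
  also have "\<dots> = (\<Sum>i\<in>UNIV. \<Sum>j\<in>UNIV. \<Sum>k\<in>UNIV. a i j x *\<^sub>R
     (second_fundamental_form M round_sphere c (stereo_chart e) \<phi> x i j $ k *\<^sub>R \<sigma> k (F x)))"
    by (rule sum_rotate3)
  also have "\<dots> = lap M c u x + grad_inner M c u u x *\<^sub>R u x"
    unfolding scaleR_sum_right[symmetric] second_fundamental_form_u[OF x] lap_def grad_inner_def metric_trace_def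
    by (simp add: scaleR_right_distrib sum.distrib scaleR_sum_left)
  finally show ?thesis .
qed

text \<open>The differential of \<open>stereo_inv\<close> scales lengths by the positive factor
  \<open>conf\<close>, the same factor that defines the metric of the chart. Length and vanishing of
  the tension field can therefore be read off in the ambient space.\<close>

lemma tension_norm_u:
  assumes x: "x \<in> V"
  defines "\<tau> \<equiv> metric_trace M c x (second_fundamental_form M round_sphere c (stereo_chart e) \<phi> x)"
  shows "\<tau> \<bullet> (metric round_sphere (stereo_chart e) (F x) *v \<tau>)
      = tension_sq M c u x"
    and "\<tau> = 0 \<longleftrightarrow> lap M c u x + grad_inner M c u u x *\<^sub>R u x = 0"
proof -
  let ?W = "lap M c u x + grad_inner M c u u x *\<^sub>R u x"
  have W: "dir_deriv \<tau> (stereo_inv e) (F x) = ?W"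
    using dir_deriv_vec[OF smooth_\<sigma>(4)] tension_u[OF x] unfolding \<tau>_def[symmetric] by (rule trans)
  have *: "\<tau> \<bullet> (metric round_sphere (stereo_chart e) (F x) *v \<tau>) = conf (F x) * conf (F x) * (\<tau> \<bullet> \<tau>)"
    by (simp add: inner_vec_def matrix_vector_mult_def metric_stereo[OF e] sum_distrib_left
        if_distrib[of "\<lambda>z. z * _"] if_distrib[of "\<lambda>z. _ * z"] ac_simps cong: if_cong)
  also have **: "\<dots> = ?W \<bullet> ?W"
    unfolding W[symmetric] inner_dir_deriv_stereo_inv[OF e] ..
  finally show "\<tau> \<bullet> (metric round_sphere (stereo_chart e) (F x) *v \<tau>)
      = tension_sq M c u x"
    by (simp only: norm_lap_u[OF x])
  show "\<tau> = 0 \<longleftrightarrow> ?W = 0"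
  proof -
    have "\<tau> = 0 \<longleftrightarrow> conf (F x) * conf (F x) * (\<tau> \<bullet> \<tau>) = 0"
      using conf_pos[of "F x"] by simp
    also have "\<dots> \<longleftrightarrow> ?W = 0" unfolding ** by (rule inner_eq_zero_iff)
    finally show ?thesis .
  qed
qed

end

section \<open>Energy density and tension field in an arbitrary chart\<close>

context riem_mfd begin

definition sphere_map :: "('a \<Rightarrow> (real^'n::finite) \<times> real) \<Rightarrow> bool" where
  "sphere_map \<phi> \<longleftrightarrow> smooth_fun \<phi> \<and> (\<forall>p\<in>topspace (mtop M). \<phi> p \<in> sphere 0 1)"

lemma sphere_mapD:
  assumes "sphere_map \<phi>" "c \<in> atlas M"
  shows "smooth_on (cimg c) (\<phi> \<circ> chart_inv c)" "x \<in> cimg c \<Longrightarrow> \<phi> (chart_inv c x) \<in> sphere 0 1"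
proof -
  show "smooth_on (cimg c) (\<phi> \<circ> chart_inv c)"
    using assms unfolding sphere_map_def smooth_fun_def by blast
  assume "x \<in> cimg c"
  then have "chart_inv c x \<in> topspace (mtop M)"
    by (rule subsetD[OF chart_dom_subset[OF assms(2)] chart_inv_in])
  then show "\<phi> (chart_inv c x) \<in> sphere 0 1" using assms unfolding sphere_map_def by blast
qed

lemma sphere_rep:
  assumes "sphere_map \<phi>" "c \<in> atlas M"
  shows "sphere_rep M c (cimg c) (\<phi> \<circ> chart_inv c)"
proof -
  interpret C: riem_chart M c "cimg c" by (rule riem_chart[OF assms(2)])
  show ?thesis using sphere_mapD[OF assms] by unfold_locales (simp_all only: o_apply)
qed

lemma stereo_rep:
  assumes \<phi>: "sphere_map \<phi>" and c: "c \<in> atlas M" and e: "e * e = 1"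
  defines "V \<equiv> {x \<in> cimg c. (\<phi> \<circ> chart_inv c) x \<in> chart_dom (stereo_chart e)}"
  shows "stereo_rep M c V (\<phi> \<circ> chart_inv c) e \<phi>"
proof -
  interpret C: sphere_rep M c "cimg c" "\<phi> \<circ> chart_inv c" by (rule sphere_rep[OF \<phi> c])
  have sub: "V \<subseteq> cimg c" unfolding V_def by blast
  show ?thesis
  proof
    show "open V" unfolding V_def
      by (rule open_stereo_preimage[OF C.open_V smooth_on_continuous_on[OF C.smooth_u] C.u_sphere])
    show "smooth_on V (metric M c)" "smooth_on V (\<phi> \<circ> chart_inv c)"
      using sub C.smooth_metric C.smooth_u by (blast intro: smooth_on_subset)+
    show "e * e = 1" by (rule e)
    fix x assume x: "x \<in> V"
    then have xc: "x \<in> cimg c" using sub by blast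
    show "transpose (metric M c x) = metric M c x" by (rule C.sym_metric[OF xc])
    show "v \<noteq> 0 \<Longrightarrow> v \<bullet> (metric M c x *v v) > 0" for v by (rule C.pos_metric[OF xc])
    show "(\<phi> \<circ> chart_inv c) x \<in> sphere 0 1" by (rule C.u_sphere[OF xc])
    show "(\<phi> \<circ> chart_inv c) x \<in> chart_dom (stereo_chart e)" using x unfolding V_def by blast
    show "\<phi> (chart_inv c x) = (\<phi> \<circ> chart_inv c) x" by (rule o_apply[symmetric])
  qed
qed

text \<open>The chart of the sphere that the definitions select enters only through its sign, and
  the results do not depend on that sign. The chart of \<open>M\<close> is still the selected one;
  \<open>tension_chart\<close> frees it as well.\<close>

lemma tension_local:
  assumes \<phi>: "sphere_map \<phi>" and p: "p \<in> topspace (mtop M)"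
  defines "c \<equiv> chart_at M p"
  shows "energy_density M round_sphere \<phi> p = grad_inner M c (\<phi> \<circ> chart_inv c) (\<phi> \<circ> chart_inv c) (chart_map c p)"
    and "tension_norm2 M round_sphere \<phi> p = lap M c (\<phi> \<circ> chart_inv c) (chart_map c p) \<bullet> lap M c (\<phi> \<circ> chart_inv c) (chart_map c p)
      - energy_density M round_sphere \<phi> p * energy_density M round_sphere \<phi> p"
    and "tension M round_sphere \<phi> p = 0 \<longleftrightarrow>
      lap M c (\<phi> \<circ> chart_inv c) (chart_map c p) + energy_density M round_sphere \<phi> p *\<^sub>R \<phi> p = 0"
proof -
  have c: "c \<in> atlas M" "p \<in> chart_dom c" using chart_at[OF p] by (auto simp: c_def)
  have "\<phi> p \<in> sphere 0 1" using \<phi> p by (simp add: sphere_map_def)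
  then obtain e where e: "e * e = 1" "chart_at round_sphere (\<phi> p) = stereo_chart e" "\<phi> p \<in> chart_dom (stereo_chart e)"
    by (rule chart_at_sphere)
  define V where "V = {x \<in> cimg c. (\<phi> \<circ> chart_inv c) x \<in> chart_dom (stereo_chart e)}"
  interpret S: stereo_rep M c V "\<phi> \<circ> chart_inv c" e \<phi>
    unfolding V_def by (rule stereo_rep[OF \<phi> c(1) e(1)])
  have x: "chart_map c p \<in> V" using c e by (simp add: V_def)
  have u: "(\<phi> \<circ> chart_inv c) (chart_map c p) = \<phi> p" using c by simp
  show en: "energy_density M round_sphere \<phi> p = grad_inner M c (\<phi> \<circ> chart_inv c) (\<phi> \<circ> chart_inv c) (chart_map c p)"
    unfolding energy_density_def Let_def c_def[symmetric] e(2) grad_inner_def metric_trace_def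
      S.pullback_metric_u[OF x] ..
  have t: "tension M round_sphere \<phi> p = metric_trace M c (chart_map c p)
     (second_fundamental_form M round_sphere c (stereo_chart e) \<phi> (chart_map c p))"
    unfolding tension_def Let_def c_def[symmetric] e(2) ..
  have F: "chart_map (stereo_chart e) (\<phi> p) = S.F (chart_map c p)"
    using S.F_eq[OF x] u by simp
  show "tension_norm2 M round_sphere \<phi> p = lap M c (\<phi> \<circ> chart_inv c) (chart_map c p) \<bullet> lap M c (\<phi> \<circ> chart_inv c) (chart_map c p)
      - energy_density M round_sphere \<phi> p * energy_density M round_sphere \<phi> p"
    unfolding tension_norm2_def Let_def e(2) t F en by (rule S.tension_norm_u(1)[OF x])
  show "tension M round_sphere \<phi> p = 0 \<longleftrightarrow>
      lap M c (\<phi> \<circ> chart_inv c) (chart_map c p) + energy_density M round_sphere \<phi> p *\<^sub>R \<phi> p = 0"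
    unfolding t en using S.tension_norm_u(2)[OF x] unfolding u .
qed

lemma tension_chart:
  assumes \<phi>: "sphere_map \<phi>" and c: "c \<in> atlas M" and x: "x \<in> cimg c"
  defines "u \<equiv> \<phi> \<circ> chart_inv c"
  shows "energy_density M round_sphere \<phi> (chart_inv c x) = grad_inner M c u u x"
    and "tension_norm2 M round_sphere \<phi> (chart_inv c x) = tension_sq M c u x"
    and "tension M round_sphere \<phi> (chart_inv c x) = 0 \<longleftrightarrow> lap M c u x + grad_inner M c u u x *\<^sub>R u x = 0"
proof -
  let ?p = "chart_inv c x"
  have pc: "?p \<in> chart_dom c" "chart_map c ?p = x"
    using chart_inv_in[OF x] chart_inv_right[OF x] by simp_all
  have p: "?p \<in> topspace (mtop M)" by (rule subsetD[OF chart_dom_subset[OF c] pc(1)])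
  let ?d = "chart_at M ?p"
  have d: "?d \<in> atlas M" "?p \<in> chart_dom ?d" using chart_at[OF p] by auto
  have 1: "lap M ?d (\<phi> \<circ> chart_inv ?d) (chart_map ?d ?p) = lap M c u x"
    using lap_chart_independent[OF d(1) c d(2) pc(1) sphere_mapD(1)[OF \<phi> c]] by (simp add: pc u_def)
  have 2: "grad_inner M ?d (\<phi> \<circ> chart_inv ?d) (\<phi> \<circ> chart_inv ?d) (chart_map ?d ?p) = grad_inner M c u u x"
    using grad_inner_chart_independent[OF d(1) c d(2) pc(1) sphere_mapD(1)[OF \<phi> c] sphere_mapD(1)[OF \<phi> c]]
    by (simp add: pc u_def)
  have 3: "\<phi> ?p = u x" by (simp add: u_def)
  show en: "energy_density M round_sphere \<phi> ?p = grad_inner M c u u x"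
    unfolding tension_local(1)[OF \<phi> p] 2 ..
  show "tension_norm2 M round_sphere \<phi> ?p = tension_sq M c u x"
    unfolding tension_local(2)[OF \<phi> p] 1 en ..
  show "tension M round_sphere \<phi> ?p = 0 \<longleftrightarrow> lap M c u x + grad_inner M c u u x *\<^sub>R u x = 0"
    unfolding tension_local(3)[OF \<phi> p] 1 en 3 ..
qed

text \<open>Around each point one stereographic chart covers the image, and there
  \<open>\<phi>\<close> is the smooth map \<open>stereo_inv\<close> applied to its coordinate
  representation. Continuity of \<open>\<phi>\<close> makes the region of validity open.\<close>

lemma smooth_map_sphere_map:
  assumes "smooth_map M round_sphere \<phi>"
  shows "sphere_map \<phi>"
proof -
  have cont: "continuous_map (mtop M) (top_of_set (sphere 0 1)) \<phi>"
    and sm: "\<And>c d. c \<in> atlas M \<Longrightarrow> d \<in> atlas round_sphere \<Longrightarrow>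
      smooth_on (chart_map c ` (chart_dom c \<inter> \<phi> -` chart_dom d)) (coord_rep c d \<phi>)"
    using assms unfolding smooth_map_def by (simp add: round_sphere_def, blast)
  have sph: "\<phi> p \<in> sphere 0 1" if "p \<in> topspace (mtop M)" for p
    using continuous_map_image_subset_topspace[OF cont] that unfolding topspace_euclidean_subtopology by blast
  have "smooth_on (cimg c) (\<phi> \<circ> chart_inv c)" if c: "c \<in> atlas M" for c
  proof (rule smooth_on_local)
    fix x assume x: "x \<in> cimg c"
    let ?p = "chart_inv c x"
    have p: "?p \<in> chart_dom c" "?p \<in> topspace (mtop M)" "chart_map c ?p = x"
      using chart_inv_in[OF x] chart_inv_right[OF x] subsetD[OF chart_dom_subset[OF c] chart_inv_in[OF x]] by simp_all
    obtain e where e: "e * e = 1" "?p \<in> \<phi> -` chart_dom (stereo_chart e)"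
      using chart_at_sphere[OF sph[OF p(2)]] by (metis vimageI)
    define A where "A = chart_dom c \<inter> \<phi> -` chart_dom (stereo_chart e)"
    have ea: "stereo_chart e \<in> atlas round_sphere" using sign_cases[OF e(1)] unfolding atlas_sphere by blast
    have "A = {q \<in> topspace (mtop M). \<phi> q \<in> sphere 0 1 \<inter> - {(0, e)}} \<inter> chart_dom c"
      using sph chart_dom_subset[OF c] by (auto simp: A_def stereo_chart_def)
    moreover have "openin (mtop M) {q \<in> topspace (mtop M). \<phi> q \<in> sphere 0 1 \<inter> - {(0, e)}}"
      by (rule openin_continuous_map_preimage[OF cont]) (auto intro: openin_open_Int)
    ultimately have "openin (mtop M) A" using openin_chart_dom[OF c] by (auto intro: openin_Int)
    then have oA: "open (chart_map c ` A)" using open_chart_image[OF c] by (simp add: A_def)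
    have "smooth_on (chart_map c ` A) (\<phi> \<circ> chart_inv c)"
    proof (rule smooth_on_cong[OF oA])
      show "smooth_on (chart_map c ` A) (\<lambda>x. stereo_inv e (coord_rep c (stereo_chart e) \<phi> x))"
        using sm[OF c ea] unfolding A_def[symmetric]
        by (intro smooth_on_compose[OF oA _ smooth_stereo_inv[of UNIV]]) auto
      fix y assume "y \<in> chart_map c ` A"
      then show "stereo_inv e (coord_rep c (stereo_chart e) \<phi> y) = (\<phi> \<circ> chart_inv c) y"
        using c stereo_inv_chart[OF e(1)] by (auto simp: A_def coord_rep_def)
    qed
    moreover have "x \<in> chart_map c ` A" using p e by (auto simp: A_def intro!: image_eqI[of _ _ ?p])
    ultimately show "\<exists>W. x \<in> W \<and> smooth_on W (\<phi> \<circ> chart_inv c)" by blast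
  qed
  with sph show ?thesis by (simp add: sphere_map_def smooth_fun_def)
qed

end

section \<open>The Riemannian volume measure\<close>

lemma absolutely_integrable_nn_integral:
  fixes F :: "'a::euclidean_space \<Rightarrow> real"
  assumes F: "\<And>x. x \<in> S \<Longrightarrow> 0 \<le> F x" "(\<lambda>x. F x * indicator S x) \<in> borel_measurable borel"
    and r: "(\<integral>\<^sup>+x\<in>S. ennreal (F x) \<partial>lborel) = ennreal r" "0 \<le> r"
  shows "F absolutely_integrable_on S \<and> integral S F = r"
proof -
  have "(\<integral>\<^sup>+x. ennreal (F x * indicator S x) \<partial>lborel) = ennreal r"
    unfolding r(1)[symmetric] by (intro nn_integral_cong) (auto simp: indicator_def)
  then have "((\<lambda>x. F x * indicator S x) has_integral r) UNIV"
    using F r(2) by (intro nn_integral_has_integral) (auto simp: indicator_def)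
  moreover have "(\<lambda>x. F x * indicator S x) = (\<lambda>x. if x \<in> S then F x else 0)"
    by (auto simp: indicator_def)
  ultimately have "(F has_integral r) S" by (simp add: has_integral_restrict_UNIV)
  then show ?thesis
    using F(1) by (auto intro!: nonnegative_absolutely_integrable_1 simp: integral_unique integrable_on_def)
qed

text \<open>The change of variables theorem for vector-valued integrands, read on vectors with a
  single component.\<close>

lemma has_absolute_integral_change_of_variables_real:
  fixes f :: "real^'m::{finite,wellorder} \<Rightarrow> real" and g :: "real^'m::_ \<Rightarrow> real^'m::_"
  assumes S: "S \<in> sets lebesgue"
    and der_g: "\<And>x. x \<in> S \<Longrightarrow> (g has_derivative g' x) (at x within S)"
    and inj: "inj_on g S"
  shows "(\<lambda>x. \<bar>det (matrix (g' x))\<bar> * f (g x)) absolutely_integrable_on S \<and>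
           integral S (\<lambda>x. \<bar>det (matrix (g' x))\<bar> * f (g x)) = b
     \<longleftrightarrow> f absolutely_integrable_on (g ` S) \<and> integral (g ` S) f = b"
  using has_absolute_integral_change_of_variables[OF S der_g inj, of "\<lambda>x. vec (f x) :: real^1" "vec b"]
  by (simp add: absolutely_integrable_on_1_iff integral_on_1_eq vec_eq_iff)

text \<open>If either side is finite, the corresponding function is absolutely integrable, and the
  equivalence for absolute integrals gives the other side the same value. Otherwise both sides are
  infinite.\<close>

lemma nn_integral_change_of_variables:
  fixes f h :: "real^'m::{finite,wellorder} \<Rightarrow> real" and g :: "real^'m::_ \<Rightarrow> real^'m::_"
  assumes S: "S \<in> sets borel"
    and der_g: "\<And>x. x \<in> S \<Longrightarrow> (g has_derivative g' x) (at x within S)"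
    and inj: "inj_on g S"
    and f: "\<And>y. y \<in> g ` S \<Longrightarrow> 0 \<le> f y" "(\<lambda>y. f y * indicator (g ` S) y) \<in> borel_measurable borel"
    and h: "\<And>x. x \<in> S \<Longrightarrow> h x = \<bar>det (matrix (g' x))\<bar> * f (g x)" "(\<lambda>x. h x * indicator S x) \<in> borel_measurable borel"
  shows "(\<integral>\<^sup>+x\<in>S. ennreal (h x) \<partial>lborel) = (\<integral>\<^sup>+y\<in>g ` S. ennreal (f y) \<partial>lborel)"
proof -
  let ?a = "\<integral>\<^sup>+x\<in>S. ennreal (h x) \<partial>lborel" and ?b = "\<integral>\<^sup>+y\<in>g ` S. ennreal (f y) \<partial>lborel"
  have S': "S \<in> sets lebesgue" using S by simp
  have h0: "0 \<le> h x" if "x \<in> S" for x using that f(1) h(1) by simp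
  have i: "h absolutely_integrable_on S \<longleftrightarrow> (\<lambda>x. \<bar>det (matrix (g' x))\<bar> * f (g x)) absolutely_integrable_on S"
    by (rule set_integrable_cong[OF refl refl]) (rule h(1))
  have j: "integral S h = integral S (\<lambda>x. \<bar>det (matrix (g' x))\<bar> * f (g x))"
    by (rule Henstock_Kurzweil_Integration.integral_cong) (rule h(1))
  have hh: "h absolutely_integrable_on S \<and> integral S h = b \<longleftrightarrow>
      (\<lambda>x. \<bar>det (matrix (g' x))\<bar> * f (g x)) absolutely_integrable_on S \<and>
           integral S (\<lambda>x. \<bar>det (matrix (g' x))\<bar> * f (g x)) = b" for b
    unfolding i j ..
  note cv = has_absolute_integral_change_of_variables_real[OF S' der_g inj, of f, folded hh]
  have nn: "integral\<^sup>N lborel (\<lambda>x. ennreal (F x) * indicator A x) = ennreal (integral A F)"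
    if "\<And>x. x \<in> A \<Longrightarrow> 0 \<le> F x" "F absolutely_integrable_on A" for F and A :: "(real^'m::_) set"
    by (rule nn_integral_has_integral_lebesgue'[OF that(1) integrable_integral])
      (use that(2) in \<open>simp_all add: absolutely_integrable_on_def\<close>)
  show ?thesis
  proof (cases "?a < \<infinity>")
    case True
    then obtain r where r: "?a = ennreal r" "0 \<le> r" by (cases ?a) auto
    then have "h absolutely_integrable_on S \<and> integral S h = r"
      by (intro absolutely_integrable_nn_integral h0 h(2))
    then have "f absolutely_integrable_on (g ` S) \<and> integral (g ` S) f = r" by (simp only: cv)
    then show ?thesis using nn[of "g ` S" f] f(1) r by simp
  next
    case a: False
    show ?thesis
    proof (cases "?b < \<infinity>")
      case True
      then obtain r where r: "?b = ennreal r" "0 \<le> r" by (cases ?b) auto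
      then have "f absolutely_integrable_on (g ` S) \<and> integral (g ` S) f = r"
        by (intro absolutely_integrable_nn_integral f)
      then have "h absolutely_integrable_on S \<and> integral S h = r" by (simp only: cv)
      then show ?thesis using nn[of S h] h0 r by simp
    next
      case False
      then show ?thesis using a by (simp add: less_top[symmetric])
    qed
  qed
qed

section \<open>Construction and uniqueness of the volume measure\<close>

locale riem_mfd_wo = riem_mfd M
  for M :: "('a, 'm::{finite,wellorder}, 'z) riem_scheme"
begin

abbreviation "X \<equiv> topspace (mtop M)"
abbreviation "borelM \<equiv> sigma_sets X {U. openin (mtop M) U}"

lemma open_Pow: "{U. openin (mtop M) U} \<subseteq> Pow X"
  using openin_subset by blast

lemma sigma_borelM: "sigma_algebra X borelM"
  by (rule sigma_algebra_sigma_sets[OF open_Pow])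

lemma borelM_open: "openin (mtop M) U \<Longrightarrow> U \<in> borelM"
  by (rule sigma_sets.Basic) simp

lemma borelM_Int: "A \<in> borelM \<Longrightarrow> B \<in> borelM \<Longrightarrow> A \<inter> B \<in> borelM"
  by (rule sigma_algebra.axioms(1)[OF sigma_borelM, THEN algebra.axioms(1), THEN ring_of_sets.axioms(1), THEN semiring_of_sets.Int])

lemma borelM_subset: "A \<in> borelM \<Longrightarrow> A \<subseteq> X"
  using sigma_sets_into_sp[OF open_Pow] .

text \<open>Intersecting with the chart domain keeps the claim meaningful for complements, which
  leave that domain; injectivity of the chart then handles the complement step of the
  induction.\<close>

lemma chart_image_borel':
  assumes c: "c \<in> atlas M" and A: "A \<in> borelM"
  shows "chart_map c ` (A \<inter> chart_dom c) \<in> sets borel"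
  using A
proof induction
  case (Basic U)
  then have "openin (mtop M) (U \<inter> chart_dom c)" using openin_chart_dom[OF c] by blast
  then have "open (chart_map c ` (U \<inter> chart_dom c))" by (rule open_chart_image[OF c]) simp
  then show ?case by simp
next
  case Empty
  then show ?case by simp
next
  case (Compl A)
  have "chart_map c ` ((X - A) \<inter> chart_dom c) = chart_map c ` (chart_dom c - A \<inter> chart_dom c)"
    by (rule arg_cong[of _ _ "\<lambda>Z. chart_map c ` Z"]) (use chart_dom_subset[OF c] in blast)
  also have "\<dots> = cimg c - chart_map c ` (A \<inter> chart_dom c)"
    by (rule inj_on_image_set_diff[OF inj_on_chart[OF c]]) simp_all
  finally show ?case using Compl.IH open_cimg[OF c] by (simp only: sets.Diff borel_open)
next
  case (Union A)
  have "chart_map c ` (\<Union> (range A) \<inter> chart_dom c) = (\<Union>i. chart_map c ` (A i \<inter> chart_dom c))" by blast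
  then show ?case using Union.IH by (simp only:) blast
qed

lemma chart_image_borel:
  "c \<in> atlas M \<Longrightarrow> A \<in> borelM \<Longrightarrow> A \<subseteq> chart_dom c \<Longrightarrow> chart_map c ` A \<in> sets borel"
  using chart_image_borel'[of c A] by (simp only: Int_absorb2)

lemma chart_preimage_borelM:
  assumes c: "c \<in> atlas M" and S: "S \<in> sets borel"
  shows "{p \<in> chart_dom c. chart_map c p \<in> S} \<in> borelM"
proof -
  interpret sigma_algebra X borelM by (rule sigma_borelM)
  have dom: "chart_dom c \<in> borelM" using openin_chart_dom[OF c] by (rule borelM_open)
  have "S \<in> sigma_sets UNIV {S. open S}" using S by (simp add: borel_def)
  then show ?thesis
  proof induction
    case (Basic S)
    then show ?case using openin_chart_preimage[OF c] by (blast intro: borelM_open)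
  next
    case Empty
    then show ?case by simp
  next
    case (Compl S)
    have "{p \<in> chart_dom c. chart_map c p \<in> UNIV - S} = chart_dom c - {p \<in> chart_dom c. chart_map c p \<in> S}" by blast
    then show ?case using Diff[OF dom Compl.IH] by simp
  next
    case (Union S)
    have "{p \<in> chart_dom c. chart_map c p \<in> \<Union> (range S)} = (\<Union>i. {p \<in> chart_dom c. chart_map c p \<in> S i})" by blast
    then show ?case using Union.IH by (simp only:) blast
  qed
qed

definition chart_vol :: "('a, 'm) chart \<Rightarrow> 'a set \<Rightarrow> ennreal" where
  "chart_vol c A = (\<integral>\<^sup>+x\<in>chart_map c ` A. ennreal (volume_density M c x) \<partial>lborel)"

lemma vd_borel:
  assumes c: "c \<in> atlas M"
  shows "(\<lambda>x. volume_density M c x * indicator (cimg c) x) \<in> borel_measurable borel"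
proof -
  interpret C: riem_chart M c "cimg c" by (rule riem_chart[OF c])
  have "(\<lambda>x. indicator (cimg c) x *\<^sub>R volume_density M c x) \<in> borel_measurable borel"
    using C.open_V smooth_on_continuous_on[OF C.smooth_vd]
    by (intro borel_measurable_continuous_on_indicator) auto
  then show ?thesis by (simp add: mult.commute)
qed

lemma vd_borel_subset:
  assumes c: "c \<in> atlas M" and S: "S \<in> sets borel" "S \<subseteq> cimg c"
  shows "(\<lambda>x. volume_density M c x * indicator S x) \<in> borel_measurable borel"
proof -
  have "(\<lambda>x. (volume_density M c x * indicator (cimg c) x) * indicator S x) \<in> borel_measurable borel"
    by (intro borel_measurable_times[OF vd_borel[OF c]] borel_measurable_indicator) (use S(1) in simp)
  moreover have "(volume_density M c x * indicator (cimg c) x) * indicator S x = volume_density M c x * indicator S x" for x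
    using S(2) by (auto simp: indicator_def)
  ultimately show ?thesis by simp
qed

text \<open>Recognises \<open>chart_vol\<close> as a measure with density in coordinates, so that
  countable additivity can be inherited.\<close>

lemma chart_vol_emeasure:
  assumes c: "c \<in> atlas M" and A: "A \<in> borelM" "A \<subseteq> chart_dom c"
  shows "chart_vol c A = emeasure (density lborel (\<lambda>x. ennreal (volume_density M c x * indicator (cimg c) x))) (chart_map c ` A)"
proof -
  have "chart_map c ` A \<in> sets borel" using assms by (rule chart_image_borel)
  moreover have "ennreal (volume_density M c x * indicator (cimg c) x) * indicator (chart_map c ` A) x
     = ennreal (volume_density M c x) * indicator (chart_map c ` A) x" for x
    using A(2) by (auto simp: indicator_def)
  ultimately show ?thesis
    using vd_borel[OF c] unfolding chart_vol_def by (subst emeasure_density) auto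
qed

lemma chart_vol_suminf:
  assumes c: "c \<in> atlas M" and A: "\<And>i. A i \<in> borelM" "\<And>i. A i \<subseteq> chart_dom c" "disjoint_family A"
  shows "(\<Sum>i. chart_vol c (A i)) = chart_vol c (\<Union>i. A i)"
proof -
  let ?D = "density lborel (\<lambda>x. ennreal (volume_density M c x * indicator (cimg c) x))"
  interpret sigma_algebra X borelM by (rule sigma_borelM)
  have UA: "(\<Union>i. A i) \<in> borelM" "(\<Union>i. A i) \<subseteq> chart_dom c" using A by auto
  have "disjoint_family (\<lambda>i. chart_map c ` A i)"
    unfolding disjoint_family_on_def
  proof (intro ballI impI)
    fix i j :: nat assume "i \<noteq> j"
    then have "A i \<inter> A j = {}" using A(3) by (auto simp: disjoint_family_on_def)
    then show "chart_map c ` A i \<inter> chart_map c ` A j = {}"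
      using inj_on_image_Int[OF inj_on_chart[OF c] A(2) A(2), of i j] by simp
  qed
  then have "(\<Sum>i. emeasure ?D (chart_map c ` A i)) = emeasure ?D (\<Union>i. chart_map c ` A i)"
    using chart_image_borel[OF c A(1) A(2)] by (intro suminf_emeasure) auto
  then show ?thesis
    by (simp add: chart_vol_emeasure[OF c A(1) A(2)] chart_vol_emeasure[OF c UA] image_UN)
qed

text \<open>By \<open>det_metric_T\<close> the densities of the two charts differ by the absolute
  Jacobian determinant of the transition map, which is what the change of variables absorbs.\<close>

lemma chart_vol_independent:
  assumes c: "c \<in> atlas M" and d: "d \<in> atlas M"
    and A: "A \<in> borelM" "A \<subseteq> chart_dom c" "A \<subseteq> chart_dom d"
  shows "chart_vol c A = chart_vol d A"
proof -
  interpret P: chart_pair M c d by (rule chart_pair[OF c d])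
  let ?S = "chart_map c ` A"
  have SV: "?S \<subseteq> P.V" using A by blast
  have TS: "transition c d ` ?S = chart_map d ` A"
    unfolding image_image using A(2) P.T_chart by (intro image_cong) auto
  have "(\<integral>\<^sup>+x\<in>?S. ennreal (volume_density M c x) \<partial>lborel)
    = (\<integral>\<^sup>+y\<in>transition c d ` ?S. ennreal (volume_density M d y) \<partial>lborel)"
  proof (rule nn_integral_change_of_variables[where g' = "\<lambda>x v. dir_deriv v (transition c d) x"])
    show "?S \<in> sets borel" using c A(1,2) by (rule chart_image_borel)
    show "inj_on (transition c d) ?S" using P.inj_on_T SV by (rule inj_on_subset)
    show "(\<lambda>y. volume_density M d y * indicator (transition c d ` ?S) y) \<in> borel_measurable borel"
      unfolding TS using A chart_image_borel[OF d] by (intro vd_borel_subset d) auto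
    show "(\<lambda>x. volume_density M c x * indicator ?S x) \<in> borel_measurable borel"
      using A chart_image_borel[OF c] by (intro vd_borel_subset c) auto
    show "0 \<le> volume_density M d y" if "y \<in> transition c d ` ?S" for y
    proof -
      have "y \<in> cimg d" using that A(3) unfolding TS by blast
      then show ?thesis using P.D.vd_pos[of y] by simp
    qed
    fix x assume "x \<in> ?S"
    then have x: "x \<in> P.V" using SV by blast
    show "(transition c d has_derivative (\<lambda>v. dir_deriv v (transition c d) x)) (at x within ?S)"
      by (rule has_derivative_at_withinI[OF dir_deriv_works[OF smooth_on_differentiable[OF P.smooth_T x]]])
    have "matrix (\<lambda>v. dir_deriv v (transition c d) x) = P.Jm x"
      by (simp add: matrix_def P.Jm_def)
    then show "volume_density M c x = \<bar>det (matrix (\<lambda>v. dir_deriv v (transition c d) x))\<bar> * volume_density M d (transition c d x)"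
      using P.det_metric_T[OF x] by simp
  qed
  then show ?thesis unfolding chart_vol_def TS .
qed

text \<open>The condition inside the definite description of \<open>riemannian_volume\<close>, named
  so that unique existence can be stated.\<close>

definition volume_spec :: "'a measure \<Rightarrow> bool" where
  "volume_spec \<nu> \<longleftrightarrow> space \<nu> = X \<and> sets \<nu> = borelM \<and>
       (\<forall>c\<in>atlas M. \<forall>B\<in>sets \<nu>. B \<subseteq> chart_dom c \<longrightarrow> emeasure \<nu> B = chart_vol c B)"

text \<open>Second countability makes the manifold a Lindelof space, hence countably many chart
  domains cover it. Nonemptiness allows an enumeration by all natural numbers.\<close>

lemma countable_atlas:
  assumes "X \<noteq> {}"
  obtains C where "\<And>n::nat. C n \<in> atlas M" "(\<Union>n. chart_dom (C n)) = X"
proof -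
  have sc: "second_countable (mtop M)"
    using smooth_mfd unfolding smooth_manifold_def by (elim conjE)
  have cov: "(\<Union>c\<in>atlas M. chart_dom c) = X"
    using smooth_mfd unfolding smooth_manifold_def by (elim conjE)
  have "\<exists>V. countable V \<and> V \<subseteq> chart_dom ` atlas M \<and> \<Union>V = X"
  proof (rule Lindelof_spaceD)
    show "Lindelof_space (mtop M)" using sc by (rule second_countable_imp_Lindelof_space)
    show "\<Union> (chart_dom ` atlas M) = X" by (rule cov)
    fix U assume "U \<in> chart_dom ` atlas M"
    then obtain c where "c \<in> atlas M" "U = chart_dom c" by (rule imageE)
    then show "openin (mtop M) U" by (simp only: openin_chart_dom)
  qed
  then obtain V where V: "countable V" "V \<subseteq> chart_dom ` atlas M" "\<Union>V = X" by (elim exE conjE)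
  have "V \<noteq> {}" using assms V(3) by (metis Union_empty)
  then have rg: "range (from_nat_into V) = V" using V(1) by (rule range_from_nat_into)
  have in_V: "from_nat_into V n \<in> chart_dom ` atlas M" for n
    by (rule subsetD[OF V(2)], rule subsetD[OF equalityD1[OF rg]]) (rule rangeI)
  define C where "C n = inv_into (atlas M) chart_dom (from_nat_into V n)" for n
  have C: "C n \<in> atlas M" for n unfolding C_def using in_V by (rule inv_into_into)
  have dom: "chart_dom (C n) = from_nat_into V n" for n unfolding C_def using in_V by (rule f_inv_into_f)
  have "(\<Union>n. chart_dom (C n)) = X" by (simp only: dom rg V(3))
  then show ?thesis by (rule that[OF C])
qed

text \<open>Monotone convergence for the counting measure.\<close>

lemma suminf_swap_ennreal: "(\<Sum>i. \<Sum>n. f i n) = (\<Sum>n. \<Sum>i. f i n :: ennreal)" for f :: "nat \<Rightarrow> nat \<Rightarrow> ennreal"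
proof -
  have "(\<Sum>i. \<Sum>n. f i n) = (\<integral>\<^sup>+i. (\<Sum>n. f i n) \<partial>count_space UNIV)"
    by (simp add: nn_integral_count_space_nat)
  also have "\<dots> = (\<Sum>n. \<integral>\<^sup>+i. f i n \<partial>count_space UNIV)"
    by (rule nn_integral_suminf) simp
  finally show ?thesis by (simp add: nn_integral_count_space_nat)
qed

text \<open>The space is cut into countably many disjoint Borel pieces \<open>D n\<close>, each
  inside one chart. Adding the chart volumes of the pieces defines a measure, and countable
  additivity leaves no other choice.\<close>

lemma volume_exists_unique:
  assumes "X \<noteq> {}"
  shows "\<exists>!\<nu>. volume_spec \<nu>"
proof -
  obtain C where C: "\<And>n::nat. C n \<in> atlas M" "(\<Union>n. chart_dom (C n)) = X"
    using countable_atlas[OF assms] by blast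
  interpret sigma_algebra X borelM by (rule sigma_borelM)
  define D where "D = disjointed (\<lambda>n. chart_dom (C n))"
  have Ddom: "D n \<subseteq> chart_dom (C n)" for n unfolding D_def by (rule disjointed_subset)
  have "range (\<lambda>n. chart_dom (C n)) \<subseteq> borelM"
    using borelM_open[OF openin_chart_dom[OF C(1)]] by blast
  from range_disjointed_sets[OF this] have D: "D n \<in> borelM" for n unfolding D_def by blast
  have DX: "(\<Union>n. D n) = X" unfolding D_def UN_disjointed_eq by (rule C(2))
  have Ddisj: "disjoint_family D" unfolding D_def by (rule disjoint_family_disjointed)
  have ADU: "(\<Union>n. A \<inter> D n) = A" if "A \<in> borelM" for A
    using DX borelM_subset[OF that] by blast
  have ADdisj: "disjoint_family (\<lambda>n. A \<inter> D n)" for A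
    using Ddisj unfolding disjoint_family_on_def by blast
  define v where "v A = (\<Sum>n. chart_vol (C n) (A \<inter> D n))" for A
  have "positive borelM v" by (simp add: positive_def v_def chart_vol_def)
  moreover have "countably_additive borelM v"
    unfolding countably_additive_def
  proof (intro allI impI)
    fix A :: "nat \<Rightarrow> 'a set" assume A: "range A \<subseteq> borelM" "disjoint_family A"
    have "(\<Sum>i. v (A i)) = (\<Sum>n. \<Sum>i. chart_vol (C n) (A i \<inter> D n))"
      unfolding v_def by (rule suminf_swap_ennreal)
    also have "\<dots> = (\<Sum>n. chart_vol (C n) (\<Union>i. A i \<inter> D n))"
    proof (rule suminf_cong, rule chart_vol_suminf[OF C(1)])
      fix n i
      show "A i \<inter> D n \<in> borelM" using A(1) D by (intro borelM_Int) auto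
      show "A i \<inter> D n \<subseteq> chart_dom (C n)" using Ddom by blast
      show "disjoint_family (\<lambda>i. A i \<inter> D n)" using A(2) unfolding disjoint_family_on_def by blast
    qed
    also have "\<dots> = v (\<Union>i. A i)" unfolding v_def by (simp only: UN_extend_simps)
    finally show "(\<Sum>i. v (A i)) = v (\<Union>i. A i)" .
  qed
  ultimately have v: "emeasure (measure_of X borelM v) A = v A" if "A \<in> borelM" for A
    using emeasure_measure_of_sigma[OF sigma_borelM] that by blast
  \<comment> \<open>Each piece of \<open>A\<close> lies both in its own chart and in
    \<open>c\<close>, so it can be measured in \<open>c\<close>; then additivity inside
    \<open>c\<close> reassembles \<open>A\<close>.\<close>
  have val: "v A = chart_vol c A" if c: "c \<in> atlas M" and A: "A \<in> borelM" "A \<subseteq> chart_dom c" for c A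
  proof -
    have "v A = (\<Sum>n. chart_vol c (A \<inter> D n))"
      unfolding v_def using A D Ddom by (intro suminf_cong chart_vol_independent C c borelM_Int) blast+
    also have "\<dots> = chart_vol c (\<Union>n. A \<inter> D n)"
      using A D by (intro chart_vol_suminf c ADdisj borelM_Int) blast+
    finally show ?thesis by (simp only: ADU[OF A(1)])
  qed
  have "space (measure_of X borelM v) = X" "sets (measure_of X borelM v) = borelM"
    using space_closed by (auto simp: sigma_sets_eq space_measure_of)
  then have ex: "volume_spec (measure_of X borelM v)"
    unfolding volume_spec_def using v val by simp
  have det: "emeasure \<nu> A = v A" if \<nu>: "volume_spec \<nu>" and A: "A \<in> borelM" for \<nu> A
  proof -
    have "emeasure \<nu> (\<Union>n. A \<inter> D n) = (\<Sum>n. emeasure \<nu> (A \<inter> D n))"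
      using \<nu> A D by (intro suminf_emeasure[symmetric] ADdisj) (auto simp: volume_spec_def intro!: borelM_Int)
    also have "\<dots> = v A"
      unfolding v_def
    proof (rule suminf_cong)
      fix n
      have "A \<inter> D n \<in> sets \<nu>" "A \<inter> D n \<subseteq> chart_dom (C n)"
        using \<nu> borelM_Int[OF A D] Ddom by (auto simp: volume_spec_def)
      then show "emeasure \<nu> (A \<inter> D n) = chart_vol (C n) (A \<inter> D n)"
        using \<nu> C(1) unfolding volume_spec_def by blast
    qed
    finally show ?thesis by (simp only: ADU[OF A])
  qed
  show ?thesis
  proof (rule ex1I[where P = volume_spec, OF ex])
    fix \<nu> assume \<nu>: "volume_spec \<nu>"
    show "\<nu> = measure_of X borelM v"
    proof (rule measure_eqI)
      show "sets \<nu> = sets (measure_of X borelM v)" using \<nu> ex by (simp add: volume_spec_def)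
      show "emeasure \<nu> A = emeasure (measure_of X borelM v) A" if "A \<in> sets \<nu>" for A
        using that \<nu> det[OF \<nu>] det[OF ex] by (simp add: volume_spec_def)
    qed
  qed
qed

lemma volume_spec_riemannian_volume:
  assumes "X \<noteq> {}" shows "volume_spec (riemannian_volume M)"
proof -
  have "riemannian_volume M = (THE \<nu>. volume_spec \<nu>)"
    unfolding riemannian_volume_def volume_spec_def chart_vol_def ..
  then show ?thesis using theI'[OF volume_exists_unique[OF assms]] by simp
qed

lemma compact_borelM: "compactin (mtop M) K \<Longrightarrow> K \<in> borelM"
proof -
  assume K: "compactin (mtop M) K"
  have "Hausdorff_space (mtop M)" using smooth_mfd by (simp add: smooth_manifold_def)
  then have "closedin (mtop M) K" using K by (rule compactin_imp_closedin)
  then have "openin (mtop M) (X - K)" "K \<subseteq> X" by (auto simp: closedin_def)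
  then have "X - (X - K) \<in> borelM" by (intro sigma_sets.Compl borelM_open)
  then show ?thesis using \<open>K \<subseteq> X\<close> by (simp add: double_diff)
qed

lemma compactin_chart:
  assumes c: "c \<in> atlas M" and Q: "compact Q" "Q \<subseteq> cimg c"
  shows "compactin (mtop M) (chart_inv c ` Q)"
  by (rule image_compactin[OF _ continuous_chart_inv[OF c]]) (simp add: compactin_subtopology Q)

text \<open>The volume restricted to \<open>K\<close> is the image of a weighted Lebesgue measure
  under the inverse chart. Off the image of \<open>K\<close> the map takes some fixed point of
  \<open>X\<close>, which makes it a map into the space of the measure; the weight vanishes there,
  so that point receives no mass.\<close>

lemma volume_density_chart:
  assumes c: "c \<in> atlas M" and X: "X \<noteq> {}" and K: "K \<in> borelM" "K \<subseteq> chart_dom c"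
  shows "density (riemannian_volume M) (\<lambda>p. ennreal (indicator K p)) = distr
     (density lborel (\<lambda>x. ennreal (volume_density M c x * indicator (chart_map c ` K) x)))
     (riemannian_volume M) (\<lambda>x. if x \<in> chart_map c ` K then chart_inv c x else (SOME p. p \<in> X))"
    (is "?L = distr ?N ?R ?f")
    and "(\<lambda>x. if x \<in> chart_map c ` K then chart_inv c x else (SOME p. p \<in> X)) \<in> measurable lborel (riemannian_volume M)"
proof -
  have vs: "space ?R = X" "sets ?R = borelM" "\<And>B. B \<in> borelM \<Longrightarrow> B \<subseteq> chart_dom c \<Longrightarrow> emeasure ?R B = chart_vol c B"
    using volume_spec_riemannian_volume[OF X] c unfolding volume_spec_def by blast+
  have p0: "(SOME p. p \<in> X) \<in> X" using X by (simp add: some_in_eq)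
  have cK: "chart_map c ` K \<in> sets borel" using c K by (rule chart_image_borel)
  have pre: "?f -` A = (chart_map c ` (A \<inter> K)) \<union> (if (SOME p. p \<in> X) \<in> A then - (chart_map c ` K) else {})" for A
  proof -
    have "chart_inv c (chart_map c p) = p" if "p \<in> K" for p using c K(2) that by (intro chart_inv_left) auto
    note inv = this
    show ?thesis
    proof (rule set_eqI)
      fix x
      show "x \<in> ?f -` A \<longleftrightarrow> x \<in> (chart_map c ` (A \<inter> K)) \<union> (if (SOME p. p \<in> X) \<in> A then - (chart_map c ` K) else {})"
      proof (cases "x \<in> chart_map c ` K")
        case True
        then obtain p where p: "p \<in> K" "x = chart_map c p" by blast
        have "x \<in> chart_map c ` (A \<inter> K) \<longleftrightarrow> p \<in> A"
        proof
          assume "x \<in> chart_map c ` (A \<inter> K)"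
          then obtain q where q: "q \<in> A" "q \<in> K" "x = chart_map c q" by blast
          have "q = p" using inv[OF q(2)] inv[OF p(1)] q(3) p(2) by simp
          with q show "p \<in> A" by simp
        qed (use p in blast)
        then show ?thesis using True p inv[OF p(1)] by simp
      next
        case False
        then have "x \<notin> chart_map c ` (A \<inter> K)" by blast
        then show ?thesis using False by simp
      qed
    qed
  qed
  show meas: "?f \<in> measurable lborel ?R"
  proof (rule measurableI)
    show "?f x \<in> space ?R" for x
    proof (cases "x \<in> chart_map c ` K")
      case True
      then have "x \<in> cimg c" using K(2) by blast
      then have "chart_inv c x \<in> X" by (rule subsetD[OF chart_dom_subset[OF c] chart_inv_in])
      then show ?thesis using True vs(1) by simp
    qed (use p0 vs(1) in simp)
    fix A assume "A \<in> sets ?R"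
    then have "A \<in> borelM" using vs by simp
    then have "A \<inter> K \<in> borelM" using K by (intro borelM_Int)
    then have "chart_map c ` (A \<inter> K) \<in> sets borel" using c K by (intro chart_image_borel) auto
    then show "?f -` A \<inter> space lborel \<in> sets lborel" unfolding pre using cK by auto
  qed
  show "?L = distr ?N ?R ?f"
  proof (rule measure_eqI)
    fix A assume "A \<in> sets ?L"
    then have A: "A \<in> borelM" using vs by simp
    have AK: "A \<inter> K \<in> borelM" "A \<inter> K \<subseteq> chart_dom c" using A K by (auto intro: borelM_Int)
    have "(\<lambda>p. ennreal (indicator K p)) \<in> borel_measurable ?R"
      by (rule measurable_compose[OF borel_measurable_indicator measurable_ennreal]) (use K vs in simp)
    then have "emeasure ?L A = (\<integral>\<^sup>+p. ennreal (indicator K p) * indicator A p \<partial>?R)"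
      by (rule emeasure_density) (use A vs in simp)
    also have "\<dots> = (\<integral>\<^sup>+p. indicator (A \<inter> K) p \<partial>?R)"
      by (rule nn_integral_cong) (auto simp: indicator_def)
    also have "\<dots> = emeasure ?R (A \<inter> K)" using AK vs by (intro nn_integral_indicator) simp
    also have "\<dots> = chart_vol c (A \<inter> K)" using AK vs by blast
    also have "\<dots> = (\<integral>\<^sup>+x. ennreal (volume_density M c x * indicator (chart_map c ` K) x) * indicator (?f -` A) x \<partial>lborel)"
      unfolding chart_vol_def
    proof (rule nn_integral_cong)
      fix x
      have "x \<in> ?f -` A \<longleftrightarrow> x \<in> chart_map c ` (A \<inter> K)" if "x \<in> chart_map c ` K"
        using that unfolding pre by (auto split: if_splits)
      moreover have "x \<in> chart_map c ` (A \<inter> K) \<Longrightarrow> x \<in> chart_map c ` K" by blast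
      ultimately show "ennreal (volume_density M c x) * indicator (chart_map c ` (A \<inter> K)) x
        = ennreal (volume_density M c x * indicator (chart_map c ` K) x) * indicator (?f -` A) x"
        by (cases "x \<in> chart_map c ` K") (auto simp: indicator_def)
    qed
    also have "\<dots> = emeasure ?N (?f -` A \<inter> space ?N)"
      using vd_borel_subset[OF c cK image_mono[OF K(2)]] measurable_sets[OF meas, of A] A vs
      by (subst emeasure_density) auto
    also have "\<dots> = emeasure (distr ?N ?R ?f) A"
      using meas A vs by (subst emeasure_distr) auto
    finally show "emeasure ?L A = emeasure (distr ?N ?R ?f) A" .
  qed simp
qed

lemma volume_integral_cbox:
  fixes h :: "real^'m::{finite,wellorder} \<Rightarrow> real"
  assumes c: "c \<in> atlas M" and X: "X \<noteq> {}" and Q: "cbox a b \<subseteq> cimg c"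
    and h: "continuous_on (cimg c) h" and f: "\<And>x. x \<in> cbox a b \<Longrightarrow> f (chart_inv c x) = h x"
  shows "(LINT p:chart_inv c ` cbox a b|riemannian_volume M. f p)
    = integral (cbox a b) (\<lambda>x. volume_density M c x * h x)"
proof -
  let ?K = "chart_inv c ` cbox a b" and ?R = "riemannian_volume M"
  interpret C: riem_chart M c "cimg c" by (rule riem_chart[OF c])
  have cinv: "chart_map c (chart_inv c x) = x" if "x \<in> cbox a b" for x
    using Q that by (intro chart_inv_right) auto
  have cK: "chart_map c ` ?K = cbox a b"
    unfolding image_image using cinv by simp
  have K: "?K \<in> borelM" "?K \<subseteq> chart_dom c"
    using compact_borelM[OF compactin_chart[OF c compact_cbox Q]] subsetD[OF Q, THEN chart_inv_in]
    by (simp_all add: image_subset_iff)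
  have vs: "space ?R = X" "sets ?R = borelM"
    using volume_spec_riemannian_volume[OF X] unfolding volume_spec_def by blast+
  define p0 where "p0 = (SOME p. p \<in> X)"
  define F where "F = (\<lambda>x. if x \<in> cbox a b then chart_inv c x else p0)"
  note vc = volume_density_chart[OF c X K, unfolded cK, folded p0_def, folded F_def]
  \<comment> \<open>Nothing is known about \<open>f\<close> outside \<open>?K\<close>, not even
    measurability. \<open>g\<close> agrees with it on \<open>?K\<close> and is measurable on the
    whole space.\<close>
  define g where "g p = indicator ?K p *\<^sub>R h (chart_map c p)" for p
  have g: "g \<in> borel_measurable ?R"
  proof (rule measurableI)
    fix S :: "real set" assume S: "S \<in> sets borel"
    have "(\<lambda>x. indicator (cbox a b) x *\<^sub>R h x) \<in> borel_measurable borel"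
      using continuous_on_subset[OF h Q] by (intro borel_measurable_continuous_on_indicator) auto
    from measurable_sets[OF this S]
    have "(\<lambda>x. indicator (cbox a b) x *\<^sub>R h x) -` S \<in> sets borel" by simp
    then have 1: "{p \<in> chart_dom c. chart_map c p \<in> (\<lambda>x. indicator (cbox a b) x *\<^sub>R h x) -` S} \<in> borelM"
      by (rule chart_preimage_borelM[OF c])
    interpret sigma_algebra X borelM by (rule sigma_borelM)
    have "g -` S \<inter> space ?R = (?K \<inter> {p \<in> chart_dom c. chart_map c p \<in> (\<lambda>x. indicator (cbox a b) x *\<^sub>R h x) -` S})
      \<union> (if 0 \<in> S then X - ?K else {})"
    proof (rule set_eqI)
      fix p
      show "p \<in> g -` S \<inter> space ?R \<longleftrightarrow> p \<in> (?K \<inter> {p \<in> chart_dom c. chart_map c p \<in> (\<lambda>x. indicator (cbox a b) x *\<^sub>R h x) -` S})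
        \<union> (if 0 \<in> S then X - ?K else {})"
      proof (cases "p \<in> ?K")
        case True
        then obtain x where x: "x \<in> cbox a b" "p = chart_inv c x" by blast
        have "p \<in> chart_dom c" "p \<in> X" using True K(2) borelM_subset[OF K(1)] by blast+
        moreover have "chart_map c p = x" using cinv[OF x(1)] x(2) by simp
        ultimately show ?thesis using True x(1) by (simp add: g_def vs)
      next
        case False
        then show ?thesis by (simp add: g_def vs)
      qed
    qed
    then show "g -` S \<inter> space ?R \<in> sets ?R"
      unfolding vs using borelM_Int[OF K(1) 1] K(1) by (cases "0 \<in> S") (simp_all only: if_True if_False Un compl_sets empty_sets simp_thms)
  qed simp
  have Kind: "(indicator ?K :: 'a \<Rightarrow> real) \<in> borel_measurable ?R"
    by (rule borel_measurable_indicator) (use K vs in simp)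
  have vdb: "(\<lambda>x. volume_density M c x * indicator (cbox a b) x) \<in> borel_measurable borel"
    by (rule vd_borel_subset[OF c _ Q]) simp
  have vd0: "0 \<le> volume_density M c x * indicator (cbox a b) x" for x
    using C.vd_pos[of x] Q by (cases "x \<in> cbox a b") auto
  have "(LINT p:?K|?R. f p) = (LINT p|?R. indicator ?K p *\<^sub>R g p)"
    unfolding set_lebesgue_integral_def
    by (rule arg_cong[of _ _ "integral\<^sup>L ?R"]) (auto simp: fun_eq_iff g_def indicator_def f cinv)
  also have "\<dots> = (LINT p|density ?R (\<lambda>p. ennreal (indicator ?K p)). g p)"
    by (rule integral_density[symmetric, OF g Kind]) auto
  also have "\<dots> = (LINT x|density lborel (\<lambda>x. ennreal (volume_density M c x * indicator (cbox a b) x)). g (F x))"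
    unfolding vc(1) using vc(2) g by (intro integral_distr) auto
  also have "\<dots> = (LINT x|lborel. (volume_density M c x * indicator (cbox a b) x) *\<^sub>R g (F x))"
    using vc(2) g vdb vd0 by (intro integral_density) (auto intro: measurable_compose)
  also have "\<dots> = (LINT x:cbox a b|lborel. volume_density M c x * h x)"
    unfolding set_lebesgue_integral_def
    by (rule arg_cong[of _ _ "integral\<^sup>L lborel"]) (auto simp: fun_eq_iff g_def F_def indicator_def cinv)
  also have "\<dots> = integral (cbox a b) (\<lambda>x. volume_density M c x * h x)"
  proof (rule set_borel_integral_eq_integral(2))
    have "continuous_on (cbox a b) (\<lambda>x. volume_density M c x * h x)"
      using smooth_on_continuous_on[OF C.smooth_vd] h Q
      by (intro continuous_on_mult) (auto intro: continuous_on_subset)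
    then show "set_integrable lborel (cbox a b) (\<lambda>x. volume_density M c x * h x)"
      unfolding set_integrable_def by (intro borel_integrable_compact compact_cbox)
  qed
  finally show ?thesis .
qed

end

section \<open>Integration by parts\<close>

lemma integral_eq_integral_UNIV:
  fixes f :: "'a::euclidean_space \<Rightarrow> 'b::banach"
  assumes "\<And>x. x \<notin> S \<Longrightarrow> f x = 0"
  shows "integral S f = integral UNIV f"
proof -
  have "(\<lambda>x. if x \<in> S then f x else 0) = f" using assms by auto
  then show ?thesis using integral_restrict_UNIV[of S f] by simp
qed

lemma dir_deriv_zero_outside:
  assumes "\<And>x. x \<in> V \<Longrightarrow> x \<notin> cball x0 r \<Longrightarrow> F x = 0" "open V" "x \<in> V" "x \<notin> cball x0 r"
  shows "dir_deriv e F x = 0"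
proof -
  have "dir_deriv e F x = dir_deriv e (\<lambda>x. 0) x"
    by (rule dir_deriv_cong_open[of "V - cball x0 r"]) (use assms in \<open>auto simp: open_Diff\<close>)
  then show ?thesis by simp
qed

text \<open>By translation invariance \<open>s \<mapsto> \<integral> F(x + s e) dx\<close> is constant, and its derivative at \<open>0\<close> is the
  integral of the derivative of \<open>F\<close>.\<close>

lemma integral_dir_deriv_eq_0:
  fixes F :: "'v::euclidean_space \<Rightarrow> real"
  assumes F: "smooth_on UNIV F" and supp: "\<And>x. x \<notin> cball x0 r \<Longrightarrow> F x = 0" and sub: "cball x0 r \<subseteq> cbox a b"
  shows "integral (cbox a b) (dir_deriv e F) = 0"
proof -
  \<comment> \<open>One box that contains the supports of all translates by
    \<open>s *\<^sub>R e\<close> with \<open>\<bar>s\<bar> \<le> 1\<close>, so that the domain of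
    integration does not move with \<open>s\<close>.\<close>
  obtain c where c: "cball x0 (r + norm e) \<subseteq> cbox (- c) c"
    using bounded_subset_cbox_symmetric[OF bounded_cball] by blast
  define Q where "Q = cbox (- c) c"
  have dF: "F differentiable (at x)" for x using F by (auto intro: smooth_on_differentiable)
  have cF: "continuous_on UNIV F" and cdF: "continuous_on UNIV (dir_deriv e F)"
    using F by (auto intro: smooth_on_continuous_on smooth_on_dir_deriv)
  have const: "integral Q (\<lambda>x. F (x + s *\<^sub>R e)) = integral UNIV F" if s: "\<bar>s\<bar> \<le> 1" for s
  proof -
    have "F (x + s *\<^sub>R e) = 0" if "x \<notin> Q" for x
    proof (rule supp)
      have "x \<notin> cball x0 (r + norm e)" using that c unfolding Q_def by blast
      then have "r + norm e < dist x0 x" by simp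
      also have "dist x0 x \<le> dist x0 (x + s *\<^sub>R e) + dist (x + s *\<^sub>R e) x" by (rule dist_triangle)
      also have "dist (x + s *\<^sub>R e) x \<le> norm e" using s by (simp add: dist_norm mult_left_le_one_le)
      finally show "x + s *\<^sub>R e \<notin> cball x0 r" by simp
    qed
    then have "integral Q (\<lambda>x. F (x + s *\<^sub>R e)) = integral UNIV (\<lambda>x. F (x + s *\<^sub>R e))"
      by (rule integral_eq_integral_UNIV)
    also have "\<dots> = integral (cbox (a - s *\<^sub>R e) (b - s *\<^sub>R e)) (\<lambda>x. F (x + s *\<^sub>R e))"
    proof (rule integral_eq_integral_UNIV[symmetric], rule supp)
      fix x assume "x \<notin> cbox (a - s *\<^sub>R e) (b - s *\<^sub>R e)"
      then have "x + s *\<^sub>R e \<notin> cbox a b" by (auto simp: mem_box algebra_simps)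
      then show "x + s *\<^sub>R e \<notin> cball x0 r" using sub by blast
    qed
    also have "\<dots> = integral (cbox a b) F" by (rule integral_shift_cbox)
    also have "\<dots> = integral UNIV F" using supp sub by (intro integral_eq_integral_UNIV) blast
    finally show ?thesis .
  qed
  have "((\<lambda>s. integral (cbox (- c) c) (\<lambda>x. F (x + s *\<^sub>R e))) has_field_derivative
      integral (cbox (- c) c) (\<lambda>x. dir_deriv e F (x + 0 *\<^sub>R e))) (at 0 within UNIV)"
  proof (rule leibniz_rule_field_derivative)
    show "((\<lambda>s. F (x + s *\<^sub>R e)) has_real_derivative dir_deriv e F (x + s *\<^sub>R e)) (at s within UNIV)" for s x
      using dir_deriv_line[OF dF] by simp
    show "(\<lambda>x. F (x + s *\<^sub>R e)) integrable_on cbox (- c) c" for s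
      by (intro integrable_continuous continuous_on_compose2[OF cF]) (auto intro!: continuous_intros)
    show "continuous_on (UNIV \<times> cbox (- c) c) (\<lambda>(s, x). dir_deriv e F (x + s *\<^sub>R e))"
      unfolding case_prod_beta by (intro continuous_on_compose2[OF cdF]) (auto intro!: continuous_intros)
  qed auto
  then have 1: "((\<lambda>s. integral Q (\<lambda>x. F (x + s *\<^sub>R e))) has_real_derivative integral Q (dir_deriv e F)) (at 0)"
    by (simp add: Q_def)
  have "((\<lambda>s::real. integral UNIV F) has_real_derivative 0) (at 0)" by simp
  then have 2: "((\<lambda>s. integral Q (\<lambda>x. F (x + s *\<^sub>R e))) has_real_derivative 0) (at 0)"
    by (rule has_field_derivative_transform_within[where d = 1]) (auto simp: const)
  have "integral Q (dir_deriv e F) = 0" using DERIV_unique[OF 1 2] .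
  moreover have 3: "dir_deriv e F x = 0" if "x \<notin> cball x0 r" for x
    using dir_deriv_zero_outside[of UNIV x0 r F x e] supp that by simp
  have "integral Q (dir_deriv e F) = integral (cbox a b) (dir_deriv e F)"
  proof -
    have "cball x0 r \<subseteq> Q"
      using order_trans[OF subset_cball[of r "r + norm e" x0] c] by (simp add: Q_def)
    then have "integral Q (dir_deriv e F) = integral UNIV (dir_deriv e F)"
      using 3 by (intro integral_eq_integral_UNIV) blast
    also have "\<dots> = integral (cbox a b) (dir_deriv e F)"
      using 3 sub by (intro integral_eq_integral_UNIV[symmetric]) blast
    finally show ?thesis .
  qed
  ultimately show ?thesis by simp
qed

text \<open>The space is covered by \<open>V\<close> and the open complement of the closed ball; on
  the latter the extension is identically zero.\<close>

lemma smooth_on_zero_extension: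
  assumes V: "open V" "cball x0 r \<subseteq> V" and F: "smooth_on V F" "\<And>x. x \<in> V \<Longrightarrow> x \<notin> cball x0 r \<Longrightarrow> F x = 0"
  shows "smooth_on UNIV (\<lambda>x. if x \<in> V then F x else 0)"
proof (rule smooth_on_local)
  fix x
  show "\<exists>W. x \<in> W \<and> smooth_on W (\<lambda>x. if x \<in> V then F x else 0)"
  proof (cases "x \<in> V")
    case True
    have "smooth_on V (\<lambda>x. if x \<in> V then F x else 0)"
      by (rule smooth_on_cong[OF V(1) _ F(1)]) simp
    then show ?thesis using True by blast
  next
    case False
    have "smooth_on (- cball x0 r) (\<lambda>x. if x \<in> V then F x else 0)"
      by (rule smooth_on_cong[OF _ _ smooth_on_const[of _ 0]]) (use F(2) in auto)
    then show ?thesis using False V(2) by (intro exI[of _ "- cball x0 r"]) auto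
  qed
qed

text \<open>Every summand, extended by zero, is a directional derivative of a smooth function
  supported in the ball, and such derivatives integrate to zero.\<close>

lemma integral_divergence_eq_0:
  fixes F :: "'m::finite \<Rightarrow> real^'m \<Rightarrow> real"
  assumes V: "open V" "cball x0 r \<subseteq> cbox a b" "cbox a b \<subseteq> V"
    and F: "\<And>i. smooth_on V (F i)" "\<And>i x. x \<in> V \<Longrightarrow> x \<notin> cball x0 r \<Longrightarrow> F i x = 0"
  shows "integral (cbox a b) (\<lambda>x. \<Sum>i\<in>UNIV. partial i (F i) x) = 0"
proof -
  have int: "partial i (F i) integrable_on cbox a b" for i
    using smooth_on_continuous_on[OF smooth_on_dir_deriv[OF F(1)]] V(3)
    by (intro integrable_continuous) (rule continuous_on_subset)
  have "integral (cbox a b) (partial i (F i)) = 0" for i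
  proof -
    let ?G = "\<lambda>x. if x \<in> V then F i x else 0"
    have "integral (cbox a b) (partial i ?G) = 0"
      using V F by (intro integral_dir_deriv_eq_0[of _ x0 r] smooth_on_zero_extension) auto
    moreover have "partial i ?G x = partial i (F i) x" if "x \<in> V" for x
      by (rule dir_deriv_cong_open[OF V(1) that]) simp
    then have "integral (cbox a b) (partial i ?G) = integral (cbox a b) (partial i (F i))"
      using V(3) by (intro Henstock_Kurzweil_Integration.integral_cong) blast
    ultimately show ?thesis by simp
  qed
  then show ?thesis by (simp add: integral_sum int)
qed

section \<open>Green's formulas in a coordinate domain\<close>

context riem_chart begin

lemma smooth_flux: "smooth_on V u \<Longrightarrow> smooth_on V (\<lambda>y. vd y * (\<Sum>j\<in>UNIV. a i j y * partial j u y))"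
  for u :: "real^'m \<Rightarrow> real"
  by (intro smooth_intros smooth_vd smooth_a open_V)

lemma grad_inner_sym:
  "x \<in> V \<Longrightarrow> grad_inner M c u v x = grad_inner M c v u x"
  unfolding grad_inner_def metric_trace_def
  by (subst sum.swap) (intro sum.cong refl, simp add: a_sym inner_commute)

lemma integrable_cbox: "cbox p q \<subseteq> V \<Longrightarrow> smooth_on V f \<Longrightarrow> f integrable_on cbox p q"
  for f :: "real^'m \<Rightarrow> real"
  by (intro integrable_continuous continuous_on_subset[OF smooth_on_continuous_on])

text \<open>The fluxes of \<open>h\<close> times the gradient of \<open>u\<close>, and of
  \<open>u\<close> times the gradient of \<open>h\<close>, both have zero total divergence. Support
  in the ball is required of \<open>h\<close> alone, since its derivatives vanish off the closed
  ball too. The first flux gives the first formula, and comparing both gives the second.\<close>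

lemma green_real:
  fixes u h :: "real^'m \<Rightarrow> real"
  assumes Q: "cball x0 r \<subseteq> cbox p q" "cbox p q \<subseteq> V" and u: "smooth_on V u" and h: "smooth_on V h"
    and supp: "\<And>x. x \<in> V \<Longrightarrow> x \<notin> cball x0 r \<Longrightarrow> h x = 0"
  shows "integral (cbox p q) (\<lambda>x. vd x * grad_inner M c u h x) = - integral (cbox p q) (\<lambda>x. vd x * (lap M c u x * h x))"
    and "integral (cbox p q) (\<lambda>x. vd x * (u x * lap M c h x)) = integral (cbox p q) (\<lambda>x. vd x * (lap M c u x * h x))"
proof -
  let ?I = "integral (cbox p q)"
  have sm: "smooth_on V (\<lambda>x. vd x * grad_inner M c u h x)" "smooth_on V (\<lambda>x. vd x * (h x * lap M c u x))"
    "smooth_on V (\<lambda>x. vd x * (u x * lap M c h x))"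
    by (intro smooth_intros open_V smooth_vd smooth_grad_inner smooth_lap u h)+
  note int = this[THEN integrable_cbox[OF Q(2)]]
  have "?I (\<lambda>x. \<Sum>i\<in>UNIV. partial i (\<lambda>y. h y * (vd y * (\<Sum>j\<in>UNIV. a i j y * partial j u y))) x) = 0"
    by (rule integral_divergence_eq_0[OF open_V Q])
      (auto simp: supp intro!: smooth_on_mult open_V h smooth_flux u)
  also have "?I (\<lambda>x. \<Sum>i\<in>UNIV. partial i (\<lambda>y. h y * (vd y * (\<Sum>j\<in>UNIV. a i j y * partial j u y))) x)
    = ?I (\<lambda>x. vd x * (h x * lap M c u x) + vd x * grad_inner M c u h x)"
    using Q(2) by (intro Henstock_Kurzweil_Integration.integral_cong)
      (auto simp: green_pointwise[OF _ u h] grad_inner_sym[of _ h u])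
  also have "\<dots> = ?I (\<lambda>x. vd x * (h x * lap M c u x)) + ?I (\<lambda>x. vd x * grad_inner M c u h x)"
    using int by (intro integral_add) auto
  finally have 1: "?I (\<lambda>x. vd x * (h x * lap M c u x)) + ?I (\<lambda>x. vd x * grad_inner M c u h x) = 0" .
  have ph: "partial j h x = 0" if "x \<in> V" "x \<notin> cball x0 r" for j x
    using dir_deriv_zero_outside[OF supp open_V that] .
  have "?I (\<lambda>x. \<Sum>i\<in>UNIV. partial i (\<lambda>y. u y * (vd y * (\<Sum>j\<in>UNIV. a i j y * partial j h y))) x) = 0"
    by (rule integral_divergence_eq_0[OF open_V Q])
      (auto simp: ph intro!: smooth_on_mult open_V h smooth_flux u)
  also have "?I (\<lambda>x. \<Sum>i\<in>UNIV. partial i (\<lambda>y. u y * (vd y * (\<Sum>j\<in>UNIV. a i j y * partial j h y))) x)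
    = ?I (\<lambda>x. vd x * (u x * lap M c h x) + vd x * grad_inner M c u h x)"
    using Q(2) by (intro Henstock_Kurzweil_Integration.integral_cong)
      (auto simp: green_pointwise[OF _ h u])
  also have "\<dots> = ?I (\<lambda>x. vd x * (u x * lap M c h x)) + ?I (\<lambda>x. vd x * grad_inner M c u h x)"
    using int by (intro integral_add) auto
  finally have 2: "?I (\<lambda>x. vd x * (u x * lap M c h x)) + ?I (\<lambda>x. vd x * grad_inner M c u h x) = 0" .
  show "?I (\<lambda>x. vd x * grad_inner M c u h x) = - ?I (\<lambda>x. vd x * (lap M c u x * h x))"
    using 1 by (simp add: mult.commute)
  show "?I (\<lambda>x. vd x * (u x * lap M c h x)) = ?I (\<lambda>x. vd x * (lap M c u x * h x))"
    using 1 2 by (simp add: mult.commute)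
qed

lemma grad_inner_components:
  fixes u v :: "real^'m \<Rightarrow> 'w::euclidean_space"
  assumes x: "x \<in> V" and u: "smooth_on V u" and v: "smooth_on V v"
  shows "grad_inner M c u v x = (\<Sum>b\<in>Basis. grad_inner M c (\<lambda>y. u y \<bullet> b) (\<lambda>y. v y \<bullet> b) x)"
proof -
  have d: "u differentiable (at x)" "v differentiable (at x)"
    using u v x by (auto intro: smooth_on_differentiable)
  have "grad_inner M c u v x = (\<Sum>i\<in>UNIV. \<Sum>j\<in>UNIV. \<Sum>b\<in>Basis. a i j x * ((partial i u x \<bullet> b) * (partial j v x \<bullet> b)))"
    unfolding grad_inner_def metric_trace_def
    by (subst euclidean_inner) (simp add: sum_distrib_left)
  also have "\<dots> = (\<Sum>b\<in>Basis. \<Sum>i\<in>UNIV. \<Sum>j\<in>UNIV. a i j x * ((partial i u x \<bullet> b) * (partial j v x \<bullet> b)))"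
    by (rule sum_rotate3[symmetric])
  finally show ?thesis
    by (simp add: grad_inner_def metric_trace_def dir_deriv_bounded_linear[OF bounded_linear_inner_left] d)
qed

lemma green_vector:
  fixes u h :: "real^'m \<Rightarrow> 'w::euclidean_space"
  assumes Q: "cball x0 r \<subseteq> cbox p q" "cbox p q \<subseteq> V" and u: "smooth_on V u" and h: "smooth_on V h"
    and supp: "\<And>x. x \<in> V \<Longrightarrow> x \<notin> cball x0 r \<Longrightarrow> h x = 0"
  shows "integral (cbox p q) (\<lambda>x. vd x * grad_inner M c u h x) = - integral (cbox p q) (\<lambda>x. vd x * (lap M c u x \<bullet> h x))"
    and "integral (cbox p q) (\<lambda>x. vd x * (u x \<bullet> lap M c h x)) = integral (cbox p q) (\<lambda>x. vd x * (lap M c u x \<bullet> h x))"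
proof -
  let ?I = "integral (cbox p q)"
  define ub hb where "ub b y = u y \<bullet> b" and "hb b y = h y \<bullet> b" for b y
  have sb: "smooth_on V (ub b)" "smooth_on V (hb b)" for b
    unfolding ub_def[abs_def] hb_def[abs_def] by (intro smooth_intros open_V u h)+
  have lb: "lap M c u x \<bullet> b = lap M c (ub b) x" "lap M c h x \<bullet> b = lap M c (hb b) x" if "x \<in> V" for x b
    unfolding ub_def[abs_def] hb_def[abs_def]
    using lap_bounded_linear[OF bounded_linear_inner_left that u] lap_bounded_linear[OF bounded_linear_inner_left that h]
    by simp_all
  have gb: "grad_inner M c u h x = (\<Sum>b\<in>Basis. grad_inner M c (ub b) (hb b) x)" if "x \<in> V" for x
    unfolding ub_def[abs_def] hb_def[abs_def] by (rule grad_inner_components[OF that u h])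
  have sup: "x \<in> V \<Longrightarrow> x \<notin> cball x0 r \<Longrightarrow> hb b x = 0" for x b using supp by (simp add: hb_def)
  note green = green_real[OF Q sb(1) sb(2) sup]
  have sm: "smooth_on V (\<lambda>x. vd x * grad_inner M c (ub b) (hb b) x)" "smooth_on V (\<lambda>x. vd x * (lap M c (ub b) x * hb b x))"
    "smooth_on V (\<lambda>x. vd x * (ub b x * lap M c (hb b) x))" for b
    by (intro smooth_intros open_V smooth_vd smooth_grad_inner smooth_lap sb)+
  note int = this[THEN integrable_cbox[OF Q(2)]]
  have L: "?I (\<lambda>x. vd x * (lap M c u x \<bullet> h x)) = (\<Sum>b\<in>Basis. ?I (\<lambda>x. vd x * (lap M c (ub b) x * hb b x)))"
  proof -
    have "?I (\<lambda>x. vd x * (lap M c u x \<bullet> h x)) = ?I (\<lambda>x. \<Sum>b\<in>Basis. vd x * (lap M c (ub b) x * hb b x))"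
    proof (rule Henstock_Kurzweil_Integration.integral_cong)
      fix x assume "x \<in> cbox p q"
      then have "x \<in> V" using Q(2) by blast
      then show "vd x * (lap M c u x \<bullet> h x) = (\<Sum>b\<in>Basis. vd x * (lap M c (ub b) x * hb b x))"
        by (subst euclidean_inner) (simp add: lb hb_def sum_distrib_left)
    qed
    then show ?thesis using int by (simp add: integral_sum)
  qed
  have R: "?I (\<lambda>x. vd x * (u x \<bullet> lap M c h x)) = (\<Sum>b\<in>Basis. ?I (\<lambda>x. vd x * (ub b x * lap M c (hb b) x)))"
  proof -
    have "?I (\<lambda>x. vd x * (u x \<bullet> lap M c h x)) = ?I (\<lambda>x. \<Sum>b\<in>Basis. vd x * (ub b x * lap M c (hb b) x))"
    proof (rule Henstock_Kurzweil_Integration.integral_cong)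
      fix x assume "x \<in> cbox p q"
      then have "x \<in> V" using Q(2) by blast
      then show "vd x * (u x \<bullet> lap M c h x) = (\<Sum>b\<in>Basis. vd x * (ub b x * lap M c (hb b) x))"
        by (subst euclidean_inner) (simp add: lb ub_def sum_distrib_left)
    qed
    then show ?thesis using int by (simp add: integral_sum)
  qed
  have G: "?I (\<lambda>x. vd x * grad_inner M c u h x) = (\<Sum>b\<in>Basis. ?I (\<lambda>x. vd x * grad_inner M c (ub b) (hb b) x))"
  proof -
    have "?I (\<lambda>x. vd x * grad_inner M c u h x) = ?I (\<lambda>x. \<Sum>b\<in>Basis. vd x * grad_inner M c (ub b) (hb b) x)"
      using Q(2) by (intro Henstock_Kurzweil_Integration.integral_cong) (auto simp: gb sum_distrib_left)
    then show ?thesis using int by (simp add: integral_sum)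
  qed
  show "?I (\<lambda>x. vd x * grad_inner M c u h x) = - ?I (\<lambda>x. vd x * (lap M c u x \<bullet> h x))"
    unfolding G L sum_negf[symmetric] by (intro sum.cong refl green(1))
  show "?I (\<lambda>x. vd x * (u x \<bullet> lap M c h x)) = ?I (\<lambda>x. vd x * (lap M c u x \<bullet> h x))"
    unfolding R L by (intro sum.cong refl green(2))
qed

end

section \<open>The derivative of the bienergy along a family of maps\<close>

lemma dir_deriv_Pair_const: "dir_deriv v (\<lambda>y. (t, y)) x = (0, v)"
  by (rule dir_deriv_eq) (auto intro!: derivative_eq_intros)

lemma differentiable_Pair_const: "(\<lambda>y. (t, y)) differentiable (at x)"
  unfolding differentiable_def by (rule exI) (rule derivative_intros)+

lemma dir_deriv_slice:
  assumes "f differentiable (at (t, x))"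
  shows "dir_deriv v (\<lambda>y. f (t, y)) x = dir_deriv (0, v) f (t, x)"
  using dir_deriv_compose[OF differentiable_Pair_const assms] by (simp add: dir_deriv_Pair_const)

lemma dir_deriv_snd_zero:
  assumes "f differentiable (at (snd z))"
  shows "dir_deriv (1, 0) (\<lambda>z. f (snd z)) z = 0"
proof -
  have "dir_deriv (1, 0) (\<lambda>z. f (snd z)) z = dir_deriv (dir_deriv (1, 0) snd z) f (snd z)"
    by (rule dir_deriv_compose[OF bounded_linear_imp_differentiable[OF bounded_linear_snd] assms])
  also have "dir_deriv (1, 0) snd z = 0" by (simp add: dir_deriv_linear bounded_linear_snd)
  also have "dir_deriv 0 f (snd z) = 0"
    using bounded_linear_dir_deriv[OF assms] by (rule linear_simps(3))
  finally show ?thesis .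
qed

section \<open>Differentiation of the energy integrand in the variation parameter\<close>

context riem_chart begin

abbreviation "VV \<equiv> (UNIV :: real set) \<times> V"

lemma open_VV: "open VV"
  using open_V by (intro open_Times) auto

lemma smooth_snd: "smooth_on V f \<Longrightarrow> smooth_on VV (\<lambda>z. f (snd z))"
  by (rule smooth_on_compose[OF open_VV]) (auto intro: smooth_on_linear bounded_linear_snd)

text \<open>The spatial Laplacian expressed by directional derivatives on the product with the time
  axis. In this form it is jointly smooth and can be differentiated in time;
  \<open>lap_slice\<close> returns to the operator on a fixed time slice.\<close>

definition lap_t :: "(real \<times> (real^'m) \<Rightarrow> 'w::euclidean_space) \<Rightarrow> real \<times> (real^'m) \<Rightarrow> 'w" where
  "lap_t U z = (\<Sum>i\<in>UNIV. \<Sum>j\<in>UNIV. a i j (snd z) *\<^sub>R (dir_deriv (0, axis i 1) (dir_deriv (0, axis j 1) U) z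
    - (\<Sum>k\<in>UNIV. christoffel M c (snd z) k i j *\<^sub>R dir_deriv (0, axis k 1) U z)))"

definition grad_t :: "(real \<times> (real^'m) \<Rightarrow> 'w::euclidean_space) \<Rightarrow> (real \<times> (real^'m) \<Rightarrow> 'w) \<Rightarrow> real \<times> (real^'m) \<Rightarrow> real" where
  "grad_t U W z = (\<Sum>i\<in>UNIV. \<Sum>j\<in>UNIV. a i j (snd z) * (dir_deriv (0, axis i 1) U z \<bullet> dir_deriv (0, axis j 1) W z))"

lemma smooth_lap_t: "smooth_on VV U \<Longrightarrow> smooth_on VV (lap_t U)"
  unfolding lap_t_def by (intro smooth_intros open_VV smooth_snd smooth_a smooth_christoffel)

lemma smooth_grad_t: "smooth_on VV U \<Longrightarrow> smooth_on VV W \<Longrightarrow> smooth_on VV (grad_t U W)"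
  unfolding grad_t_def by (intro smooth_intros open_VV smooth_snd smooth_a)

lemma partial_slice:
  assumes "smooth_on VV U" "x \<in> V"
  shows "partial i (\<lambda>y. U (t, y)) x = dir_deriv (0, axis i 1) U (t, x)"
  using assms by (intro dir_deriv_slice smooth_on_differentiable[OF assms(1)]) auto

lemma lap_slice:
  assumes U: "smooth_on VV U" and x: "x \<in> V"
  shows "lap M c (\<lambda>y. U (t, y)) x = lap_t U (t, x)"
proof -
  have "partial i (partial j (\<lambda>y. U (t, y))) x = dir_deriv (0, axis i 1) (dir_deriv (0, axis j 1) U) (t, x)" for i j
  proof -
    have "partial i (partial j (\<lambda>y. U (t, y))) x = partial i (\<lambda>y. dir_deriv (0, axis j 1) U (t, y)) x"
      by (rule dir_deriv_cong_open[OF open_V x]) (rule partial_slice[OF U])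
    then show ?thesis using partial_slice[OF smooth_on_dir_deriv[OF U] x] by simp
  qed
  then show ?thesis by (simp add: lap_def lap_t_def metric_trace_def partial_slice[OF U x])
qed

lemma grad_slice:
  assumes "smooth_on VV U" "smooth_on VV W" "x \<in> V"
  shows "grad_inner M c (\<lambda>y. U (t, y)) (\<lambda>y. W (t, y)) x = grad_t U W (t, x)"
  using assms by (simp add: grad_inner_def grad_t_def metric_trace_def partial_slice)

lemma time_deriv_coeff:
  assumes "smooth_on V f" "z \<in> VV"
  shows "(\<lambda>z. f (snd z)) differentiable (at z)" "dir_deriv (1, 0) (\<lambda>z. f (snd z)) z = 0"
  using assms by (auto intro!: dir_deriv_snd_zero smooth_on_differentiable[OF assms(1)]
      intro: smooth_on_differentiable[OF smooth_snd])

text \<open>The coefficients do not depend on time, and the time derivative commutes with the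
  spatial ones.\<close>

lemma time_deriv_lap_t:
  assumes U: "smooth_on VV U" and z: "z \<in> VV"
  shows "dir_deriv (1, 0) (lap_t U) z = lap_t (dir_deriv (1, 0) U) z"
proof -
  have c1: "dir_deriv (1, 0) (dir_deriv (0, axis k 1) U) z = dir_deriv (0, axis k 1) (dir_deriv (1, 0) U) z" for k
    by (rule dir_deriv_commute[OF open_VV U z])
  have c2: "dir_deriv (1, 0) (dir_deriv (0, axis i 1) (dir_deriv (0, axis k 1) U)) z
      = dir_deriv (0, axis i 1) (dir_deriv (0, axis k 1) (dir_deriv (1, 0) U)) z" for i k
  proof -
    have "dir_deriv (1, 0) (dir_deriv (0, axis i 1) (dir_deriv (0, axis k 1) U)) z
      = dir_deriv (0, axis i 1) (dir_deriv (1, 0) (dir_deriv (0, axis k 1) U)) z"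
      by (rule dir_deriv_commute[OF open_VV smooth_on_dir_deriv[OF U] z])
    also have "\<dots> = dir_deriv (0, axis i 1) (dir_deriv (0, axis k 1) (dir_deriv (1, 0) U)) z"
      by (rule dir_deriv_cong_open[OF open_VV z]) (rule dir_deriv_commute[OF open_VV U])
    finally show ?thesis .
  qed
  have dU: "dir_deriv (0, axis k 1) U differentiable (at z)"
    "dir_deriv (0, axis i 1) (dir_deriv (0, axis k 1) U) differentiable (at z)" for i k
    using U z by (auto intro!: smooth_on_differentiable[OF _ z] smooth_on_dir_deriv)
  note co = time_deriv_coeff[OF smooth_a z] and co' = time_deriv_coeff[OF smooth_christoffel z]
  define N where "N i j z = dir_deriv (0, axis i 1) (dir_deriv (0, axis j 1) U) z
    - (\<Sum>k\<in>UNIV. christoffel M c (snd z) k i j *\<^sub>R dir_deriv (0, axis k 1) U z)" for i j z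
  have d: "(\<lambda>z. christoffel M c (snd z) k i j *\<^sub>R dir_deriv (0, axis k 1) U z) differentiable (at z)"
    "(\<lambda>z. \<Sum>k\<in>UNIV. christoffel M c (snd z) k i j *\<^sub>R dir_deriv (0, axis k 1) U z) differentiable (at z)"
    "N i j differentiable (at z)" "(\<lambda>z. a i j (snd z) *\<^sub>R N i j z) differentiable (at z)"
    "(\<lambda>z. \<Sum>j\<in>UNIV. a i j (snd z) *\<^sub>R N i j z) differentiable (at z)" for i j k
    unfolding N_def[abs_def]
    by (rule smooth_on_differentiable[OF _ z], intro smooth_intros U open_VV smooth_snd smooth_a smooth_christoffel)+
  have N: "dir_deriv (1, 0) (N i j) z = dir_deriv (0, axis i 1) (dir_deriv (0, axis j 1) (dir_deriv (1, 0) U)) z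
    - (\<Sum>k\<in>UNIV. christoffel M c (snd z) k i j *\<^sub>R dir_deriv (0, axis k 1) (dir_deriv (1, 0) U) z)" for i j
  proof -
    have "dir_deriv (1, 0) (N i j) z = dir_deriv (1, 0) (dir_deriv (0, axis i 1) (dir_deriv (0, axis j 1) U)) z
      - dir_deriv (1, 0) (\<lambda>z. \<Sum>k\<in>UNIV. christoffel M c (snd z) k i j *\<^sub>R dir_deriv (0, axis k 1) U z) z"
      unfolding N_def[abs_def] by (rule dir_deriv_diff[OF dU(2) d(2)])
    also have "dir_deriv (1, 0) (\<lambda>z. \<Sum>k\<in>UNIV. christoffel M c (snd z) k i j *\<^sub>R dir_deriv (0, axis k 1) U z) z
      = (\<Sum>k\<in>UNIV. dir_deriv (1, 0) (\<lambda>z. christoffel M c (snd z) k i j *\<^sub>R dir_deriv (0, axis k 1) U z) z)"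
      by (rule dir_deriv_sum[OF d(1)])
    finally show ?thesis
      unfolding dir_deriv_scaleR[OF co'(1) dU(1)] co'(2) c1 c2 by simp
  qed
  have "dir_deriv (1, 0) (lap_t U) z = dir_deriv (1, 0) (\<lambda>z. \<Sum>i\<in>UNIV. \<Sum>j\<in>UNIV. a i j (snd z) *\<^sub>R N i j z) z"
    unfolding lap_t_def[abs_def] N_def[abs_def] ..
  also have "\<dots> = (\<Sum>i\<in>UNIV. \<Sum>j\<in>UNIV. dir_deriv (1, 0) (\<lambda>z. a i j (snd z) *\<^sub>R N i j z) z)"
    unfolding dir_deriv_sum[OF d(5)] dir_deriv_sum[OF d(4)] ..
  also have "\<dots> = lap_t (dir_deriv (1, 0) U) z"
    unfolding dir_deriv_scaleR[OF co(1) d(3)] co(2) N lap_t_def by simp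
  finally show ?thesis .
qed

lemma time_deriv_grad_t:
  assumes U: "smooth_on VV U" and z: "z \<in> VV"
  shows "dir_deriv (1, 0) (grad_t U U) z = 2 * grad_t U (dir_deriv (1, 0) U) z"
proof -
  have c1: "dir_deriv (1, 0) (dir_deriv (0, axis k 1) U) z = dir_deriv (0, axis k 1) (dir_deriv (1, 0) U) z" for k
    by (rule dir_deriv_commute[OF open_VV U z])
  have dU: "dir_deriv (0, axis k 1) U differentiable (at z)" for k
    using U z by (auto intro!: smooth_on_differentiable[OF _ z] smooth_on_dir_deriv)
  define N where "N i j z = dir_deriv (0, axis i 1) U z \<bullet> dir_deriv (0, axis j 1) U z" for i j z
  have d: "N i j differentiable (at z)" "(\<lambda>z. a i j (snd z) * N i j z) differentiable (at z)"
    "(\<lambda>z. \<Sum>j\<in>UNIV. a i j (snd z) * N i j z) differentiable (at z)" for i j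
    unfolding N_def[abs_def]
    by (rule smooth_on_differentiable[OF _ z], intro smooth_intros U open_VV smooth_snd smooth_a)+
  note co = time_deriv_coeff[OF smooth_a z]
  have N: "dir_deriv (1, 0) (N i j) z = dir_deriv (0, axis i 1) U z \<bullet> dir_deriv (0, axis j 1) (dir_deriv (1, 0) U) z
      + dir_deriv (0, axis i 1) (dir_deriv (1, 0) U) z \<bullet> dir_deriv (0, axis j 1) U z" for i j
    unfolding N_def[abs_def] dir_deriv_inner[OF dU dU] c1 ..
  have "dir_deriv (1, 0) (grad_t U U) z = dir_deriv (1, 0) (\<lambda>z. \<Sum>i\<in>UNIV. \<Sum>j\<in>UNIV. a i j (snd z) * N i j z) z"
    unfolding grad_t_def[abs_def] N_def[abs_def] ..
  also have "\<dots> = (\<Sum>i\<in>UNIV. \<Sum>j\<in>UNIV. dir_deriv (1, 0) (\<lambda>z. a i j (snd z) * N i j z) z)"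
    unfolding dir_deriv_sum[OF d(3)] dir_deriv_sum[OF d(2)] ..
  also have "\<dots> = grad_t U (dir_deriv (1, 0) U) z + grad_t (dir_deriv (1, 0) U) U z"
    unfolding dir_deriv_mult[OF co(1) d(1)] co(2) N grad_t_def
    by (simp add: distrib_left sum.distrib)
  also have "grad_t (dir_deriv (1, 0) U) U z = grad_t U (dir_deriv (1, 0) U) z"
    unfolding grad_t_def using z
    by (subst sum.swap) (intro sum.cong refl, auto simp: inner_commute a_sym)
  finally show ?thesis by simp
qed

text \<open>Differentiation under the integral. The factor 4 combines a 2 from squaring the energy
  density with a 2 from the symmetric form inside it.\<close>

lemma bienergy_derivative:
  fixes U :: "real \<times> (real^'m) \<Rightarrow> 'w::euclidean_space"
  assumes U: "smooth_on VV U" and Q: "cbox p q \<subseteq> V"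
  defines "u \<equiv> \<lambda>y. U (0, y)" and "w \<equiv> \<lambda>y. dir_deriv (1, 0) U (0, y)"
  shows "((\<lambda>t. integral (cbox p q) (\<lambda>x. vd x * (tension_sq M c (\<lambda>y. U (t, y)) x)))
      has_real_derivative integral (cbox p q) (\<lambda>x. vd x *
        (2 * (lap M c u x \<bullet> lap M c w x) - 4 * grad_inner M c u u x * grad_inner M c u w x))) (at 0)"
proof -
  define G where "G z = vd (snd z) * (lap_t U z \<bullet> lap_t U z - grad_t U U z * grad_t U U z)" for z
  have sG: "smooth_on VV G"
    unfolding G_def by (intro smooth_intros open_VV smooth_snd smooth_vd smooth_lap_t smooth_grad_t U)
  have dG: "dir_deriv (1, 0) G z = vd (snd z) * (2 * (lap_t U z \<bullet> lap_t (dir_deriv (1, 0) U) z)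
      - 4 * grad_t U U z * grad_t U (dir_deriv (1, 0) U) z)" if z: "z \<in> VV" for z
  proof -
    have d: "lap_t U differentiable (at z)" "grad_t U U differentiable (at z)"
      "(\<lambda>z. lap_t U z \<bullet> lap_t U z) differentiable (at z)" "(\<lambda>z. grad_t U U z * grad_t U U z) differentiable (at z)"
      "(\<lambda>z. lap_t U z \<bullet> lap_t U z - grad_t U U z * grad_t U U z) differentiable (at z)"
      by (rule smooth_on_differentiable[OF _ z], intro smooth_intros open_VV smooth_lap_t smooth_grad_t U)+
    note co = time_deriv_coeff[OF smooth_vd z]
    show ?thesis unfolding G_def
      by (simp add: dir_deriv_mult dir_deriv_diff dir_deriv_inner d co time_deriv_lap_t[OF U z]
          time_deriv_grad_t[OF U z] inner_commute[of "lap_t (dir_deriv (1, 0) U) z"])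
  qed
  have "((\<lambda>t. integral (cbox p q) (\<lambda>x. G (t, x))) has_field_derivative
      integral (cbox p q) (\<lambda>x. dir_deriv (1, 0) G (0, x))) (at 0 within UNIV)"
  proof (rule leibniz_rule_field_derivative)
    fix t x assume "x \<in> cbox p q"
    then have "G differentiable (at ((0, x) + t *\<^sub>R (1, 0)))"
      using Q by (intro smooth_on_differentiable[OF sG]) auto
    from dir_deriv_line[OF this]
    show "((\<lambda>t. G (t, x)) has_real_derivative dir_deriv (1, 0) G (t, x)) (at t within UNIV)" by simp
  next
    fix t
    show "(\<lambda>x. G (t, x)) integrable_on cbox p q"
      using Q by (intro integrable_continuous continuous_on_compose2[OF smooth_on_continuous_on[OF sG]])
        (auto intro!: continuous_intros)
  next
    show "continuous_on (UNIV \<times> cbox p q) (\<lambda>(t, x). dir_deriv (1, 0) G (t, x))"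
      using Q continuous_on_subset[OF smooth_on_continuous_on[OF smooth_on_dir_deriv[OF sG]], of "UNIV \<times> cbox p q"]
      by auto
  qed auto
  then have D: "((\<lambda>t. integral (cbox p q) (\<lambda>x. G (t, x))) has_real_derivative
      integral (cbox p q) (\<lambda>x. dir_deriv (1, 0) G (0, x))) (at 0)" by simp
  have 1: "integral (cbox p q) (\<lambda>x. G (t, x)) = integral (cbox p q) (\<lambda>x. vd x * (tension_sq M c (\<lambda>y. U (t, y)) x))" for t
  proof (rule Henstock_Kurzweil_Integration.integral_cong)
    fix x assume "x \<in> cbox p q"
    then have x: "x \<in> V" using Q by blast
    show "G (t, x) = vd x * (tension_sq M c (\<lambda>y. U (t, y)) x)"
      unfolding lap_slice[OF U x] grad_slice[OF U U x] G_def by simp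
  qed
  have 2: "integral (cbox p q) (\<lambda>x. dir_deriv (1, 0) G (0, x)) = integral (cbox p q) (\<lambda>x. vd x *
        (2 * (lap M c u x \<bullet> lap M c w x) - 4 * grad_inner M c u u x * grad_inner M c u w x))"
  proof (rule Henstock_Kurzweil_Integration.integral_cong)
    fix x assume "x \<in> cbox p q"
    then have x: "x \<in> V" using Q by blast
    have z: "(0, x) \<in> VV" using x by simp
    show "dir_deriv (1, 0) G (0, x) = vd x *
        (2 * (lap M c u x \<bullet> lap M c w x) - 4 * grad_inner M c u u x * grad_inner M c u w x)"
      unfolding u_def w_def lap_slice[OF U x] lap_slice[OF smooth_on_dir_deriv[OF U] x] grad_slice[OF U U x]
        grad_slice[OF U smooth_on_dir_deriv[OF U] x] dG[OF z] by simp
  qed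
  from D show ?thesis unfolding 1 2 .
qed

end

section \<open>Variations by rotations\<close>

text \<open>For orthonormal \<open>b1\<close>, \<open>b2\<close> this is the rotation by
  \<open>\<theta>\<close> in their plane, the identity on the orthogonal complement. It is written
  as a perturbation of \<open>z\<close>, so that angle 0 visibly gives \<open>z\<close>.\<close>

definition rot :: "'w::real_inner \<Rightarrow> 'w \<Rightarrow> real \<Rightarrow> 'w \<Rightarrow> 'w" where
  "rot b1 b2 \<theta> z = z + (cos \<theta> - 1) *\<^sub>R ((z \<bullet> b1) *\<^sub>R b1 + (z \<bullet> b2) *\<^sub>R b2)
    + sin \<theta> *\<^sub>R ((z \<bullet> b1) *\<^sub>R b2 - (z \<bullet> b2) *\<^sub>R b1)"

lemma rot_0 [simp]: "rot b1 b2 0 z = z"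
  by (simp add: rot_def)

lemma rot_inner:
  assumes b: "b1 \<bullet> b1 = 1" "b2 \<bullet> b2 = 1" "b1 \<bullet> b2 = 0"
  shows "rot b1 b2 \<theta> z \<bullet> rot b1 b2 \<theta> z = z \<bullet> z"
proof -
  let ?x = "z \<bullet> b1" and ?y = "z \<bullet> b2" and ?C = "cos \<theta> - 1" and ?S = "sin \<theta>"
  have b': "b2 \<bullet> b1 = 0" using b(3) by (simp add: inner_commute)
  have gen: "A + 2 * (C * x - S * y) * x + 2 * (C * y + S * x) * y + (C * x - S * y)\<^sup>2 + (C * y + S * x)\<^sup>2
    = A + (2 * C + C\<^sup>2 + S\<^sup>2) * (x\<^sup>2 + y\<^sup>2)" for A C S x y :: real
    by (simp add: power2_eq_square algebra_simps)
  have eq: "rot b1 b2 \<theta> z = z + (?C * ?x - ?S * ?y) *\<^sub>R b1 + (?C * ?y + ?S * ?x) *\<^sub>R b2"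
    by (simp add: rot_def algebra_simps)
  have "rot b1 b2 \<theta> z \<bullet> rot b1 b2 \<theta> z
    = z \<bullet> z + 2 * (?C * ?x - ?S * ?y) * ?x + 2 * (?C * ?y + ?S * ?x) * ?y
      + (?C * ?x - ?S * ?y)\<^sup>2 + (?C * ?y + ?S * ?x)\<^sup>2"
    unfolding eq by (simp add: inner_add_left inner_add_right b b' inner_commute[of b1 z] inner_commute[of b2 z]
        power2_eq_square algebra_simps)
  also have "\<dots> = z \<bullet> z + (2 * ?C + ?C\<^sup>2 + ?S\<^sup>2) * (?x\<^sup>2 + ?y\<^sup>2)"
    by (rule gen)
  finally have *: "rot b1 b2 \<theta> z \<bullet> rot b1 b2 \<theta> z = z \<bullet> z + (2 * ?C + ?C\<^sup>2 + ?S\<^sup>2) * (?x\<^sup>2 + ?y\<^sup>2)" .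
  have "2 * ?C + ?C\<^sup>2 + ?S\<^sup>2 = 0"
    using sin_cos_squared_add[of \<theta>] by (simp add: power2_eq_square algebra_simps)
  with * show ?thesis by simp
qed

lemma smooth_on_rot:
  "open U \<Longrightarrow> smooth_on U f \<Longrightarrow> smooth_on U g \<Longrightarrow> smooth_on U (\<lambda>x. rot b1 b2 (f x) (g x))"
  unfolding rot_def by (intro smooth_intros)

text \<open>At angle 0 the cosine part has no first-order contribution, so what remains is the
  infinitesimal rotation, scaled by the derivative of the angle.\<close>

lemma dir_deriv_rot:
  assumes f: "f differentiable (at x)" "f x = 0" and g: "g differentiable (at x)" "dir_deriv v g x = 0"
  shows "dir_deriv v (\<lambda>x. rot b1 b2 (f x) (g x)) x = dir_deriv v f x *\<^sub>R ((g x \<bullet> b1) *\<^sub>R b2 - (g x \<bullet> b2) *\<^sub>R b1)"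
proof (rule dir_deriv_eq[THEN trans])
  show "((\<lambda>x. rot b1 b2 (f x) (g x)) has_derivative (\<lambda>v. dir_deriv v g x + dir_deriv v f x *\<^sub>R ((g x \<bullet> b1) *\<^sub>R b2 - (g x \<bullet> b2) *\<^sub>R b1))) (at x)"
    unfolding rot_def
    using dir_deriv_works[OF f(1)] dir_deriv_works[OF g(1)]
    by (auto intro!: derivative_eq_intros simp: f(2))
  show "dir_deriv v g x + dir_deriv v f x *\<^sub>R ((g x \<bullet> b1) *\<^sub>R b2 - (g x \<bullet> b2) *\<^sub>R b1) = dir_deriv v f x *\<^sub>R ((g x \<bullet> b1) *\<^sub>R b2 - (g x \<bullet> b2) *\<^sub>R b1)"
    by (simp add: g(2))
qed

section \<open>Rotational variations on the whole manifold\<close>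

context riem_mfd begin

lemma smooth_fun_continuous:
  fixes f :: "'a \<Rightarrow> 'w::real_normed_vector"
  assumes f: "smooth_fun f"
  shows "continuous_map (mtop M) euclidean f"
  unfolding continuous_map_def
proof (intro conjI allI impI)
  show "f \<in> topspace (mtop M) \<rightarrow> topspace euclidean" by simp
  fix S :: "'w set" assume S: "openin euclidean S"
  show "openin (mtop M) {p \<in> topspace (mtop M). f p \<in> S}"
  proof (subst openin_subopen, intro ballI)
    fix p assume "p \<in> {p \<in> topspace (mtop M). f p \<in> S}"
    then have p: "p \<in> topspace (mtop M)" "f p \<in> S" by simp_all
    obtain c where c: "c \<in> atlas M" "p \<in> chart_dom c" using chart_exists[OF p(1)] by blast
    define O' where "O' = {x \<in> cimg c. (f \<circ> chart_inv c) x \<in> S}"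
    have "continuous_on (cimg c) (f \<circ> chart_inv c)"
      using f c(1) unfolding smooth_fun_def by (blast intro: smooth_on_continuous_on)
    moreover have "O' = cimg c \<inter> (f \<circ> chart_inv c) -` S" unfolding O'_def by blast
    ultimately have "open O'" using S by (simp add: continuous_open_preimage open_cimg[OF c(1)] del: o_apply)
    then have op: "openin (mtop M) {q \<in> chart_dom c. chart_map c q \<in> O'}" by (rule openin_chart_preimage[OF c(1)])
    have pin: "p \<in> {q \<in> chart_dom c. chart_map c q \<in> O'}"
      using c p unfolding O'_def by simp
    have sub: "{q \<in> chart_dom c. chart_map c q \<in> O'} \<subseteq> {p \<in> topspace (mtop M). f p \<in> S}"
    proof
      fix q assume "q \<in> {q \<in> chart_dom c. chart_map c q \<in> O'}"
      then have q: "q \<in> chart_dom c" "f (chart_inv c (chart_map c q)) \<in> S" unfolding O'_def by simp_all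
      then show "q \<in> {p \<in> topspace (mtop M). f p \<in> S}"
        using subsetD[OF chart_dom_subset[OF c(1)] q(1)] chart_inv_left[OF c(1) q(1)] by simp
    qed
    show "\<exists>T. openin (mtop M) T \<and> p \<in> T \<and> T \<subseteq> {p \<in> topspace (mtop M). f p \<in> S}"
      by (rule exI[of _ "{q \<in> chart_dom c. chart_map c q \<in> O'}"]) (rule conjI[OF op conjI[OF pin sub]])
  qed
qed

definition chart_bump :: "('a, 'm) chart \<Rightarrow> real^'m \<Rightarrow> real \<Rightarrow> 'a \<Rightarrow> real" where
  "chart_bump c x0 r p = (if p \<in> chart_dom c then bump x0 r (chart_map c p) else 0)"

lemma chart_bump_chart: "x \<in> cimg c \<Longrightarrow> chart_bump c x0 r (chart_inv c x) = bump x0 r x"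
  by (simp add: chart_bump_def chart_inv_in chart_inv_right)

text \<open>The preimage of the closed ball is compact, hence closed because the manifold is
  Hausdorff. So another chart domain is covered by its overlap with \<open>c\<close>, where the
  transition map is used, and by the open complement of that compact set, where the function is
  zero.\<close>

lemma smooth_fun_chart_bump:
  assumes c: "c \<in> atlas M" and r: "r > 0" "cball x0 r \<subseteq> cimg c"
  shows "smooth_fun (chart_bump c x0 r)"
  unfolding smooth_fun_def
proof
  fix d assume d: "d \<in> atlas M"
  interpret P: chart_pair M d c by (rule chart_pair[OF d c])
  let ?K = "chart_inv c ` cball x0 r"
  have "compactin (mtop M) ?K"
    by (rule image_compactin[OF _ continuous_chart_inv[OF c]]) (simp add: compactin_subtopology r(2))
  moreover have "Hausdorff_space (mtop M)" using smooth_mfd unfolding smooth_manifold_def by (elim conjE)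
  ultimately have "closedin (mtop M) ?K" by (rule compactin_imp_closedin[rotated])
  then have "openin (mtop M) (chart_dom d - ?K)" using openin_chart_dom[OF d] by (rule openin_diff[rotated])
  then have oK: "open (chart_map d ` (chart_dom d - ?K))" by (rule open_chart_image[OF d]) (rule Diff_subset)
  show "smooth_on (cimg d) (chart_bump c x0 r \<circ> chart_inv d)"
  proof (rule smooth_on_local)
    fix x assume x: "x \<in> cimg d"
    then obtain p where p: "p \<in> chart_dom d" "x = chart_map d p" by (elim imageE)
    show "\<exists>W. x \<in> W \<and> smooth_on W (chart_bump c x0 r \<circ> chart_inv d)"
    proof (cases "p \<in> chart_dom c")
      case True
      then have x': "x \<in> P.V" unfolding p(2) using p(1) by (intro imageI IntI)
      have sm: "smooth_on P.V (chart_bump c x0 r \<circ> chart_inv d)"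
      proof (rule smooth_on_cong[OF P.open_V])
        show "smooth_on P.V (\<lambda>y. bump x0 r (transition d c y))"
          by (rule smooth_on_compose[OF P.open_V P.smooth_T smooth_on_bump[of UNIV]]) auto
        fix y assume "y \<in> P.V"
        then obtain q where q: "q \<in> chart_dom d" "q \<in> chart_dom c" "y = chart_map d q" by (rule P.V_E)
        show "bump x0 r (transition d c y) = (chart_bump c x0 r \<circ> chart_inv d) y"
          unfolding q(3) o_apply P.T_chart[OF q(1)] chart_inv_left[OF d q(1)] chart_bump_def using q(2) by simp
      qed
      show ?thesis by (rule exI, rule conjI[OF x' sm])
    next
      case False
      have "p \<notin> ?K"
      proof
        assume "p \<in> ?K"
        then obtain y where y: "y \<in> cball x0 r" "p = chart_inv c y" by (elim imageE)
        have "p \<in> chart_dom c" unfolding y(2) by (rule chart_inv_in[OF subsetD[OF r(2) y(1)]])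
        with False show False ..
      qed
      then have x': "x \<in> chart_map d ` (chart_dom d - ?K)" unfolding p(2) using p(1) by (intro imageI DiffI)
      have sm: "smooth_on (chart_map d ` (chart_dom d - ?K)) (chart_bump c x0 r \<circ> chart_inv d)"
      proof (rule smooth_on_cong[OF oK _ smooth_on_const[of _ 0]])
        fix y assume "y \<in> chart_map d ` (chart_dom d - ?K)"
        then obtain q where q: "q \<in> chart_dom d" "q \<notin> ?K" "y = chart_map d q" by (elim imageE DiffE)
        have "bump x0 r (chart_map c q) = 0" if "q \<in> chart_dom c"
        proof (rule bump_eq_0[OF r(1)], rule ccontr)
          assume "\<not> r \<le> dist x0 (chart_map c q)"
          then have "chart_map c q \<in> cball x0 r" by simp
          then have "chart_inv c (chart_map c q) \<in> ?K" by (rule imageI)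
          then show False using q(2) chart_inv_left[OF c that] by simp
        qed
        then show "0 = (chart_bump c x0 r \<circ> chart_inv d) y"
          unfolding q(3) o_apply chart_inv_left[OF d q(1)] chart_bump_def by simp
      qed
      show ?thesis by (rule exI, rule conjI[OF x' sm])
    qed
  qed
qed

lemma sphere_map_rot:
  assumes \<phi>: "sphere_map \<phi>" and \<eta>: "smooth_fun \<eta>"
    and b: "b1 \<bullet> b1 = 1" "b2 \<bullet> b2 = 1" "b1 \<bullet> b2 = 0"
  shows "sphere_map (\<lambda>p. rot b1 b2 (t * \<eta> p) (\<phi> p))"
  unfolding sphere_map_def smooth_fun_def
proof (intro conjI ballI)
  fix p assume "p \<in> topspace (mtop M)"
  then have "\<phi> p \<in> sphere 0 1" using \<phi> unfolding sphere_map_def by blast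
  then show "rot b1 b2 (t * \<eta> p) (\<phi> p) \<in> sphere 0 1"
    unfolding sphere_inner rot_inner[OF b] .
next
  fix c assume c: "c \<in> atlas M"
  have "smooth_on (cimg c) (\<lambda>x. \<eta> (chart_inv c x))" "smooth_on (cimg c) (\<lambda>x. \<phi> (chart_inv c x))"
    using \<eta> sphere_mapD(1)[OF \<phi> c] c unfolding smooth_fun_def o_def by blast+
  then show "smooth_on (cimg c) ((\<lambda>p. rot b1 b2 (t * \<eta> p) (\<phi> p)) \<circ> chart_inv c)"
    unfolding o_def by (intro smooth_on_rot smooth_intros open_cimg[OF c])
qed

lemma smooth_variation_rot:
  fixes \<phi> :: "'a \<Rightarrow> (real^'n::finite) \<times> real"
  assumes \<phi>: "sphere_map \<phi>" and \<eta>: "smooth_fun \<eta>"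
    and b: "b1 \<bullet> b1 = 1" "b2 \<bullet> b2 = 1" "b1 \<bullet> b2 = 0"
  shows "smooth_variation M round_sphere \<epsilon> (\<lambda>t p. rot b1 b2 (t * \<eta> p) (\<phi> p))"
  unfolding smooth_variation_def
proof (intro conjI ballI)
  have c\<phi>: "continuous_map (mtop M) euclidean \<phi>" and c\<eta>: "continuous_map (mtop M) euclidean \<eta>"
    using \<phi> \<eta> unfolding sphere_map_def by (blast intro: smooth_fun_continuous)+
  let ?P = "prod_topology (top_of_set {-\<epsilon><..<\<epsilon>}) (mtop M)"
  have "continuous_map ?P (prod_topology euclidean (prod_topology euclidean euclidean)) (\<lambda>z. (fst z, \<eta> (snd z), \<phi> (snd z)))"
    by (intro continuous_map_pairedI continuous_map_into_fulltopology[OF continuous_map_fst]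
        continuous_map_compose[OF continuous_map_snd c\<eta>, unfolded o_def]
        continuous_map_compose[OF continuous_map_snd c\<phi>, unfolded o_def])
  then have "continuous_map ?P euclidean (\<lambda>z. (fst z, \<eta> (snd z), \<phi> (snd z)))"
    by (simp only: prod_topology_euclidean)
  moreover have "continuous_map euclidean euclidean (\<lambda>(t, h, z). rot b1 b2 (t * h) z)"
    unfolding rot_def case_prod_beta by (auto intro!: continuous_intros)
  ultimately have "continuous_map ?P euclidean ((\<lambda>(t, h, z). rot b1 b2 (t * h) z) \<circ> (\<lambda>z. (fst z, \<eta> (snd z), \<phi> (snd z))))"
    by (rule continuous_map_compose)
  moreover have "rot b1 b2 (t * \<eta> p) (\<phi> p) \<in> sphere 0 1" if "p \<in> topspace (mtop M)" for t p
    using sphere_map_rot[OF \<phi> \<eta> b, of t] that unfolding sphere_map_def by blast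
  ultimately show "continuous_map ?P (mtop round_sphere) (\<lambda>(t, p). rot b1 b2 (t * \<eta> p) (\<phi> p))"
    unfolding round_sphere_def
    by (auto simp: o_def case_prod_unfold continuous_map_in_subtopology)
next
  fix c :: "('a, 'm) chart" and d :: "((real^'n) \<times> real, 'n) chart"
  assume c: "c \<in> atlas M" and d: "d \<in> atlas round_sphere"
  obtain e where e: "e * e = 1" "d = stereo_chart e"
    using d unfolding atlas_sphere by (metis mult_1 mult_minus1 minus_minus)
  \<comment> \<open>Joint smoothness is proved for the ambient map first; the chart of the sphere is
    applied afterwards, on the open set \<open>D\<close> where the rotated point avoids the
    pole.\<close>
  define psi where "psi z = rot b1 b2 (fst z * \<eta> (chart_inv c (snd z))) (\<phi> (chart_inv c (snd z)))" for z
  define U where "U = {-\<epsilon><..<\<epsilon>} \<times> cimg c"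
  have oU: "open U" unfolding U_def by (intro open_Times open_cimg[OF c]) auto
  have "smooth_on (cimg c) (\<lambda>x. \<eta> (chart_inv c x))" "smooth_on (cimg c) (\<lambda>x. \<phi> (chart_inv c x))"
    using \<eta> sphere_mapD(1)[OF \<phi> c] c unfolding smooth_fun_def o_def by blast+
  note s = this[THEN smooth_on_compose[OF oU smooth_on_linear[OF bounded_linear_snd]]]
  have "smooth_on U (\<lambda>z. \<eta> (chart_inv c (snd z)))" "smooth_on U (\<lambda>z. \<phi> (chart_inv c (snd z)))"
    by (rule s(1), force simp: U_def) (rule s(2), force simp: U_def)
  then have sp: "smooth_on U psi" unfolding psi_def
    by (intro smooth_on_rot smooth_on_mult smooth_on_linear[OF bounded_linear_fst] oU)
  have sphp: "psi z \<in> sphere 0 1" if "z \<in> U" for z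
    using sphere_mapD(2)[OF sphere_map_rot[OF \<phi> \<eta> b] c, of "snd z" "fst z"] that
    unfolding psi_def U_def by auto
  define D where "D = {z \<in> U. psi z \<in> chart_dom (stereo_chart e)}"
  have oD: "open D" unfolding D_def by (rule open_stereo_preimage[OF oU smooth_on_continuous_on[OF sp] sphp])
  have "D \<subseteq> U" unfolding D_def by blast
  then have "smooth_on D psi" using sp by (rule smooth_on_subset[rotated])
  then have "smooth_on D (\<lambda>z. chart_map (stereo_chart e) (psi z))"
    by (rule smooth_stereo_chart[OF e(1) oD]) (unfold D_def, blast)
  moreover have "D = {(t, x). t \<in> {-\<epsilon><..<\<epsilon>} \<and> x \<in> chart_map c ` chart_dom c \<and>
      rot b1 b2 (t * \<eta> (chart_inv c x)) (\<phi> (chart_inv c x)) \<in> chart_dom d}"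
    unfolding D_def U_def psi_def e(2) by auto
  moreover have "(\<lambda>(t, x). coord_rep c d (\<lambda>p. rot b1 b2 (t * \<eta> p) (\<phi> p)) x) = (\<lambda>z. chart_map (stereo_chart e) (psi z))"
    unfolding coord_rep_def psi_def e(2) by (simp add: fun_eq_iff)
  ultimately show "smooth_on {(t, x). t \<in> {-\<epsilon><..<\<epsilon>} \<and> x \<in> chart_map c ` chart_dom c \<and>
      rot b1 b2 (t * \<eta> (chart_inv c x)) (\<phi> (chart_inv c x)) \<in> chart_dom d}
      (\<lambda>(t, x). coord_rep c d (\<lambda>p. rot b1 b2 (t * \<eta> p) (\<phi> p)) x)" by simp
qed

end

section \<open>The Euler--Lagrange equation\<close>

text \<open>The assumption says that all two by two minors of the pair \<open>P\<close>,
  \<open>u\<close> vanish. Inserting \<open>u \<bullet> u = 1\<close> into a component of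
  \<open>P\<close> and exchanging indices by it collects the factor
  \<open>P \<bullet> u\<close>.\<close>

lemma eq_scaleR_unit_vector:
  fixes P u :: "'w::euclidean_space"
  assumes u: "u \<bullet> u = 1"
    and par: "\<And>b1 b2. b1 \<in> Basis \<Longrightarrow> b2 \<in> Basis \<Longrightarrow> b1 \<noteq> b2 \<Longrightarrow> (P \<bullet> b2) * (u \<bullet> b1) = (P \<bullet> b1) * (u \<bullet> b2)"
  shows "P = (P \<bullet> u) *\<^sub>R u"
proof (rule euclidean_eqI)
  fix b :: 'w assume b: "b \<in> Basis"
  have "P \<bullet> b = (P \<bullet> b) * (u \<bullet> u)" using u by simp
  also have "u \<bullet> u = (\<Sum>b'\<in>Basis. (u \<bullet> b') * (u \<bullet> b'))" by (rule euclidean_inner)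
  also have "(P \<bullet> b) * \<dots> = (\<Sum>b'\<in>Basis. (P \<bullet> b) * (u \<bullet> b') * (u \<bullet> b'))"
    by (simp add: sum_distrib_left mult.assoc)
  also have "\<dots> = (\<Sum>b'\<in>Basis. (P \<bullet> b') * (u \<bullet> b) * (u \<bullet> b'))"
  proof (rule sum.cong[OF refl])
    fix b' :: 'w assume b': "b' \<in> Basis"
    show "(P \<bullet> b) * (u \<bullet> b') * (u \<bullet> b') = (P \<bullet> b') * (u \<bullet> b) * (u \<bullet> b')"
      using par[OF b' b] by (cases "b' = b") simp_all
  qed
  also have "\<dots> = (\<Sum>b'\<in>Basis. (P \<bullet> b') * (u \<bullet> b')) * (u \<bullet> b)"
    by (simp add: sum_distrib_left sum_distrib_right ac_simps)
  also have "(\<Sum>b'\<in>Basis. (P \<bullet> b') * (u \<bullet> b')) = P \<bullet> u" by (rule euclidean_inner[symmetric])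
  finally show "P \<bullet> b = ((P \<bullet> u) *\<^sub>R u) \<bullet> b" by simp
qed

text \<open>The velocity is the bump function times the infinitesimal rotation of \<open>u\<close>,
  and its inner product with \<open>P\<close> is the displayed minor. Compact support of the
  velocity permits both Green formulas, which leave no derivative on it.\<close>

lemma (in riem_chart) first_variation_rot:
  fixes u :: "real^'m \<Rightarrow> 'w::euclidean_space"
  assumes u: "smooth_on V u" and b: "b1 \<bullet> b1 = 1" "b2 \<bullet> b2 = 1"
    and Q: "cball x0 r \<subseteq> cbox p q" "cbox p q \<subseteq> V" and r: "r > 0"
    and en: "\<And>x. x \<in> V \<Longrightarrow> grad_inner M c u u x = k"
  defines "U \<equiv> \<lambda>z. rot b1 b2 (fst z * bump x0 r (snd z)) (u (snd z))"
    and "P \<equiv> \<lambda>x. lap M c (lap M c u) x + (2 * k) *\<^sub>R lap M c u x"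
  shows "smooth_on VV U"
    and "((\<lambda>t. integral (cbox p q) (\<lambda>x. vd x * (tension_sq M c (\<lambda>y. U (t, y)) x)))
      has_real_derivative 2 * integral (cbox p q)
        (\<lambda>x. vd x * (bump x0 r x * ((P x \<bullet> b2) * (u x \<bullet> b1) - (P x \<bullet> b1) * (u x \<bullet> b2))))) (at 0)"
proof -
  let ?I = "integral (cbox p q)"
  have sb: "smooth_on V (bump x0 r)" using open_V by (rule smooth_on_bump)
  have sf: "smooth_on VV (\<lambda>z. fst z * bump x0 r (snd z))"
    by (intro smooth_on_mult open_VV smooth_on_linear[OF bounded_linear_fst] smooth_snd sb)
  show sU: "smooth_on VV U" unfolding U_def
    by (intro smooth_on_rot open_VV sf smooth_snd u)
  define w where "w x = bump x0 r x *\<^sub>R ((u x \<bullet> b1) *\<^sub>R b2 - (u x \<bullet> b2) *\<^sub>R b1)" for x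
  have sw: "smooth_on V w" unfolding w_def[abs_def]
    by (intro smooth_intros open_V sb u)
  have U0: "(\<lambda>y. U (0, y)) = u" by (simp add: U_def)
  have Uw: "dir_deriv (1, 0) U (0, y) = w y" if y: "y \<in> V" for y
  proof -
    have z: "(0, y) \<in> VV" using y by simp
    have df: "(\<lambda>z. fst z * bump x0 r (snd z)) differentiable (at (0, y))"
      using sf z by (rule smooth_on_differentiable)
    have "dir_deriv (1, 0) (\<lambda>z. fst z * bump x0 r (snd z)) (0, y)
      = fst (0::real, y) * dir_deriv (1, 0) (\<lambda>z. bump x0 r (snd z)) (0::real, y) + dir_deriv (1, 0) fst (0::real, y) * bump x0 r (snd (0::real, y))"
      by (rule dir_deriv_mult[OF bounded_linear_imp_differentiable[OF bounded_linear_fst] time_deriv_coeff(1)[OF sb z]])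
    also have "\<dots> = bump x0 r y" by (simp add: dir_deriv_linear bounded_linear_fst)
    finally have 1: "dir_deriv (1, 0) (\<lambda>z. fst z * bump x0 r (snd z)) (0, y) = bump x0 r y" .
    show ?thesis unfolding U_def
      using dir_deriv_rot[OF df _ time_deriv_coeff[OF u z], of b1 b2] unfolding 1 w_def by simp
  qed
  have lap_w: "lap M c (\<lambda>y. dir_deriv (1, 0) U (0, y)) x = lap M c w x"
    and grad_w: "grad_inner M c u (\<lambda>y. dir_deriv (1, 0) U (0, y)) x = grad_inner M c u w x" if "x \<in> V" for x
    by (rule lap_cong_open[OF open_V that] grad_inner_cong_open[OF open_V that refl], erule Uw)+
  have D: "((\<lambda>t. ?I (\<lambda>x. vd x * (tension_sq M c (\<lambda>y. U (t, y)) x)))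
      has_real_derivative ?I (\<lambda>x. vd x * (2 * (lap M c u x \<bullet> lap M c (\<lambda>y. dir_deriv (1, 0) U (0, y)) x)
        - 4 * grad_inner M c u u x * grad_inner M c u (\<lambda>y. dir_deriv (1, 0) U (0, y)) x))) (at 0)"
    using bienergy_derivative[OF sU Q(2)] unfolding U0 .
  have supp: "w x = 0" if "x \<notin> cball x0 r" for x
    using that bump_eq_0[OF r, of x0 x] by (simp add: w_def)
  have int: "(\<lambda>x. vd x * (lap M c u x \<bullet> lap M c w x)) integrable_on cbox p q"
    "(\<lambda>x. vd x * grad_inner M c u w x) integrable_on cbox p q"
    "(\<lambda>x. vd x * (lap M c (lap M c u) x \<bullet> w x)) integrable_on cbox p q"
    "(\<lambda>x. vd x * (lap M c u x \<bullet> w x)) integrable_on cbox p q"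
    by (rule integrable_cbox[OF Q(2)], intro smooth_intros open_V smooth_vd smooth_lap smooth_grad_inner u sw)+
  have "?I (\<lambda>x. vd x * (2 * (lap M c u x \<bullet> lap M c (\<lambda>y. dir_deriv (1, 0) U (0, y)) x)
        - 4 * grad_inner M c u u x * grad_inner M c u (\<lambda>y. dir_deriv (1, 0) U (0, y)) x))
    = ?I (\<lambda>x. 2 * (vd x * (lap M c u x \<bullet> lap M c w x)) - (4 * k) * (vd x * grad_inner M c u w x))"
  proof (rule Henstock_Kurzweil_Integration.integral_cong)
    fix x assume "x \<in> cbox p q"
    then have x: "x \<in> V" using Q(2) by blast
    show "vd x * (2 * (lap M c u x \<bullet> lap M c (\<lambda>y. dir_deriv (1, 0) U (0, y)) x)
        - 4 * grad_inner M c u u x * grad_inner M c u (\<lambda>y. dir_deriv (1, 0) U (0, y)) x)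
      = 2 * (vd x * (lap M c u x \<bullet> lap M c w x)) - (4 * k) * (vd x * grad_inner M c u w x)"
      unfolding lap_w[OF x] grad_w[OF x] en[OF x] by (simp add: algebra_simps)
  qed
  also have "\<dots> = 2 * ?I (\<lambda>x. vd x * (lap M c u x \<bullet> lap M c w x)) - (4 * k) * ?I (\<lambda>x. vd x * grad_inner M c u w x)"
    using int by (simp add: integral_diff integrable_on_mult_right)
  also have "\<dots> = 2 * ?I (\<lambda>x. vd x * (lap M c (lap M c u) x \<bullet> w x)) + (4 * k) * ?I (\<lambda>x. vd x * (lap M c u x \<bullet> w x))"
    using green_vector(1)[OF Q u sw supp] green_vector(2)[OF Q smooth_lap[OF u] sw supp] by simp
  also have "\<dots> = ?I (\<lambda>x. 2 * (vd x * (lap M c (lap M c u) x \<bullet> w x)) + (4 * k) * (vd x * (lap M c u x \<bullet> w x)))"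
    using int by (simp add: integral_add integrable_on_mult_right)
  also have "\<dots> = ?I (\<lambda>x. 2 * (vd x * (bump x0 r x * ((P x \<bullet> b2) * (u x \<bullet> b1) - (P x \<bullet> b1) * (u x \<bullet> b2)))))"
    by (rule Henstock_Kurzweil_Integration.integral_cong)
      (simp add: w_def P_def inner_diff_right inner_add_left algebra_simps)
  also have "\<dots> = 2 * ?I (\<lambda>x. vd x * (bump x0 r x * ((P x \<bullet> b2) * (u x \<bullet> b1) - (P x \<bullet> b1) * (u x \<bullet> b2))))"
    by simp
  finally show "((\<lambda>t. ?I (\<lambda>x. vd x * (tension_sq M c (\<lambda>y. U (t, y)) x)))
      has_real_derivative 2 * ?I (\<lambda>x. vd x * (bump x0 r x * ((P x \<bullet> b2) * (u x \<bullet> b1) - (P x \<bullet> b1) * (u x \<bullet> b2))))) (at 0)"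
    using D by simp
qed

text \<open>The energy is a sum, over the ambient components, of values of the positive definite
  inverse metric on their differentials; a zero sum forces all first derivatives to vanish on
  \<open>V\<close>.\<close>

lemma (in riem_chart) lap_eq_0_of_grad_inner_eq_0:
  fixes u :: "real^'m \<Rightarrow> 'w::euclidean_space"
  assumes u: "smooth_on V u" and en: "\<And>x. x \<in> V \<Longrightarrow> grad_inner M c u u x = 0" and x: "x \<in> V"
  shows "lap M c u x = 0"
proof -
  have pu: "partial i u y = 0" if y: "y \<in> V" for i y
  proof -
    define v where "v b = (\<chi> i. partial i u y \<bullet> b)" for b
    have "grad_inner M c u u y = (\<Sum>b\<in>Basis. v b \<bullet> (inv_metric M c y *v v b))"
    proof -
      have "grad_inner M c u u y = (\<Sum>i\<in>UNIV. \<Sum>j\<in>UNIV. \<Sum>b\<in>Basis. a i j y * ((partial i u y \<bullet> b) * (partial j u y \<bullet> b)))"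
        unfolding grad_inner_def metric_trace_def
        by (subst euclidean_inner) (simp add: sum_distrib_left)
      also have "\<dots> = (\<Sum>b\<in>Basis. \<Sum>i\<in>UNIV. \<Sum>j\<in>UNIV. a i j y * ((partial i u y \<bullet> b) * (partial j u y \<bullet> b)))"
        by (rule sum_rotate3[symmetric])
      also have "\<dots> = (\<Sum>b\<in>Basis. \<Sum>i\<in>UNIV. \<Sum>j\<in>UNIV. v b $ i * (a i j y * v b $ j))"
        by (intro sum.cong refl) (simp add: v_def)
      finally show ?thesis
        by (simp only: inner_vec_def matrix_vector_mult_def sum_distrib_left vec_lambda_beta inner_real_def)
    qed
    then have sum0: "(\<Sum>b\<in>Basis. v b \<bullet> (inv_metric M c y *v v b)) = 0" using en[OF y] by simp
    have nonneg: "0 \<le> v b \<bullet> (inv_metric M c y *v v b)" for b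
      by (cases "v b = 0") (simp, rule less_imp_le[OF inv_metric_pos[OF y]])
    have vb: "v b = 0" if b: "b \<in> Basis" for b
    proof (rule ccontr)
      assume "v b \<noteq> 0"
      then have "v b \<bullet> (inv_metric M c y *v v b) > 0" by (rule inv_metric_pos[OF y])
      moreover have "v b \<bullet> (inv_metric M c y *v v b) = 0"
        using sum_nonneg_eq_0_iff[OF finite_Basis nonneg, THEN iffD1, OF sum0] b by (rule bspec)
      ultimately show False by simp
    qed
    have "partial i u y \<bullet> b = 0" if b: "b \<in> Basis" for b
    proof -
      have "partial i u y \<bullet> b = v b $ i" by (simp only: v_def vec_lambda_beta)
      then show ?thesis by (simp only: vb[OF b] zero_index)
    qed
    then show ?thesis by (simp add: euclidean_eq_iff[of "partial i u y" 0])
  qed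
  have "partial i (partial j u) x = 0" for i j
  proof -
    have "partial i (partial j u) x = partial i (\<lambda>y. 0) x"
      by (rule dir_deriv_cong_open[OF open_V x]) (rule pu)
    then show ?thesis by simp
  qed
  then show ?thesis by (simp add: lap_def metric_trace_def pu[OF x])
qed

context riem_mfd_wo begin

lemma biharmonic_sphere_map:
  "biharmonic M round_sphere \<phi> \<Longrightarrow> sphere_map \<phi>"
  unfolding biharmonic_def by (elim conjE) (rule smooth_map_sphere_map)

text \<open>Over the image of a box, the abstract volume integral becomes an integral in
  coordinates. A separate function \<open>w\<close> is allowed so that time slices of a smooth
  family can be inserted directly.\<close>

lemma bienergy_chart:
  assumes \<Phi>: "sphere_map \<Phi>" and c: "c \<in> atlas M" and X: "X \<noteq> {}" and Q: "cbox p q \<subseteq> cimg c"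
    and w: "\<And>x. x \<in> cimg c \<Longrightarrow> \<Phi> (chart_inv c x) = w x"
  shows "bienergy M round_sphere (chart_inv c ` cbox p q) \<Phi>
    = integral (cbox p q) (\<lambda>x. volume_density M c x * (tension_sq M c w x)) / 2"
proof -
  interpret C: sphere_rep M c "cimg c" "\<Phi> \<circ> chart_inv c" by (rule sphere_rep[OF \<Phi> c])
  have eq: "lap M c (\<Phi> \<circ> chart_inv c) x = lap M c w x" "grad_inner M c (\<Phi> \<circ> chart_inv c) (\<Phi> \<circ> chart_inv c) x = grad_inner M c w w x"
    if "x \<in> cimg c" for x
    by (rule lap_cong_open[OF C.open_V that], simp only: o_apply w)
      (rule grad_inner_cong_open[OF C.open_V that], simp_all only: o_apply w)
  have sw: "smooth_on (cimg c) w"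
    by (rule smooth_on_cong[OF C.open_V _ C.smooth_u]) (simp add: w)
  have "(LINT p:chart_inv c ` cbox p q|riemannian_volume M. tension_norm2 M round_sphere \<Phi> p)
    = integral (cbox p q) (\<lambda>x. volume_density M c x * (tension_sq M c w x))"
  proof (rule volume_integral_cbox[OF c X Q])
    show "continuous_on (cimg c) (\<lambda>x. tension_sq M c w x)"
      by (rule smooth_on_continuous_on) (intro smooth_intros C.open_V C.smooth_lap C.smooth_grad_inner sw)
    fix x assume "x \<in> cbox p q"
    then have x: "x \<in> cimg c" using Q by (rule subsetD[rotated])
    show "tension_norm2 M round_sphere \<Phi> (chart_inv c x) = tension_sq M c w x"
      unfolding tension_chart(2)[OF \<Phi> c x] eq[OF x] ..
  qed
  then show ?thesis by (simp add: bienergy_def)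
qed

lemma first_variation_zero:
  assumes \<phi>: "biharmonic M round_sphere \<phi>"
    and en: "\<And>p. p \<in> X \<Longrightarrow> energy_density M round_sphere \<phi> p = k"
    and c: "c \<in> atlas M" and b: "b1 \<bullet> b1 = 1" "b2 \<bullet> b2 = 1" "b1 \<bullet> b2 = 0"
    and Q: "cball x0 r \<subseteq> cbox p q" "cbox p q \<subseteq> cimg c" and r: "r > 0"
  defines "u \<equiv> \<phi> \<circ> chart_inv c"
  defines "P \<equiv> \<lambda>x. lap M c (lap M c u) x + (2 * k) *\<^sub>R lap M c u x"
  shows "integral (cbox p q) (\<lambda>x. volume_density M c x * (bump x0 r x * ((P x \<bullet> b2) * (u x \<bullet> b1) - (P x \<bullet> b1) * (u x \<bullet> b2)))) = 0"
proof -
  have sm: "sphere_map \<phi>" using \<phi> by (rule biharmonic_sphere_map)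
  interpret C: sphere_rep M c "cimg c" u unfolding u_def by (rule sphere_rep[OF sm c])
  have x0: "x0 \<in> cimg c" by (rule subsetD[OF order_trans[OF Q]]) (use r in simp)
  have X: "X \<noteq> {}" using subsetD[OF chart_dom_subset[OF c] chart_inv_in[OF x0]] by (rule ex_in_conv[THEN iffD1, OF exI])
  have en_u: "grad_inner M c u u x = k" if x: "x \<in> cimg c" for x
    using tension_chart(1)[OF sm c x] en[OF subsetD[OF chart_dom_subset[OF c] chart_inv_in[OF x]]]
    unfolding u_def by simp
  define \<eta> where "\<eta> = chart_bump c x0 r"
  have \<eta>: "smooth_fun \<eta>" unfolding \<eta>_def by (rule smooth_fun_chart_bump[OF c r order_trans[OF Q]])
  define \<Phi> where "\<Phi> t p = rot b1 b2 (t * \<eta> p) (\<phi> p)" for t p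
  \<comment> \<open>The image of the whole box rather than of the ball: it contains the support of
    the variation, and the bienergy over it is an integral over \<open>cbox p q\<close>.\<close>
  define K where "K = chart_inv c ` cbox p q"
  have var: "smooth_variation M round_sphere 1 \<Phi>"
    unfolding \<Phi>_def by (rule smooth_variation_rot[OF sm \<eta> b])
  have K: "compactin (mtop M) K" unfolding K_def by (rule compactin_chart[OF c compact_cbox Q(2)])
  have out: "\<Phi> t p' = \<phi> p'" if "p' \<in> X - K" for t p'
  proof -
    have "\<eta> p' = 0"
    proof (cases "p' \<in> chart_dom c")
      case True
      have "bump x0 r (chart_map c p') = 0"
      proof (rule bump_eq_0[OF r], rule ccontr)
        assume "\<not> r \<le> dist x0 (chart_map c p')"
        then have "chart_map c p' \<in> cbox p q" using Q(1) by auto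
        then have "chart_inv c (chart_map c p') \<in> K" unfolding K_def by (rule imageI)
        then show False using that chart_inv_left[OF c True] by simp
      qed
      then show ?thesis by (simp add: \<eta>_def chart_bump_def)
    qed (simp add: \<eta>_def chart_bump_def)
    then show ?thesis by (simp add: \<Phi>_def)
  qed
  have "((\<lambda>t. bienergy M round_sphere K (\<Phi> t)) has_real_derivative 0) (at 0)"
  proof -
    have "\<forall>\<epsilon> \<Phi> K. \<epsilon> > 0 \<and> smooth_variation M round_sphere \<epsilon> \<Phi> \<and> (\<forall>p\<in>X. \<Phi> 0 p = \<phi> p) \<and>
       compactin (mtop M) K \<and> (\<forall>t\<in>{-\<epsilon><..<\<epsilon>}. \<forall>p\<in>X - K. \<Phi> t p = \<phi> p)
       \<longrightarrow> ((\<lambda>t. bienergy M round_sphere K (\<Phi> t)) has_real_derivative 0) (at 0)"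
      using \<phi> unfolding biharmonic_def by (elim conjE)
    note H = this[THEN spec, of 1, THEN spec, of \<Phi>, THEN spec, of K]
    have start: "\<Phi> 0 p' = \<phi> p'" for p' by (simp add: \<Phi>_def)
    show ?thesis by (intro H[THEN mp] conjI ballI zero_less_one var K; (rule start | erule out))
  qed
  moreover define U where "U = (\<lambda>z. rot b1 b2 (fst z * bump x0 r (snd z)) (u (snd z)))"
  have "bienergy M round_sphere K (\<Phi> t) = integral (cbox p q) (\<lambda>x. volume_density M c x * (tension_sq M c (\<lambda>y. U (t, y)) x)) / 2" for t
    unfolding K_def
  proof (rule bienergy_chart[OF _ c X Q(2)])
    show "sphere_map (\<Phi> t)" unfolding \<Phi>_def by (rule sphere_map_rot[OF sm \<eta> b])
    fix x assume "x \<in> cimg c"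
    then show "\<Phi> t (chart_inv c x) = U (t, x)"
      by (simp add: \<Phi>_def U_def \<eta>_def chart_bump_chart u_def)
  qed
  ultimately have "((\<lambda>t. integral (cbox p q) (\<lambda>x. volume_density M c x * (tension_sq M c (\<lambda>y. U (t, y)) x)) / 2)
     has_real_derivative 0) (at 0)" by simp
  moreover have "((\<lambda>t. integral (cbox p q) (\<lambda>x. volume_density M c x * (tension_sq M c (\<lambda>y. U (t, y)) x)) / 2)
     has_real_derivative (2 * integral (cbox p q)
        (\<lambda>x. volume_density M c x * (bump x0 r x * ((P x \<bullet> b2) * (u x \<bullet> b1) - (P x \<bullet> b1) * (u x \<bullet> b2))))) / 2) (at 0)"
    unfolding U_def P_def
    by (rule DERIV_cdivide) (rule C.first_variation_rot(2)[OF C.smooth_u b(1,2) Q r en_u])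
  ultimately have "(2 * integral (cbox p q)
        (\<lambda>x. volume_density M c x * (bump x0 r x * ((P x \<bullet> b2) * (u x \<bullet> b1) - (P x \<bullet> b1) * (u x \<bullet> b2))))) / 2 = 0"
    by (rule DERIV_unique[rotated])
  then show ?thesis by simp
qed

text \<open>The fundamental lemma of the calculus of variations: a minor that is nonzero at
  \<open>x0\<close> keeps its sign nearby, and a bump placed there would make the vanishing first
  variation strictly signed.\<close>

lemma euler_lagrange:
  fixes \<phi> :: "'a \<Rightarrow> (real^'n::finite) \<times> real"
  assumes \<phi>: "biharmonic M round_sphere \<phi>"
    and en: "\<And>p. p \<in> X \<Longrightarrow> energy_density M round_sphere \<phi> p = k"
    and c: "c \<in> atlas M" and x0: "x0 \<in> cimg c"
  defines "u \<equiv> \<phi> \<circ> chart_inv c"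
  defines "P \<equiv> \<lambda>x. lap M c (lap M c u) x + (2 * k) *\<^sub>R lap M c u x"
  shows "P x0 = (P x0 \<bullet> u x0) *\<^sub>R u x0"
proof -
  have sm: "sphere_map \<phi>" using \<phi> by (rule biharmonic_sphere_map)
  interpret C: sphere_rep M c "cimg c" u unfolding u_def by (rule sphere_rep[OF sm c])
  show ?thesis
  proof (rule eq_scaleR_unit_vector[OF C.u_inner[OF x0]], rule ccontr)
    fix b1 b2 :: "(real^'n) \<times> real" assume B: "b1 \<in> Basis" "b2 \<in> Basis" "b1 \<noteq> b2"
    have b: "b1 \<bullet> b1 = 1" "b2 \<bullet> b2 = 1" "b1 \<bullet> b2 = 0" using B by (simp_all add: inner_Basis)
    define Z where "Z x = (P x \<bullet> b2) * (u x \<bullet> b1) - (P x \<bullet> b1) * (u x \<bullet> b2)" for x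
    assume "(P x0 \<bullet> b2) * (u x0 \<bullet> b1) \<noteq> (P x0 \<bullet> b1) * (u x0 \<bullet> b2)"
    then have Z0: "Z x0 \<noteq> 0" by (simp add: Z_def)
    have sZ: "smooth_on (cimg c) Z" unfolding Z_def[abs_def] P_def
      by (intro smooth_intros C.open_V C.smooth_lap C.smooth_u)
    \<comment> \<open>Multiplying by this sign treats positive and negative minors together.\<close>
    define s where "s = sgn (Z x0)"
    have s: "s * Z x0 > 0" using Z0 by (simp add: s_def sgn_if)
    have "open (cimg c \<inter> (\<lambda>x. s * Z x) -` {0<..})"
      by (intro continuous_open_preimage continuous_on_mult continuous_on_const
          smooth_on_continuous_on[OF sZ] C.open_V open_greaterThan)
    moreover have "x0 \<in> cimg c \<inter> (\<lambda>x. s * Z x) -` {0<..}" using x0 s by simp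
    ultimately obtain p q where Q: "x0 \<in> box p q" "cbox p q \<subseteq> cimg c \<inter> (\<lambda>x. s * Z x) -` {0<..}"
      using open_contains_cbox by metis
    obtain r where r: "r > 0" "cball x0 r \<subseteq> box p q"
      using open_contains_cball[of "box p q"] open_box Q(1) by blast
    have Qc: "cbox p q \<subseteq> cimg c" using Q(2) by (rule order_trans) (rule Int_lower1)
    define F where "F x = volume_density M c x * (bump x0 r x * (s * Z x))" for x
    have "integral (cbox p q) (\<lambda>x. volume_density M c x * (bump x0 r x * Z x)) = 0"
      using first_variation_zero[OF \<phi> en c b order_trans[OF r(2) box_subset_cbox] Qc r(1)]
      unfolding Z_def P_def u_def .
    then have "integral (cbox p q) (\<lambda>x. s * (volume_density M c x * (bump x0 r x * Z x))) = 0"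
      by (simp only: Henstock_Kurzweil_Integration.integral_mult_right mult_zero_right)
    then have IF: "integral (cbox p q) F = 0" unfolding F_def by (simp only: mult.left_commute[of s])
    have sF: "smooth_on (cimg c) F" unfolding F_def[abs_def]
      by (intro smooth_intros C.open_V C.smooth_vd smooth_on_bump sZ)
    have cF: "continuous_on (cbox p q) F"
      by (rule continuous_on_subset[OF smooth_on_continuous_on[OF sF] Qc])
    \<comment> \<open>A continuous nonnegative function with zero integral over the box must vanish,
      but every factor of \<open>F\<close> is positive at the centre of the bump.\<close>
    have "F x0 = 0"
    proof (rule has_integral_0_cbox_imp_0[OF cF])
      show "(F has_integral 0) (cbox p q)"
        using integrable_integral[OF integrable_continuous[OF cF]] IF by simp
      show "box p q \<noteq> {}" "x0 \<in> cbox p q" using Q(1) subsetD[OF box_subset_cbox Q(1)] by auto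
      fix x assume "x \<in> box p q"
      then have x: "x \<in> cbox p q" by (rule subsetD[OF box_subset_cbox])
      have "s * Z x > 0" using subsetD[OF Q(2) x] by simp
      moreover have "volume_density M c x > 0" by (rule C.vd_pos[OF subsetD[OF Qc x]])
      ultimately show "0 \<le> F x" unfolding F_def by (simp add: bump_nonneg)
    qed
    moreover have "F x0 > 0" unfolding F_def
      using s C.vd_pos[OF x0] bump_pos_iff[OF r(1), of x0 x0] r(1) by simp
    ultimately show False by simp
  qed
qed

end

theorem theorem3p3:
  fixes M :: "('a, 'm::{finite, wellorder}) riem"
    and \<phi> :: "'a \<Rightarrow> (real^'n::finite) \<times> real"
    and \<mu> :: "'a \<Rightarrow> real"
    and c :: real
  assumes "riemannian_manifold M"
    and "connected_space (mtop M)"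
    and "biharmonic M round_sphere \<phi>"
    and "\<forall>p\<in>topspace (mtop M). energy_density M round_sphere \<phi> p = c"
    and "\<forall>p\<in>topspace (mtop M).
           vec_laplacian M (vec_laplacian M \<phi>) p = - \<mu> p *\<^sub>R vec_laplacian M \<phi> p"
  shows "harmonic M round_sphere \<phi> \<or> (\<forall>p\<in>topspace (mtop M). \<mu> p = 2 * c)"
proof -
  interpret riem_mfd_wo M by unfold_locales (rule assms(1))
  have sm: "sphere_map \<phi>" using assms(3) by (rule biharmonic_sphere_map)
  have sf: "smooth_fun \<phi>" using sm unfolding sphere_map_def by (elim conjE)
  have en: "energy_density M round_sphere \<phi> p = c" if "p \<in> X" for p using assms(4) that by (rule bspec)
  define L where "L = vec_laplacian M \<phi>"
  define LL where "LL = vec_laplacian M L"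
  have sL: "smooth_fun L" unfolding L_def by (rule smooth_fun_vec_laplacian[OF sf])
  have sLL: "smooth_fun LL" unfolding LL_def by (rule smooth_fun_vec_laplacian[OF sL])
  have mu: "LL p = - \<mu> p *\<^sub>R L p" if "p \<in> X" for p
    using assms(5) that unfolding LL_def L_def by (rule bspec)
  define T where "T p = L p + c *\<^sub>R \<phi> p" for p
  have chart: "L (chart_inv d x) = lap M d (\<phi> \<circ> chart_inv d) x"
    "LL (chart_inv d x) = lap M d (lap M d (\<phi> \<circ> chart_inv d)) x"
    "grad_inner M d (\<phi> \<circ> chart_inv d) (\<phi> \<circ> chart_inv d) x = c"
    "tension M round_sphere \<phi> (chart_inv d x) = 0 \<longleftrightarrow> T (chart_inv d x) = 0"
    "L (chart_inv d x) \<bullet> \<phi> (chart_inv d x) = - c"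
    "(2 * c - \<mu> (chart_inv d x)) *\<^sub>R T (chart_inv d x) = 0"
    if d: "d \<in> atlas M" and x: "x \<in> cimg d" for d x
  proof -
    let ?u = "\<phi> \<circ> chart_inv d"
    interpret C: sphere_rep M d "cimg d" ?u by (rule sphere_rep[OF sm d])
    have p: "chart_inv d x \<in> X" by (rule subsetD[OF chart_dom_subset[OF d] chart_inv_in[OF x]])
    show 1: "L (chart_inv d x) = lap M d ?u x"
      unfolding L_def vec_laplacian_chart[OF sf d chart_inv_in[OF x]] chart_inv_right[OF x] ..
    show 2: "LL (chart_inv d x) = lap M d (lap M d ?u) x"
      unfolding LL_def L_def by (rule lap_vec_laplacian[OF sf d x])
    show 3: "grad_inner M d ?u ?u x = c"
      using tension_chart(1)[OF sm d x] en[OF p] by simp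
    show "tension M round_sphere \<phi> (chart_inv d x) = 0 \<longleftrightarrow> T (chart_inv d x) = 0"
      unfolding tension_chart(3)[OF sm d x] T_def 1 3 by simp
    show 4: "L (chart_inv d x) \<bullet> \<phi> (chart_inv d x) = - c"
      using C.lap_u_inner[OF x] unfolding 1 3 by simp
    define m where "m = 2 * c - \<mu> (chart_inv d x)"
    have "lap M d (lap M d ?u) x + (2 * c) *\<^sub>R lap M d ?u x = m *\<^sub>R L (chart_inv d x)"
      unfolding 1[symmetric] 2[symmetric] mu[OF p] m_def by (simp add: algebra_simps)
    note eqP = this
    \<comment> \<open>The Euler-Lagrange field is \<open>m\<close> times the Laplacian here. Pairing
      with \<open>\<phi>\<close> determines the normal coefficient as \<open>- m * c\<close>, so
      that \<open>m\<close> times \<open>T\<close> is zero.\<close>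
    have "m *\<^sub>R L (chart_inv d x) = (m *\<^sub>R L (chart_inv d x) \<bullet> \<phi> (chart_inv d x)) *\<^sub>R \<phi> (chart_inv d x)"
      using euler_lagrange[OF assms(3) en d x] unfolding eqP o_apply .
    also have "\<dots> = - ((m * c) *\<^sub>R \<phi> (chart_inv d x))" unfolding inner_scaleR_left 4 by simp
    finally show "(2 * c - \<mu> (chart_inv d x)) *\<^sub>R T (chart_inv d x) = 0"
      unfolding m_def[symmetric] T_def scaleR_right_distrib scaleR_scaleR by (simp only: add.left_inverse)
  qed
  have pt: "tension M round_sphere \<phi> p = 0 \<longleftrightarrow> T p = 0" "L p \<bullet> \<phi> p = - c" "(2 * c - \<mu> p) *\<^sub>R T p = 0"
    if p: "p \<in> X" for p
  proof -
    obtain d where d: "d \<in> atlas M" "p \<in> chart_dom d" using chart_exists[OF p] by (elim bexE)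
    have x: "chart_map d p \<in> cimg d" using d(2) by (rule imageI)
    show "tension M round_sphere \<phi> p = 0 \<longleftrightarrow> T p = 0"
      using chart(4)[OF d(1) x] unfolding chart_inv_left[OF d] .
    show "L p \<bullet> \<phi> p = - c"
      using chart(5)[OF d(1) x] unfolding chart_inv_left[OF d] .
    show "(2 * c - \<mu> p) *\<^sub>R T p = 0"
      using chart(6)[OF d(1) x] unfolding chart_inv_left[OF d] .
  qed
  show ?thesis
  proof (cases "\<forall>p\<in>X. T p = 0")
    case True
    then have "\<forall>p\<in>X. tension M round_sphere \<phi> p = 0" using pt(1) by simp
    moreover have "smooth_map M round_sphere \<phi>" using assms(3) unfolding biharmonic_def by (elim conjE)
    ultimately show ?thesis unfolding harmonic_def by simp
  next
    case nonharmonic: False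
    have c0: "c \<noteq> 0"
    proof
      assume c: "c = 0"
      have "T p = 0" if p: "p \<in> X" for p
      proof -
        obtain d where d: "d \<in> atlas M" "p \<in> chart_dom d" using chart_exists[OF p] by (elim bexE)
        interpret C: sphere_rep M d "cimg d" "\<phi> \<circ> chart_inv d" by (rule sphere_rep[OF sm d(1)])
        have x: "chart_map d p \<in> cimg d" using d(2) by (rule imageI)
        have "lap M d (\<phi> \<circ> chart_inv d) (chart_map d p) = 0"
          by (rule C.lap_eq_0_of_grad_inner_eq_0[OF C.smooth_u _ x]) (simp only: chart(3)[OF d(1)] c)
        then show ?thesis
          using chart(1)[OF d(1) x] unfolding chart_inv_left[OF d] by (simp add: T_def c)
      qed
      with nonharmonic show False by simp
    qed
    \<comment> \<open>No regularity of \<open>\<mu>\<close> is assumed; \<open>m\<close> is smooth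
      by construction and agrees with it on \<open>X\<close>.\<close>
    define m where "m p = (LL p \<bullet> \<phi> p) / c" for p
    have m_mu: "m p = \<mu> p" if "p \<in> X" for p
      unfolding m_def mu[OF that] using pt(2)[OF that] c0 by simp
    have "smooth_fun m"
      unfolding smooth_fun_def
    proof
      fix d assume d: "d \<in> atlas M"
      have "smooth_on (cimg d) (\<lambda>x. LL (chart_inv d x))" "smooth_on (cimg d) (\<lambda>x. \<phi> (chart_inv d x))"
        using sLL sf d unfolding smooth_fun_def o_def by (blast+)
      then have "smooth_on (cimg d) (\<lambda>x. inverse c * (LL (chart_inv d x) \<bullet> \<phi> (chart_inv d x)))"
        by (intro smooth_intros open_cimg[OF d])
      then show "smooth_on (cimg d) (m \<circ> chart_inv d)"
        by (simp add: m_def o_def divide_inverse mult.commute)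
    qed
    then have cm: "continuous_map (mtop M) euclidean m" by (rule smooth_fun_continuous)
    have closed_m: "closedin (mtop M) {p \<in> X. m p = y}" for y
      using closedin_continuous_map_preimage[OF cm, of "{y}"] by simp
    have mu_c: "m p = c" if p: "p \<in> X" and m: "m p \<noteq> 2 * c" for p
    proof -
      obtain d where d: "d \<in> atlas M" "p \<in> chart_dom d" using chart_exists[OF p] by (elim bexE)
      let ?u = "\<phi> \<circ> chart_inv d"
      interpret C: sphere_rep M d "cimg d" ?u by (rule sphere_rep[OF sm d(1)])
      \<comment> \<open>An open set, so \<open>T\<close> vanishes on a full neighbourhood of
        \<open>p\<close> and the Laplacian may be applied to the resulting equation for
        \<open>\<phi>\<close>.\<close>
      define A where "A = (X - {p \<in> X. m p = 2 * c}) \<inter> chart_dom d"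
      have A: "openin (mtop M) A" unfolding A_def
        using closed_m[of "2 * c"] openin_chart_dom[OF d(1)] by (intro openin_Int openin_diff openin_topspace)
      have oA: "open (chart_map d ` A)" by (rule open_chart_image[OF d(1) A]) (simp only: A_def Int_lower2)
      have pA: "p \<in> A" using p d(2) m by (simp add: A_def)
      have u_eq: "lap M d ?u y = (- c) *\<^sub>R ?u y" if y: "y \<in> chart_map d ` A" for y
      proof -
        from y obtain q where q: "q \<in> A" "y = chart_map d q" by (elim imageE)
        have qX: "q \<in> X" "m q \<noteq> 2 * c" "q \<in> chart_dom d" using q(1) by (simp_all add: A_def)
        then have "T q = 0" using pt(3)[OF qX(1)] m_mu[OF qX(1)] by simp
        then show ?thesis
          using chart(1)[OF d(1) imageI[OF qX(3)]] unfolding chart_inv_left[OF d(1) qX(3)] q(2)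
          by (simp add: T_def d(1) qX(3) eq_neg_iff_add_eq_0)
      qed
      let ?x = "chart_map d p"
      have x: "?x \<in> cimg d" "?x \<in> chart_map d ` A" by (rule imageI, fact)+
      have "lap M d (lap M d ?u) ?x = lap M d (\<lambda>y. (- c) *\<^sub>R ?u y) ?x"
        by (rule lap_cong_open[OF oA x(2)]) (rule u_eq)
      also have "\<dots> = (- c) *\<^sub>R lap M d ?u ?x"
        by (rule C.lap_bounded_linear[OF bounded_linear_scaleR_right x(1) C.smooth_u])
      finally have "LL p = (- c) *\<^sub>R L p"
        using chart(1,2)[OF d(1) x(1)] unfolding chart_inv_left[OF d] by simp
      then show ?thesis unfolding m_def using pt(2)[OF p] c0 by simp
    qed
    let ?S = "{p \<in> X. m p = 2 * c}"
    \<comment> \<open>Since \<open>c\<close> and \<open>2 * c\<close> are distinct, the complement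
      of \<open>?S\<close> is itself a level set and hence closed; \<open>?S\<close> is therefore
      both open and closed.\<close>
    have "X - ?S = {p \<in> X. m p = c}" using mu_c c0 by auto
    then have "openin (mtop M) (X - (X - ?S))" using closed_m[of c] by (intro openin_diff openin_topspace) simp
    then have "openin (mtop M) ?S" by (simp add: double_diff)
    then have "?S = {} \<or> ?S = X"
      using assms(2) closed_m[of "2 * c"] unfolding connected_space_clopen_in by blast
    moreover have "?S \<noteq> {}"
    proof -
      obtain p where p: "p \<in> X" "T p \<noteq> 0" using nonharmonic by blast
      then have "m p = 2 * c" using pt(3)[OF p(1)] m_mu[OF p(1)] by simp
      then show ?thesis using p(1) by blast
    qed
    ultimately have "m p = 2 * c" if "p \<in> X" for p using that by blast
    then show ?thesis using m_mu by simp
  qed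
qed

end
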